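(* Let $n\ge 2$, let $q$ be a power of a prime $p$ that is good and regular for the root system $\Phi$ of type $A_{n-1}$, and let $G=SL_n$ over $\overline{\mathbb{F}}_q$ with its split Frobenius map $F$, so that $G^F=SL(n,q)$ acts on $\mathfrak{g}^F=sl(n,q)$ by the adjoint action. Then for every proper subset $J\subsetneq\tilde{\Pi}$, the number of semisimple orbits of $SL(n,q)$ on $sl(n,q)$ of genus $(J,[\mathrm{id}])$ is equal to $$\frac{\sum_{S\sim J}p(S,q)}{f},$$ the sum being over proper subsets $S$ of $\tilde{\Pi}$ with $S\sim J$. Furthermore, for every partition $\lambda=(i^{r_i})$ of $n$, the number of split semisimple orbits of $SL(n,q)$ on $sl(n,q)$ of genus $\lambda$ is equal to $$\frac{(q-1)(q-2)\cdots(q+1-\sum_i r_i)}{r_1!\cdots r_n!},$$ where the numerator is $\prod_{k=1}^{(\sum_i r_i)-1}(q-k)$ (an empty product being $1$).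
   Context: Root system notation (here for $\Phi$ of type $A_{n-1}$, Weyl group $W=S_n$): $\Phi$ spans the real inner product space $V$. The coroots are $2\alpha/\langle\alpha,\alpha\rangle$, $\alpha\in\Phi$; $L$ is the lattice generated by the coroots; $\hat{L}=\{v\in V:\langle v,\alpha\rangle\in\mathbb{Z}\text{ for all }\alpha\in\Phi\}$; $f=[\hat{L}:L]$. $\Pi$ is a set of simple roots in a positive system, $\theta$ is the highest root, $\alpha_0=-\theta$, $\tilde{\Pi}=\Pi\cup\{\alpha_0\}$, and the positive integers $c_\alpha$ are defined by $\sum_{\alpha\in\tilde{\Pi}}c_\alpha\alpha=0$, $c_{\alpha_0}=1$. For proper subsets $S_1,S_2$ of $\tilde{\Pi}$, $S_1\sim S_2$ means $w(S_1)=S_2$ for some $w\in W$. For $S\subsetneq\tilde{\Pi}$ and a positive integer $t$, $p(S,t)$ is the number of solutions $(y_\alpha)_{\alpha\in\tilde{\Pi}-S}$ in strictly positive integers of $\sum_{\alpha\in\tilde{\Pi}-S}c_\alpha y_\alpha=t$. A prime $p$ is bad if it divides the coefficient of some root when expressed as a combination of simple roots; otherwise it is good (all primes are good in type $A$). A prime $p$ is regular if the lattice of intersections of the hyperplanes $\{\alpha=0\}$, $\alpha\in\Phi$, remains the same upon reduction mod $p$; that is, for subsets $A,B\subset\Phi$, the common zero sets of $A$ and of $B$ coincide in $L\otimes\overline{\mathbb{F}}_p$ (roots viewed as linear forms via their pairing with $L$) if and only if they coincide in $V$. In type $A_{n-1}$ a prime dividing $n$ is not regular. Genus: two semisimple elements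 $x,y\in\mathfrak{g}^F$ are in the same genus if $C_G(x)$ and $C_G(y)$ (centralizers under the adjoint action) are conjugate by an element of $G^F$. Let $T$ be a split $F$-stable maximal torus of $G$ (e.g. the diagonal torus) with root subgroups $U_\alpha$. A semisimple $x\in\mathfrak{g}^F$ has genus $(J,[\mathrm{id}])$ if $C_G(x)$ is $G^F$-conjugate to the group generated by $T$ and the root groups $U_{\pm\alpha}$, $\alpha\in J$; elements and orbits with such a genus are called split. Split semisimple orbits of $SL(n,q)$ on $sl(n,q)$ correspond (via the characteristic polynomial) to monic degree $n$ polynomials over $\mathbb{F}_q$ that factor into linear polynomials and have vanishing coefficient of $x^{n-1}$. The split genera are parametrized by partitions $\lambda=(i^{r_i})$ of $n$ (with $r_i$ parts equal to $i$): the orbit has genus $\lambda$ if, for each $i$, exactly $r_i$ distinct linear factors of the polynomial occur with multiplicity $i$. The genus $(J,[\mathrm{id}])$ corresponds to $\lambda$ when the subgroup $W_J$ generated by the reflections in the roots of $J$ is conjugate to $\prod_i S_i^{r_i}$ (the Young subgroup of type $\lambda$). *)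

theory Defs
  imports
    "HOL-Analysis.Analysis"
    "HOL-Algebra.Generated_Groups"
    "HOL-Computational_Algebra.Polynomial"
    "HOL-Library.FuncSet"
    "HOL-Library.Poly_Mapping"
begin

definition simple_system :: "'v::euclidean_space set \<Rightarrow> 'v set \<Rightarrow> bool" where
  "simple_system \<Phi> \<Delta> \<longleftrightarrow> \<Delta> \<subseteq> \<Phi> \<and> independent \<Delta> \<and> \<Phi> \<subseteq> span \<Delta> \<and>
     (\<forall>\<alpha>\<in>\<Phi>. (\<forall>\<beta>\<in>\<Delta>. representation \<Delta> \<alpha> \<beta> \<ge> 0) \<or> (\<forall>\<beta>\<in>\<Delta>. representation \<Delta> \<alpha> \<beta> \<le> 0))"

(* Meaningful for irreducible \<Phi>, where such a root exists and is unique. *)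
definition highest_root :: "'v::euclidean_space set \<Rightarrow> 'v set \<Rightarrow> 'v" where
  "highest_root \<Phi> \<Delta> =
     (THE \<theta>. \<theta> \<in> \<Phi> \<and> (\<forall>\<alpha>\<in>\<Phi>. \<forall>\<beta>\<in>\<Delta>. representation \<Delta> \<alpha> \<beta> \<le> representation \<Delta> \<theta> \<beta>))"

definition extended_simple :: "'v::euclidean_space set \<Rightarrow> 'v set \<Rightarrow> 'v set" where
  "extended_simple \<Phi> \<Delta> = insert (- highest_root \<Phi> \<Delta>) \<Delta>"

definition marks :: "'v::euclidean_space set \<Rightarrow> 'v set \<Rightarrow> 'v \<Rightarrow> nat" where
  "marks \<Phi> \<Delta> =
     (THE c. (\<Sum>\<alpha>\<in>extended_simple \<Phi> \<Delta>. real (c \<alpha>) *\<^sub>R \<alpha>) = 0 \<and>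
             c (- highest_root \<Phi> \<Delta>) = 1 \<and>
             (\<forall>\<alpha>. \<alpha> \<notin> extended_simple \<Phi> \<Delta> \<longrightarrow> c \<alpha> = 0))"

definition num_solutions :: "'v::euclidean_space set \<Rightarrow> 'v set \<Rightarrow> 'v set \<Rightarrow> nat \<Rightarrow> nat" where
  "num_solutions \<Phi> \<Delta> S t =
     card {y \<in> (extended_simple \<Phi> \<Delta> - S) \<rightarrow>\<^sub>E {0<..}.
             (\<Sum>\<alpha>\<in>extended_simple \<Phi> \<Delta> - S. marks \<Phi> \<Delta> \<alpha> * y \<alpha>) = t}"

definition root_reflection :: "'v::euclidean_space \<Rightarrow> 'v \<Rightarrow> 'v" where
  "root_reflection \<alpha> v = v - (2 * (v \<bullet> \<alpha>) / (\<alpha> \<bullet> \<alpha>)) *\<^sub>R \<alpha>"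

(* Elements of W are taken as automorphisms of the whole ambient space; they fix the
   orthogonal complement of span \<Phi> pointwise. *)
definition weyl_group :: "'v::euclidean_space set \<Rightarrow> ('v \<Rightarrow> 'v) set" where
  "weyl_group \<Phi> =
     generate \<lparr>carrier = {w. linear w \<and> bij w}, mult = (\<circ>), one = id\<rparr> (root_reflection ` \<Phi>)"

definition weyl_equiv :: "'v::euclidean_space set \<Rightarrow> 'v set \<Rightarrow> 'v set \<Rightarrow> bool" where
  "weyl_equiv \<Phi> S1 S2 \<longleftrightarrow> (\<exists>w\<in>weyl_group \<Phi>. w ` S1 = S2)"

definition coroot_lattice :: "'v::euclidean_space set \<Rightarrow> 'v set" where
  "coroot_lattice \<Phi> =
     range (\<lambda>k :: 'v \<Rightarrow> int. \<Sum>\<alpha>\<in>\<Phi>. of_int (k \<alpha>) *\<^sub>R ((2 / (\<alpha> \<bullet> \<alpha>)) *\<^sub>R \<alpha>))"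

definition coweight_lattice :: "'v::euclidean_space set \<Rightarrow> 'v set" where
  "coweight_lattice \<Phi> = {v \<in> span \<Phi>. \<forall>\<alpha>\<in>\<Phi>. v \<bullet> \<alpha> \<in> \<int>}"

definition lattice_index :: "'v::euclidean_space set \<Rightarrow> nat" where
  "lattice_index \<Phi> =
     card (rcosets\<^bsub>\<lparr>carrier = coweight_lattice \<Phi>, mult = (+), one = 0\<rparr>\<^esub> (coroot_lattice \<Phi>))"

(* Zero coefficients are excluded: every prime divides 0. *)
definition good_prime :: "'v::euclidean_space set \<Rightarrow> 'v set \<Rightarrow> nat \<Rightarrow> bool" where
  "good_prime \<Phi> \<Delta> p \<longleftrightarrow>
     \<not> (\<exists>\<alpha>\<in>\<Phi>. \<exists>\<beta>\<in>\<Delta>. \<exists>c::int. c \<noteq> 0 \<and> representation \<Delta> \<alpha> \<beta> = of_int c \<and> int p dvd c)"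

(* The tensor product of L and 'k over the integers is the free 'k-module on L (the finitely
   supported u with keys u \<subseteq> L, where "single l c" stands for l \<otimes> c) modulo the relations
   (l + m) \<otimes> c = l \<otimes> c + m \<otimes> c. *)
inductive_set tensor_relations :: "'v::euclidean_space set \<Rightarrow> ('v \<Rightarrow>\<^sub>0 'k::field) set"
  for L :: "'v set" where
  zero: "0 \<in> tensor_relations L"
| step: "r \<in> tensor_relations L \<Longrightarrow> l \<in> L \<Longrightarrow> m \<in> L \<Longrightarrow>
    r + (Poly_Mapping.single (l + m) c - Poly_Mapping.single l c - Poly_Mapping.single m c)
      \<in> tensor_relations L"

definition tensor_class :: "'v::euclidean_space set \<Rightarrow> ('v \<Rightarrow>\<^sub>0 'k::field) \<Rightarrow> ('v \<Rightarrow>\<^sub>0 'k) set" where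
  "tensor_class L u = {u + r | r. r \<in> tensor_relations L}"

(* The linear form on the tensor product induced by pairing with \<alpha>, on representatives.
   On the coroot lattice the pairing is integral, so the floor is exact. *)
definition tensor_pairing :: "'v::euclidean_space \<Rightarrow> ('v \<Rightarrow>\<^sub>0 'k::field) \<Rightarrow> 'k" where
  "tensor_pairing \<alpha> u =
     (\<Sum>l\<in>Poly_Mapping.keys u. of_int \<lfloor>l \<bullet> \<alpha>\<rfloor> * Poly_Mapping.lookup u l)"

definition zero_set_mod ::
    "'v::euclidean_space set \<Rightarrow> 'v set \<Rightarrow> ('v \<Rightarrow>\<^sub>0 'k::field) set set" where
  "zero_set_mod \<Phi> A =
     tensor_class (coroot_lattice \<Phi>) `
       {u. Poly_Mapping.keys u \<subseteq> coroot_lattice \<Phi> \<and> (\<forall>\<alpha>\<in>A. tensor_pairing \<alpha> u = 0)}"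

definition zero_set :: "'v::euclidean_space set \<Rightarrow> 'v set \<Rightarrow> 'v set" where
  "zero_set \<Phi> A = {v \<in> span \<Phi>. \<forall>\<alpha>\<in>A. v \<bullet> \<alpha> = 0}"

(* Regularity of the prime CHAR('k), where 'k is an algebraic closure of the prime field. *)
definition regular_char :: "'k::field itself \<Rightarrow> 'v::euclidean_space set \<Rightarrow> bool" where
  "regular_char _ \<Phi> \<longleftrightarrow>
     (\<forall>A B. A \<subseteq> \<Phi> \<longrightarrow> B \<subseteq> \<Phi> \<longrightarrow>
        (zero_set_mod \<Phi> A = (zero_set_mod \<Phi> B :: ('v \<Rightarrow>\<^sub>0 'k) set set) \<longleftrightarrow>
         zero_set \<Phi> A = zero_set \<Phi> B))"

definition roots_A :: "(real^'n) set" where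
  "roots_A = {axis i 1 - axis j 1 | i j. i \<noteq> j}"

definition SL :: "('k::field^'n^'n) set" where
  "SL = {g. det g = 1}"

definition sl :: "('k::field^'n^'n) set" where
  "sl = {x. trace x = 0}"

definition Ad :: "'k::field^'n^'n \<Rightarrow> 'k^'n^'n \<Rightarrow> 'k^'n^'n" where
  "Ad g x = g ** x ** matrix_inv g"

(* Matrices live over an algebraic closure 'k of the finite field, so that SL is the algebraic
   group; SL(n,q) and sl(n,q) are the fixed points SL_F q and sl_F q of the Frobenius map. *)
definition frob :: "nat \<Rightarrow> 'k::field^'n^'n \<Rightarrow> 'k^'n^'n" where
  "frob q x = (\<chi> i j. (x $ i $ j) ^ q)"

definition SL_F :: "nat \<Rightarrow> ('k::field^'n^'n) set" where
  "SL_F q = {g \<in> SL. frob q g = g}"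

definition sl_F :: "nat \<Rightarrow> ('k::field^'n^'n) set" where
  "sl_F q = {x \<in> sl. frob q x = x}"

definition diagonal_mat :: "'k::field^'n^'n \<Rightarrow> bool" where
  "diagonal_mat x \<longleftrightarrow> (\<forall>i j. i \<noteq> j \<longrightarrow> x $ i $ j = 0)"

(* Intended for algebraically closed 'k, where semisimple means diagonalizable over 'k. *)
definition semisimple_mat :: "'k::field^'n^'n \<Rightarrow> bool" where
  "semisimple_mat x \<longleftrightarrow> (\<exists>P. invertible P \<and> diagonal_mat (Ad P x))"

definition SL_centralizer :: "'k::field^'n^'n \<Rightarrow> ('k^'n^'n) set" where
  "SL_centralizer x = {g \<in> SL. Ad g x = x}"

definition torus :: "('k::field^'n^'n) set" where
  "torus = {g \<in> SL. diagonal_mat g}"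

definition root_subgroup :: "real^'n \<Rightarrow> ('k::field^'n^'n) set" where
  "root_subgroup \<alpha> =
     {mat 1 + (\<chi> a b. if a = i \<and> b = j then t else 0) | i j t. i \<noteq> j \<and> \<alpha> = axis i 1 - axis j 1}"

definition levi :: "(real^'n) set \<Rightarrow> ('k::field^'n^'n) set" where
  "levi J = generate \<lparr>carrier = SL, mult = (**), one = mat 1\<rparr>
              (torus \<union> (\<Union>\<alpha>\<in>J. root_subgroup \<alpha> \<union> root_subgroup (- \<alpha>)))"

definition has_genus_id :: "nat \<Rightarrow> (real^'n) set \<Rightarrow> 'k::field^'n^'n \<Rightarrow> bool" where
  "has_genus_id q J x \<longleftrightarrow> (\<exists>g\<in>SL_F q. Ad g ` SL_centralizer x = levi J)"

definition orbit :: "nat \<Rightarrow> 'k::field^'n^'n \<Rightarrow> ('k^'n^'n) set" where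
  "orbit q x = (\<lambda>g. Ad g x) ` SL_F q"

definition charpoly :: "'k::field^'n^'n \<Rightarrow> 'k poly" where
  "charpoly x = det (\<chi> i j. (if i = j then [:0, 1:] else 0) - [:x $ i $ j:])"

(* Only linear factors over the field with q elements are counted. *)
definition has_genus_partition :: "nat \<Rightarrow> (nat \<Rightarrow> nat) \<Rightarrow> 'k::field^'n^'n \<Rightarrow> bool" where
  "has_genus_partition q r x \<longleftrightarrow>
     (\<forall>i\<in>{1..CARD('n)}. card {a. a ^ q = a \<and> Polynomial.order a (charpoly x) = i} = r i)"

definition orbits_of_genus_id :: "nat \<Rightarrow> (real^'n) set \<Rightarrow> ('k::field^'n^'n) set set" where
  "orbits_of_genus_id q J = orbit q ` {x \<in> sl_F q. semisimple_mat x \<and> has_genus_id q J x}"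

definition split_orbits_of_partition ::
    "(real^'n) set \<Rightarrow> nat \<Rightarrow> (nat \<Rightarrow> nat) \<Rightarrow> ('k::field^'n^'n) set set" where
  "split_orbits_of_partition \<Delta> q r =
     orbit q ` {x \<in> sl_F q. semisimple_mat x \<and>
                  (\<exists>J. J \<subset> extended_simple roots_A \<Delta> \<and> has_genus_id q J x) \<and>
                  has_genus_partition q r x}"

end

theory Submission
  imports Defs "HOL-Combinatorics.Multiset_Permutations"
begin

text \<open>
  If the centralizer of \<open>x\<close> is conjugate over the finite field to the group \<open>levi J\<close>, then it
  contains a conjugate of the diagonal torus, so \<open>x\<close> is conjugate to a diagonal matrix with entries
  in the field \<open>F\<close> of \<open>q\<close> elements, two of which agree iff their positions lie in the same component
  of the graph with edge set \<open>J\<close>. Orbits therefore correspond to multisets over \<open>F\<close> with sum 0 whose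
  multiplicities are the component sizes. Regularity says that \<open>n\<close> is invertible in \<open>F\<close>, so
  translations distribute all multisets with these multiplicities evenly over the \<open>q\<close> possible sums,
  and their number is a multinomial coefficient.

  On the combinatorial side the extended simple system is a directed \<open>n\<close>-cycle with all marks 1, so
  that \<open>p(S, q)\<close> is the binomial coefficient of \<open>q - 1\<close> over \<open>m - 1\<close>, where \<open>m\<close> is the number of components of \<open>S\<close>.
  A proper subset together with an omitted edge is a composition of \<open>n\<close>, and \<open>S \<sim> J\<close> iff the
  component sizes agree, so counting pairs in two ways gives the size of the class of \<open>J\<close>.
\<close>

section \<open>The finite field and regular primes\<close>

text \<open>The centralizers and \<open>levi J\<close> are groups over the algebraic closure, so
  their torus separates coordinates even for q = 2, where SL(n,q) has no diagonal element but 1.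
  Only the conjugating element is Frobenius-fixed, and that is what puts the eigenvalues in
  \<open>F\<close>. The genus condition becomes combinatorial once \<open>levi J\<close> is
  identified with the block matrices of the components of \<open>J\<close>, by Gaussian elimination
  with transvections inside the blocks. Equal spectra give a single orbit because a permutation
  matrix can be corrected by a sign to determinant 1. Both counts end in (q-1)...(q-m+1) /
  (r_1!...r_n!), with m the number of parts. For multisets, the leading factor q of the falling
  factorial is shared out among the q possible sums. On the root side the class of \<open>J\<close>
  has n * m! / (m * r_1!...r_n!) members: the n edges at which the cycle may be cut cancel f = n,
  and dividing by the m omitted edges leaves the (m-1)! that clears the denominator of the binomial
  coefficient. Every partition is the type of some proper \<open>J\<close>, which reduces the second
  claim to the same count.\<close>

locale finite_subfield =
  fixes p e q :: nat and F :: "'k::alg_closed_field set"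
  assumes prime_p: "prime p" and char_p: "CHAR('k) = p" and e_pos: "e \<ge> 1"
    and q_eq: "q = p ^ e" and F_eq: "F = {a. a ^ q = a}"
begin

lemma q_gt_1: "q > 1"
  using prime_gt_1_nat[OF prime_p] e_pos by (simp add: q_eq one_less_power del: One_nat_def)

lemma frobenius_add: "(x + y :: 'k) ^ q = x ^ q + y ^ q"
  by (rule freshmans_dream') (simp_all add: prime_p char_p q_eq)

lemma frobenius_sum: "(sum f A :: 'k) ^ q = (\<Sum>i\<in>A. f i ^ q)"
  by (rule freshmans_dream_sum') (simp_all add: prime_p char_p q_eq)

lemma frobenius_uminus: "(- x :: 'k) ^ q = - (x ^ q)"
proof -
  have "(- x) ^ q + x ^ q = 0"
    using frobenius_add[of "- x" x] q_gt_1 by (simp add: power_0_left)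
  then show ?thesis by (simp add: eq_neg_iff_add_eq_0)
qed

lemma F_iff: "a \<in> F \<longleftrightarrow> a ^ q = a"
  by (simp add: F_eq)

lemma F_0: "0 \<in> F" and F_1: "1 \<in> F"
  using q_gt_1 by (auto simp: F_iff)

lemma F_add: "a \<in> F \<Longrightarrow> b \<in> F \<Longrightarrow> a + b \<in> F"
  by (simp add: F_iff frobenius_add)

lemma F_uminus: "a \<in> F \<Longrightarrow> - a \<in> F"
  by (simp add: F_iff frobenius_uminus)

lemma F_mult: "a \<in> F \<Longrightarrow> b \<in> F \<Longrightarrow> a * b \<in> F"
  by (simp add: F_iff power_mult_distrib)

lemma F_inverse: "a \<in> F \<Longrightarrow> inverse a \<in> F"
  by (simp add: F_iff power_inverse)

lemma F_of_nat: "of_nat m \<in> F"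
  by (induction m) (auto intro: F_0 F_1 F_add)

text \<open>\<open>F\<close> is the root set of X^q - X. This polynomial splits over
  \<open>'k\<close>, and its derivative is -1 because q vanishes in \<open>'k\<close>, so its q
  roots are distinct.\<close>

lemma finite_F: "finite F" and card_F: "card F = q"
proof -
  define P :: "'k poly" where "P = monom 1 q - [:0, 1:]"
  have deg: "degree P = q"
    unfolding P_def diff_conv_add_uminus using q_gt_1
    by (subst degree_add_eq_left) (simp_all add: degree_monom_eq)
  then have P0: "P \<noteq> 0" using q_gt_1 by auto
  have root: "poly P a = 0 \<longleftrightarrow> a \<in> F" for a
    by (simp add: P_def F_iff poly_monom)
  have q0: "of_nat q = (0 :: 'k)"
    using e_pos by (simp add: of_nat_eq_0_iff_char_dvd char_p q_eq)
  have pd: "pderiv P = - 1"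
    by (simp add: P_def pderiv_diff pderiv_monom q0 pderiv_pCons one_pCons)
  obtain A where A: "size A = degree P" "P = smult (lead_coeff P) (\<Prod>x\<in>#A. [:-x, 1:])"
    using alg_closed_imp_factorization[OF P0] by blast
  \<comment> \<open>A root counted twice would also be a root of the derivative.\<close>
  have count_le: "count A a \<le> 1" for a
  proof (rule ccontr)
    assume "\<not> count A a \<le> 1"
    then have "{#a, a#} \<subseteq># A"
      by (auto simp: subseteq_mset_def)
    then obtain B where B: "A = {#a, a#} + B" by (metis mset_subset_eq_exists_conv)
    obtain R where R: "P = [:-a, 1:] * ([:-a, 1:] * R)"
      using A(2) unfolding B by (metis (no_types, lifting) image_mset_add_mset image_mset_union
        mult_smult_right prod_mset.add_mset union_mset_add_mset_left add_0 mult.assoc)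
    have "poly (pderiv P) a = 0"
      unfolding R pderiv_mult by simp
    then show False by (simp add: pd)
  qed
  have "poly P a = 0 \<longleftrightarrow> a \<in># A" for a
    by (subst A(2)) (use P0 in \<open>auto simp: poly_prod_mset\<close>)
  then have FA: "F = set_mset A" using root by auto
  show "finite F" by (simp add: FA)
  have "A = mset_set (set_mset A)"
    using count_le by (intro multiset_eqI)
      (metis One_nat_def count_eq_zero_iff count_mset_set(1,3) finite_set_mset le_Suc_eq le_zero_eq)
  then have "size A = card (set_mset A)"
    by (metis size_mset_set)
  then show "card F = q" using A(1) deg FA by simp
qed

end

section \<open>Type A: coroot lattice, span of the roots, and what regularity says about n\<close>

lemma sum_axis_diff: "(\<Sum>i\<in>UNIV. (axis a 1 - axis b 1 :: real^'n) $ i) = 0"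
  by (simp add: sum_subtractf) (simp add: axis_def)

lemma inner_axis_diff: "v \<bullet> (axis a 1 - axis b 1 :: real^'n) = v $ a - v $ b"
  by (simp add: inner_diff_right inner_axis)

lemma axis_diff_norm: "a \<noteq> b \<Longrightarrow> (axis a 1 - axis b 1 :: real^'n) \<bullet> (axis a 1 - axis b 1) = 2"
  by (simp add: inner_axis_diff) (simp add: axis_def)

lemma axis_diff_eq_iff:
  assumes "a \<noteq> b"
  shows "(axis a 1 - axis b 1 :: real^'n) = axis c 1 - axis d 1 \<longleftrightarrow> a = c \<and> b = d"
proof
  assume eq: "(axis a 1 - axis b 1 :: real^'n) = axis c 1 - axis d 1"
  have "(axis a 1 - axis b 1 :: real^'n) $ a = (axis c 1 - axis d 1) $ a"
       "(axis a 1 - axis b 1 :: real^'n) $ b = (axis c 1 - axis d 1) $ b"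
    using eq by auto
  then show "a = c \<and> b = d"
    using assms by (auto simp: axis_def split: if_splits)
qed auto

lemma finite_roots_A [simp]: "finite (roots_A :: (real^'n) set)"
  by (rule finite_subset[of _ "range (\<lambda>(i, j). axis i 1 - axis j 1)"]) (auto simp: roots_A_def)

lemma root_norm: "\<alpha> \<in> (roots_A :: (real^'n) set) \<Longrightarrow> \<alpha> \<bullet> \<alpha> = 2"
  by (auto simp: roots_A_def axis_diff_norm)

text \<open>Roots with squared length 2 are their own coroots. An integral vector of sum 0 is the
  combination of the roots \<open>axis i 1 - axis i0 1\<close> with its own coordinates as
  coefficients.\<close>

lemma coroot_lattice_A:
  "coroot_lattice (roots_A :: (real^'n) set) = {v. (\<forall>i. v $ i \<in> \<int>) \<and> (\<Sum>i\<in>UNIV. v $ i) = 0}"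
proof -
  have L: "coroot_lattice (roots_A :: (real^'n) set) =
      range (\<lambda>k :: real^'n \<Rightarrow> int. \<Sum>\<alpha>\<in>roots_A. of_int (k \<alpha>) *\<^sub>R \<alpha>)"
    unfolding coroot_lattice_def by (intro image_cong refl sum.cong) (auto simp: root_norm)
  have int: "\<alpha> $ i \<in> \<int>" if "\<alpha> \<in> roots_A" for \<alpha> :: "real^'n" and i
    using that by (auto simp: roots_A_def axis_def)
  have sum0: "(\<Sum>i\<in>UNIV. \<alpha> $ i) = 0" if "\<alpha> \<in> roots_A" for \<alpha> :: "real^'n"
    using that by (auto simp: roots_A_def sum_axis_diff[simplified])
  show ?thesis
  proof (intro equalityI subsetI)
    fix v :: "real^'n" assume "v \<in> coroot_lattice roots_A"
    then obtain k :: "real^'n \<Rightarrow> int" where v: "v = (\<Sum>\<alpha>\<in>roots_A. of_int (k \<alpha>) *\<^sub>R \<alpha>)"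
      by (auto simp: L)
    have "(\<Sum>i\<in>UNIV. v $ i) = (\<Sum>\<alpha>\<in>roots_A. of_int (k \<alpha>) * (\<Sum>i\<in>UNIV. \<alpha> $ i))"
      unfolding v by (simp add: sum_distrib_left) (rule sum.swap)
    then show "v \<in> {v. (\<forall>i. v $ i \<in> \<int>) \<and> (\<Sum>i\<in>UNIV. v $ i) = 0}"
      using int by (auto simp: v sum0 intro!: Ints_sum Ints_mult)
  next
    fix v :: "real^'n" assume v: "v \<in> {v. (\<forall>i. v $ i \<in> \<int>) \<and> (\<Sum>i\<in>UNIV. v $ i) = 0}"
    define i0 :: 'n where "i0 = undefined"
    \<comment> \<open>The coefficients must be a function of the root, so the index is recovered
      from the vector; roots not ending in \<open>i0\<close> get 0.\<close>
    define k :: "real^'n \<Rightarrow> int" where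
      "k \<alpha> = (if \<exists>i. i \<noteq> i0 \<and> \<alpha> = axis i 1 - axis i0 1
              then \<lfloor>v $ (THE i. i \<noteq> i0 \<and> \<alpha> = axis i 1 - axis i0 1)\<rfloor> else 0)" for \<alpha>
    have k: "k (axis i 1 - axis i0 1) = \<lfloor>v $ i\<rfloor>" if "i \<noteq> i0" for i
    proof -
      have "(THE j. j \<noteq> i0 \<and> (axis i 1 - axis i0 1 :: real^'n) = axis j 1 - axis i0 1) = i"
        using that by (intro the_equality) (auto simp: axis_diff_eq_iff)
      then show ?thesis using that by (auto simp: k_def)
    qed
    have inj: "inj_on (\<lambda>i. axis i 1 - axis i0 1 :: real^'n) (UNIV - {i0})"
      by (auto simp: inj_on_def axis_diff_eq_iff)
    have "(\<Sum>\<alpha>\<in>roots_A. of_int (k \<alpha>) *\<^sub>R \<alpha>) =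
        (\<Sum>\<alpha>\<in>(\<lambda>i. axis i 1 - axis i0 1 :: real^'n) ` (UNIV - {i0}). of_int (k \<alpha>) *\<^sub>R \<alpha>)"
      by (rule sum.mono_neutral_right[OF finite_roots_A]) (auto simp: roots_A_def k_def)
    also have "\<dots> = (\<Sum>i\<in>UNIV - {i0}. v $ i *\<^sub>R (axis i 1 - axis i0 1))"
      by (subst sum.reindex[OF inj]) (use v in \<open>auto simp: k Ints_def intro!: sum.cong\<close>)
    also have "\<dots> = (\<Sum>i\<in>UNIV. v $ i *\<^sub>R (axis i 1 - axis i0 1))"
      by (rule sum.mono_neutral_left) auto
    also have "\<dots> = (\<Sum>i\<in>UNIV. v $ i *\<^sub>R axis i 1) - (\<Sum>i\<in>UNIV. v $ i) *\<^sub>R axis i0 1"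
      by (simp add: scaleR_diff_right sum_subtractf scaleR_sum_left)
    also have "\<dots> = v"
      using v basis_expansion[of v] by (simp add: scalar_mult_eq_scaleR)
    finally show "v \<in> coroot_lattice roots_A"
      unfolding L by (intro image_eqI[of _ _ k]) auto
  qed
qed

lemma span_roots_A: "span (roots_A :: (real^'n) set) = {v. (\<Sum>i\<in>UNIV. v $ i) = 0}"
proof (intro equalityI subsetI)
  fix v :: "real^'n" assume "v \<in> span roots_A"
  then show "v \<in> {v. (\<Sum>i\<in>UNIV. v $ i) = 0}"
    by (rule span_induct)
      (auto simp: subspace_def sum.distrib roots_A_def sum_axis_diff[simplified] simp flip: sum_distrib_left)
next
  fix v :: "real^'n" assume v: "v \<in> {v. (\<Sum>i\<in>UNIV. v $ i) = 0}"
  define i0 :: 'n where "i0 = undefined"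
  have "v = (\<Sum>i\<in>UNIV. v $ i *\<^sub>R axis i 1) - (\<Sum>i\<in>UNIV. v $ i) *\<^sub>R axis i0 1"
    using v basis_expansion[of v] by (simp add: scalar_mult_eq_scaleR)
  also have "\<dots> = (\<Sum>i\<in>UNIV. v $ i *\<^sub>R (axis i 1 - axis i0 1))"
    by (simp add: scaleR_diff_right sum_subtractf scaleR_sum_left)
  also have "\<dots> \<in> span roots_A"
  proof (intro span_sum span_scale)
    fix i show "axis i 1 - axis i0 1 \<in> span (roots_A :: (real^'n) set)"
      by (cases "i = i0") (auto simp: span_zero roots_A_def intro!: span_base)
  qed
  finally show "v \<in> span roots_A" .
qed

lemma exists_other_index:
  assumes "CARD('n::finite) \<ge> 2"
  shows "\<exists>j. j \<noteq> (i :: 'n)"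
proof (rule ccontr)
  assume "\<not> ?thesis"
  then have "UNIV = {i}" by auto
  then have "CARD('n) = 1" by (metis card_1_singleton_iff One_nat_def)
  then show False using assms by simp
qed

text \<open>Let \<open>A\<close> be the roots that avoid one index \<open>i0\<close>. Its zeros are
  the vectors of sum 0 that are constant away from \<open>i0\<close>. If n = 0 in \<open>'k\<close>,
  the sum condition forces the remaining coordinate to agree too, so mod p the zeros of
  \<open>A\<close> are those of all roots; over the reals they are not.\<close>

lemma regular_char_imp_not_dvd:
  assumes "regular_char TYPE('k::field) (roots_A :: (real^'n) set)" "CARD('n) \<ge> 2"
  shows "of_nat (CARD('n)) \<noteq> (0 :: 'k)"
proof
  assume N0: "of_nat (CARD('n)) = (0 :: 'k)"
  define i0 :: 'n where "i0 = undefined"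
  let ?\<Phi> = "roots_A :: (real^'n) set"
  define A :: "(real^'n) set" where "A = {axis i 1 - axis j 1 | i j. i \<noteq> j \<and> i \<noteq> i0 \<and> j \<noteq> i0}"
  have AP: "A \<subseteq> ?\<Phi>" by (auto simp: A_def roots_A_def)
  have key: "(\<forall>\<alpha>\<in>A. tensor_pairing \<alpha> u = 0) \<longleftrightarrow> (\<forall>\<alpha>\<in>?\<Phi>. tensor_pairing \<alpha> u = 0)"
    if u: "Poly_Mapping.keys u \<subseteq> coroot_lattice ?\<Phi>" for u :: "(real^'n) \<Rightarrow>\<^sub>0 'k"
  proof -
    \<comment> \<open>Coordinates of the tensor represented by \<open>u\<close>, under the map
      induced by the inclusion of the coroot lattice in Z^n. The floors are exact there, and
      pairings with roots are differences of these coordinates.\<close>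
    define x :: "'n \<Rightarrow> 'k" where
      "x i = (\<Sum>l\<in>Poly_Mapping.keys u. of_int \<lfloor>l $ i\<rfloor> * Poly_Mapping.lookup u l)" for i
    have l: "(\<forall>i. l $ i \<in> \<int>) \<and> (\<Sum>i\<in>UNIV. l $ i) = 0" if "l \<in> Poly_Mapping.keys u" for l
      using that u by (auto simp: coroot_lattice_A)
    have pair: "tensor_pairing (axis i 1 - axis j 1) u = x i - x j" for i j
    proof -
      have "of_int \<lfloor>l \<bullet> (axis i 1 - axis j 1)\<rfloor> * Poly_Mapping.lookup u l =
          of_int \<lfloor>l $ i\<rfloor> * Poly_Mapping.lookup u l - of_int \<lfloor>l $ j\<rfloor> * Poly_Mapping.lookup u l"
        if lk: "l \<in> Poly_Mapping.keys u" for l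
      proof -
        obtain m n where "l $ i = of_int m" "l $ j = of_int n"
          using l[OF lk] by (metis Ints_cases)
        then show ?thesis
          by (simp add: inner_axis_diff flip: of_int_diff) (simp add: left_diff_distrib)
      qed
      then show ?thesis by (simp add: tensor_pairing_def x_def flip: sum_subtractf)
    qed
    have "(\<Sum>i\<in>UNIV. x i) = (\<Sum>l\<in>Poly_Mapping.keys u. of_int (\<Sum>i\<in>UNIV. \<lfloor>l $ i\<rfloor>) * Poly_Mapping.lookup u l)"
      unfolding x_def by (subst sum.swap) (simp add: sum_distrib_right)
    also have "\<dots> = 0"
    proof (rule sum.neutral, rule ballI)
      fix l assume lk: "l \<in> Poly_Mapping.keys u"
      have "real_of_int (\<Sum>i\<in>UNIV. \<lfloor>l $ i\<rfloor>) = (\<Sum>i\<in>UNIV. l $ i)"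
        unfolding of_int_sum by (rule sum.cong) (use l[OF lk] in \<open>auto simp: of_int_floor\<close>)
      then have "(\<Sum>i\<in>UNIV. \<lfloor>l $ i\<rfloor>) = 0" using l[OF lk] by linarith
      then show "of_int (\<Sum>i\<in>UNIV. \<lfloor>l $ i\<rfloor>) * Poly_Mapping.lookup u l = 0" by simp
    qed
    finally have sum0: "(\<Sum>i\<in>UNIV. x i) = 0" .
    show ?thesis
    proof
      assume *: "\<forall>\<alpha>\<in>A. tensor_pairing \<alpha> u = 0"
      obtain j0 where j0: "j0 \<noteq> i0" using exists_other_index[OF assms(2)] by blast
      have eq: "x i = x j0" if "i \<noteq> i0" for i
      proof (cases "i = j0")
        case False
        then have "axis i 1 - axis j0 1 \<in> A" using that j0 by (auto simp: A_def)
        then show ?thesis using * pair by auto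
      qed simp
      have "(\<Sum>i\<in>UNIV. x i) = x i0 + (\<Sum>i\<in>UNIV - {i0}. x j0)"
        by (subst sum.remove[of _ i0]) (auto intro!: sum.cong simp: eq)
      also have "\<dots> = x i0 + (of_nat (CARD('n)) - 1) * x j0"
        by (simp add: of_nat_diff Suc_le_eq)
      finally have "x i0 = x j0" using sum0 N0 by simp
      then have "x i = x j0" for i using eq by (cases "i = i0") auto
      then show "\<forall>\<alpha>\<in>?\<Phi>. tensor_pairing \<alpha> u = 0"
        using pair by (auto simp: roots_A_def) metis
    qed (use AP in blast)
  qed
  \<comment> \<open>Both sides are images of the same set of representatives, so it is never
    necessary to decide when two representatives give the same tensor.\<close>
  have "zero_set_mod ?\<Phi> A = (zero_set_mod ?\<Phi> ?\<Phi> :: ((real^'n) \<Rightarrow>\<^sub>0 'k) set set)"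
    unfolding zero_set_mod_def using key by (intro arg_cong[where f = "image _"] Collect_cong) blast
  then have eq: "zero_set ?\<Phi> A = zero_set ?\<Phi> ?\<Phi>"
    using assms(1) AP unfolding regular_char_def by blast
  \<comment> \<open>Up to scaling the only vector of sum 0 that is constant away from
    \<open>i0\<close>.\<close>
  define v :: "real^'n" where "v = (\<chi> i. if i = i0 then 1 - real (CARD('n)) else 1)"
  have "(\<Sum>i\<in>UNIV. v $ i) = (1 - real (CARD('n))) + (\<Sum>i\<in>UNIV - {i0}. 1)"
    by (subst sum.remove[of _ i0]) (auto intro!: sum.cong simp: v_def)
  also have "\<dots> = 0" by (simp add: of_nat_diff Suc_le_eq)
  finally have "v \<in> zero_set ?\<Phi> A"
    by (auto simp: zero_set_def span_roots_A A_def inner_axis_diff) (simp add: v_def)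
  then have vz: "v \<in> zero_set ?\<Phi> ?\<Phi>" by (simp add: eq)
  obtain j0 where j0: "j0 \<noteq> i0" using exists_other_index[OF assms(2)] by blast
  have "axis i0 1 - axis j0 1 \<in> ?\<Phi>" using j0 by (auto simp: roots_A_def)
  then have "v $ i0 = v $ j0" using vz by (auto simp: zero_set_def inner_axis_diff)
  then show False using j0 assms(2) by (simp add: v_def)
qed

section \<open>Levi subgroups of SL(n)\<close>

definition diag :: "('n \<Rightarrow> 'k) \<Rightarrow> 'k::zero^'n^'n" where
  "diag d = (\<chi> i j. if i = j then d i else 0)"

definition transv :: "'n \<Rightarrow> 'n \<Rightarrow> 'k \<Rightarrow> 'k::comm_ring_1^'n^'n" where
  "transv a b t = mat 1 + (\<chi> i j. if i = a \<and> j = b then t else 0)"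

lemma diag_nth: "diag d $ i $ j = (if i = j then d i else 0)"
  by (simp add: diag_def)

lemma transv_nth: "transv a b t $ i $ j = (if i = j then 1 else 0) + (if i = a \<and> j = b then t else 0)"
  by (simp add: transv_def mat_def)

lemma diag_mult_nth: "(diag d ** (x :: 'k::comm_ring_1^'n^'n)) $ i $ j = d i * x $ i $ j"
  by (simp add: matrix_matrix_mult_def diag_nth if_distrib[of "\<lambda>x. x * _"] cong: if_cong)

lemma mult_diag_nth: "((x :: 'k::comm_ring_1^'n^'n) ** diag d) $ i $ j = x $ i $ j * d j"
  by (simp add: matrix_matrix_mult_def diag_nth if_distrib[of "\<lambda>x. _ * x"] cong: if_cong)

lemma diagonal_mat_iff_diag: "diagonal_mat x \<longleftrightarrow> x = diag (\<lambda>a. x $ a $ a)"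
  by (auto simp: diagonal_mat_def vec_eq_iff diag_nth)

lemma det_diag: "det (diag d :: 'k::comm_ring_1^'n^'n) = (\<Prod>i\<in>UNIV. d i)"
  by (subst det_diagonal) (auto simp: diag_nth)

lemma transv_mult_nth:
  "(transv a b t ** x) $ i $ j = x $ i $ j + (if i = a then t * x $ b $ j else 0)"
proof -
  have "(transv a b t ** x) $ i $ j =
      (\<Sum>k\<in>UNIV. (if i = k then x $ k $ j else 0) + (if k = b then if i = a then t * x $ k $ j else 0 else 0))"
    unfolding matrix_matrix_mult_def by (auto simp: transv_nth algebra_simps intro!: sum.cong)
  then show ?thesis by (simp add: sum.distrib)
qed

lemma det_transv:
  assumes "a \<noteq> b"
  shows "det (transv a b t :: 'k::comm_ring_1^'n^'n) = 1"
proof -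
  have "transv a b t = (\<chi> k. if k = a then row a (mat 1) + t *s row b (mat 1) else row k (mat 1 :: 'k^'n^'n))"
    using assms by (auto simp: vec_eq_iff transv_nth row_def mat_def)
  then show ?thesis
    using det_row_operation[OF assms, of "mat 1 :: 'k^'n^'n" t] by simp
qed

section \<open>Conjugation and centralizers in SL(n)\<close>

lemma mult_matrix_inv:
  fixes g :: "'k::field^'n^'n"
  assumes "det g \<noteq> 0"
  shows "g ** matrix_inv g = mat 1" "matrix_inv g ** g = mat 1"
proof -
  have "\<exists>h. g ** h = mat 1 \<and> h ** g = mat 1"
    using assms by (simp add: invertible_det_nz flip: invertible_def)
  then have "g ** matrix_inv g = mat 1 \<and> matrix_inv g ** g = mat 1"
    unfolding matrix_inv_def by (rule someI_ex)
  then show "g ** matrix_inv g = mat 1" "matrix_inv g ** g = mat 1" by auto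
qed

lemma matrix_inv_unique_field:
  fixes g :: "'k::field^'n^'n"
  assumes "g ** h = mat 1"
  shows "matrix_inv g = h"
proof -
  have "det g * det h = 1" using assms by (metis det_I det_mul)
  then have "det g \<noteq> 0" by auto
  then have "matrix_inv g = matrix_inv g ** (g ** h)" by (simp add: assms)
  also have "\<dots> = h" using \<open>det g \<noteq> 0\<close> by (simp add: matrix_mul_assoc mult_matrix_inv)
  finally show ?thesis .
qed

abbreviation SL_group :: "('k::field^'n^'n) monoid" where
  "SL_group \<equiv> \<lparr>carrier = SL, mult = (**), one = mat 1\<rparr>"

lemma SL_mult: "g \<in> SL \<Longrightarrow> h \<in> SL \<Longrightarrow> g ** h \<in> SL"
  by (simp add: SL_def det_mul)

lemma SL_one: "mat 1 \<in> SL"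
  by (simp add: SL_def)

lemma SL_det_nz: "g \<in> SL \<Longrightarrow> det g \<noteq> 0"
  by (simp add: SL_def)

lemma SL_inv:
  assumes "g \<in> SL"
  shows "matrix_inv g \<in> SL" "g ** matrix_inv g = mat 1" "matrix_inv g ** g = mat 1"
proof -
  show *: "g ** matrix_inv g = mat 1" "matrix_inv g ** g = mat 1"
    using mult_matrix_inv[OF SL_det_nz[OF assms]] by auto
  show "matrix_inv g \<in> SL"
    using arg_cong[OF *(1), of det] assms by (simp add: det_mul SL_def)
qed

lemma group_SL: "group SL_group"
  by (rule groupI) (auto simp: SL_mult SL_one matrix_mul_assoc intro!: bexI[OF _ SL_inv(1)] SL_inv)

lemma m_inv_SL: "g \<in> SL \<Longrightarrow> m_inv SL_group g = matrix_inv g"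
  by (rule group.inv_equality[OF group_SL]) (auto simp: SL_inv)

lemma Ad_eq_iff:
  assumes "g \<in> SL"
  shows "Ad g x = y \<longleftrightarrow> g ** x = y ** g"
proof
  assume "Ad g x = y"
  then show "g ** x = y ** g"
    using SL_inv[OF assms] by (auto simp: Ad_def simp flip: matrix_mul_assoc)
next
  assume "g ** x = y ** g"
  then show "Ad g x = y"
    using SL_inv[OF assms] by (auto simp: Ad_def simp flip: matrix_mul_assoc)
qed

lemma matrix_inv_mult_SL:
  assumes "g \<in> SL" "h \<in> SL"
  shows "matrix_inv (g ** h) = matrix_inv h ** matrix_inv g"
proof (rule matrix_inv_unique_field)
  have "g ** h ** (matrix_inv h ** matrix_inv g) = g ** (h ** matrix_inv h) ** matrix_inv g"
    by (simp only: matrix_mul_assoc)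
  then show "g ** h ** (matrix_inv h ** matrix_inv g) = mat 1"
    by (simp add: SL_inv(2)[OF assms(1)] SL_inv(2)[OF assms(2)])
qed

lemma Ad_mult:
  assumes "g \<in> SL" "h \<in> SL"
  shows "Ad (g ** h) x = Ad g (Ad h x)"
  by (simp add: Ad_def matrix_inv_mult_SL[OF assms] matrix_mul_assoc)

lemma Ad_one: "Ad (mat 1) x = x"
  by (simp add: Ad_def matrix_inv_unique_field)

lemma Ad_inv_Ad: "g \<in> SL \<Longrightarrow> Ad (matrix_inv g) (Ad g x) = x"
  by (simp add: SL_inv Ad_one flip: Ad_mult)

lemma Ad_Ad_inv: "g \<in> SL \<Longrightarrow> Ad g (Ad (matrix_inv g) x) = x"
  by (simp add: SL_inv Ad_one flip: Ad_mult)

lemma Ad_in_SL: "g \<in> SL \<Longrightarrow> h \<in> SL \<Longrightarrow> Ad g h \<in> SL"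
  by (simp add: Ad_def SL_mult SL_inv)

lemma Ad_mult_distrib:
  assumes "g \<in> SL"
  shows "Ad g (x ** y) = Ad g x ** Ad g y"
proof -
  have "Ad g x ** Ad g y = g ** x ** (matrix_inv g ** g) ** y ** matrix_inv g"
    by (simp only: Ad_def matrix_mul_assoc)
  then show ?thesis by (simp add: SL_inv[OF assms] Ad_def matrix_mul_assoc)
qed

lemma Ad_inj: "g \<in> SL \<Longrightarrow> Ad g x = Ad g y \<longleftrightarrow> x = y"
  by (metis Ad_inv_Ad)

lemma SL_centralizer_iff: "h \<in> SL_centralizer x \<longleftrightarrow> h \<in> SL \<and> h ** x = x ** h"
  by (auto simp: SL_centralizer_def Ad_eq_iff)

lemma Ad_image_SL_centralizer:
  assumes "g \<in> SL"
  shows "Ad g ` SL_centralizer x = SL_centralizer (Ad g x)"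
proof (intro equalityI subsetI)
  fix h assume "h \<in> Ad g ` SL_centralizer x"
  then obtain k where k: "k \<in> SL" "k ** x = x ** k" "h = Ad g k"
    by (auto simp: SL_centralizer_iff)
  then show "h \<in> SL_centralizer (Ad g x)"
    using assms by (auto simp: SL_centralizer_iff Ad_in_SL simp flip: Ad_mult_distrib)
next
  fix h assume h: "h \<in> SL_centralizer (Ad g x)"
  define k where "k = Ad (matrix_inv g) h"
  have hk: "h = Ad g k" by (simp add: k_def Ad_Ad_inv assms)
  have "k \<in> SL" using h assms by (auto simp: k_def SL_centralizer_iff Ad_in_SL SL_inv)
  moreover have "k ** x = x ** k"
    using h assms by (auto simp: SL_centralizer_iff hk Ad_inj simp flip: Ad_mult_distrib)
  ultimately show "h \<in> Ad g ` SL_centralizer x" by (auto simp: hk SL_centralizer_iff)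
qed

text \<open>Entry (a, b) of the commutation relation reads
  \<open>d a * g $ a $ b = g $ a $ b * d b\<close>, so the centralizer consists of the matrices
  supported on the blocks where \<open>d\<close> is constant.\<close>

lemma SL_centralizer_diag:
  "SL_centralizer (diag d) = {g \<in> SL. \<forall>a b. g $ a $ b \<noteq> 0 \<longrightarrow> d a = d b}"
proof -
  have "diag d ** g = g ** diag d \<longleftrightarrow> (\<forall>a b. g $ a $ b \<noteq> 0 \<longrightarrow> d a = d b)" for g
    by (simp add: vec_eq_iff diag_mult_nth mult_diag_nth mult.commute[of _ "d _"]) blast
  then show ?thesis by (auto simp: SL_centralizer_iff eq_commute[of "_ ** diag d"])
qed

text \<open>The witness \<open>t\<close> satisfies \<open>t\<^sup>2 = t + 1\<close>, so that \<open>t\<close> and \<open>1 / t\<close> are distinct.\<close>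

lemma diagonal_of_torus_subset_centralizer:
  fixes y :: "'k::alg_closed_field^'n^'n"
  assumes "torus \<subseteq> SL_centralizer y"
  shows "diagonal_mat y"
  unfolding diagonal_mat_def
proof (intro allI impI)
  fix a b :: 'n assume ab: "a \<noteq> b"
  have "degree [:-1, -1, 1 :: 'k:] > 0" by simp
  then obtain t :: 'k where "poly [:-1, -1, 1:] t = 0"
    using alg_closed_imp_poly_has_root by blast
  then have t: "t * t = t + 1" by (simp add: algebra_simps)
  then have t0: "t \<noteq> 0" by auto
  have t1: "t * t \<noteq> 1" using t t0 by simp
  \<comment> \<open>The entry \<open>inverse t\<close> at \<open>b\<close> keeps the determinant
    equal to 1. Commutation with \<open>diag s\<close> then multiplies entry (a, b) of
    \<open>y\<close> by \<open>t\<close> on one side and by \<open>inverse t\<close> on the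
    other.\<close>
  define s where "s i = (if i = a then t else if i = b then inverse t else 1)" for i
  have "(\<Prod>i\<in>UNIV. s i) = s a * (s b * (\<Prod>i\<in>UNIV - {a} - {b}. s i))"
    using ab by (subst prod.remove[of _ a], simp, simp, subst prod.remove[of _ b]) auto
  also have "(\<Prod>i\<in>UNIV - {a} - {b}. s i) = 1"
    by (rule prod.neutral) (auto simp: s_def)
  finally have "det (diag s :: 'k^'n^'n) = 1" using ab t0 by (simp add: det_diag s_def)
  then have "(diag s :: 'k^'n^'n) \<in> torus"
    by (auto simp: torus_def SL_def diagonal_mat_def diag_nth)
  then have "diag s ** y = y ** diag s" using assms by (auto simp: SL_centralizer_iff)
  then have "(diag s ** y) $ a $ b = (y ** diag s) $ a $ b" by simp
  then have eq: "t * y $ a $ b = y $ a $ b * inverse t"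
    using ab by (simp add: diag_mult_nth mult_diag_nth s_def)
  have "t * (t * y $ a $ b) = t * (y $ a $ b * inverse t)" by (simp only: eq)
  also have "\<dots> = y $ a $ b" using t0 by simp
  finally have "t * (t * y $ a $ b) = y $ a $ b" .
  then have "(t * t - 1) * y $ a $ b = 0" by (simp add: algebra_simps)
  then show "y $ a $ b = 0" using t1 by auto
qed

section \<open>Components of a set of roots and the group they generate\<close>

definition root_edges :: "(real^'n) set \<Rightarrow> ('n \<times> 'n) set" where
  "root_edges J = {(a, b). a \<noteq> b \<and> axis a 1 - axis b 1 \<in> J}"

text \<open>For a set of roots the classes are the orbits on indices of the group generated by its
  reflections. The edges are symmetrized because \<open>levi J\<close> contains the root groups of
  both \<alpha> and -\<alpha>.\<close>

definition conn :: "(real^'n) set \<Rightarrow> ('n \<times> 'n) set" where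
  "conn J = (root_edges J \<union> (root_edges J)\<inverse>)\<^sup>*"

lemma equiv_conn: "equiv UNIV (conn J)"
  unfolding conn_def
  by (intro equivI refl_rtrancl trans_rtrancl sym_rtrancl) (auto simp: sym_def)

lemma conn_refl: "(a, a) \<in> conn J"
  and conn_sym: "(a, b) \<in> conn J \<Longrightarrow> (b, a) \<in> conn J"
  and conn_trans: "(a, b) \<in> conn J \<Longrightarrow> (b, c) \<in> conn J \<Longrightarrow> (a, c) \<in> conn J"
  using equiv_conn[of J] unfolding equiv_def refl_on_def sym_def trans_def by blast+

lemma root_subgroup_eq:
  "root_subgroup \<alpha> = {transv a b t | a b t. a \<noteq> b \<and> \<alpha> = axis a 1 - axis b 1}"
  by (simp add: root_subgroup_def transv_def)

lemma root_subgroup_elim: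
  assumes "g \<in> root_subgroup \<alpha>"
  obtains a b t where "a \<noteq> b" "\<alpha> = axis a 1 - axis b 1" "g = transv a b t"
  using assms by (auto simp: root_subgroup_eq)

lemma transv_in_root_subgroup:
  assumes "a \<noteq> b"
  shows "transv a b t \<in> root_subgroup (axis a 1 - axis b 1)"
  using assms by (auto simp: root_subgroup_eq)

lemma transv_mult_transv_uminus:
  assumes "a \<noteq> b"
  shows "transv a b t ** transv a b (- t) = mat 1"
  using assms by (auto simp: vec_eq_iff transv_mult_nth transv_nth mat_def)

lemma matrix_mult_nonzero:
  assumes "(g ** h) $ a $ b \<noteq> 0"
  shows "\<exists>c. g $ a $ c \<noteq> 0 \<and> h $ c $ b \<noteq> 0"
proof (rule ccontr)
  assume "\<not> ?thesis"
  then have "\<forall>c. g $ a $ c * h $ c $ b = 0" by (metis mult_zero_left mult_zero_right)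
  then show False using assms by (simp add: matrix_matrix_mult_def)
qed

context
  fixes J :: "(real^'n) set"
begin

text \<open>The inverses are treated along with the generators because \<open>generate\<close> has a
  separate rule for inverses of generators.\<close>

lemma levi_generators:
  assumes "g \<in> torus \<union> (\<Union>\<alpha>\<in>J. root_subgroup \<alpha> \<union> root_subgroup (- \<alpha>))"
  shows "g \<in> SL \<and> (\<forall>a b. (g :: 'k::field^'n^'n) $ a $ b \<noteq> 0 \<longrightarrow> (a, b) \<in> conn J) \<and>
     (\<forall>a b. matrix_inv g $ a $ b \<noteq> 0 \<longrightarrow> (a, b) \<in> conn J)"
proof (cases "g \<in> torus")
  case True
  then have g: "g \<in> SL" "\<And>i j. i \<noteq> j \<Longrightarrow> g $ i $ j = 0"
    by (auto simp: torus_def diagonal_mat_def)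
  have gd: "g = diag (\<lambda>i. g $ i $ i)"
    using g by (simp add: vec_eq_iff diag_nth)
  have "matrix_inv g $ a $ b = 0" if "a \<noteq> b" for a b
  proof -
    have *: "g $ a $ a * matrix_inv g $ a $ i = mat 1 $ a $ i" for i
      unfolding diag_mult_nth[symmetric, of "\<lambda>i. g $ i $ i"] gd[symmetric] by (simp add: SL_inv(2)[OF g(1)])
    have "g $ a $ a \<noteq> 0" using *[of a] by (auto simp: mat_def)
    then show ?thesis using *[of b] that by (simp add: mat_def)
  qed
  then show ?thesis using g conn_refl[of _ J] by metis
next
  case False
  then obtain \<alpha> where \<alpha>: "\<alpha> \<in> J" "g \<in> root_subgroup \<alpha> \<union> root_subgroup (- \<alpha>)"
    using assms by auto
  then obtain a b t where ab: "a \<noteq> b" "g = transv a b t"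
    "axis a 1 - axis b 1 = \<alpha> \<or> axis a 1 - axis b 1 = - \<alpha>"
    by (auto elim!: root_subgroup_elim)
  have "axis a 1 - axis b 1 \<in> J \<or> axis b 1 - axis a 1 \<in> J"
  proof (rule disjE[OF ab(3)])
    assume "axis a 1 - axis b 1 = - \<alpha>"
    then have "axis b 1 - axis a 1 = \<alpha>" by (metis minus_diff_eq minus_minus)
    then show ?thesis using \<alpha>(1) by simp
  qed (use \<alpha>(1) in simp)
  then have c: "(a, b) \<in> conn J"
    using ab(1) by (auto simp: conn_def root_edges_def)
  have i: "matrix_inv g = transv a b (- t)"
    unfolding ab(2) by (rule matrix_inv_unique_field[OF transv_mult_transv_uminus[OF ab(1)]])
  show ?thesis unfolding i
    using ab c conn_refl[of _ J] by (auto simp: SL_def det_transv transv_nth split: if_splits)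
qed

lemma levi_subset:
  assumes "g \<in> levi J"
  shows "g \<in> SL \<and> (\<forall>a b. (g :: 'k::field^'n^'n) $ a $ b \<noteq> 0 \<longrightarrow> (a, b) \<in> conn J)"
  using assms unfolding levi_def
proof (induction rule: generate.induct)
  case one
  have "(a, b) \<in> conn J" if "(mat 1 :: 'k^'n^'n) $ a $ b \<noteq> 0" for a b
    using that by (auto simp: mat_def conn_refl split: if_splits)
  then show ?case by (simp add: SL_one)
next
  case (incl h)
  then show ?case using levi_generators by blast
next
  case (inv h)
  then show ?case using levi_generators[OF inv] by (simp add: m_inv_SL SL_inv)
next
  case (eng g h)
  have "(a, b) \<in> conn J" if nz: "(g ** h) $ a $ b \<noteq> 0" for a b
  proof -
    obtain c where "g $ a $ c \<noteq> 0" "h $ c $ b \<noteq> 0"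
      using matrix_mult_nonzero[OF nz] by blast
    then show ?thesis using eng.IH conn_trans[of a c J b] by auto
  qed
  then show ?case using eng.IH by (auto simp: SL_mult)
qed

lemma subgroup_levi: "subgroup (levi J) (SL_group :: ('k::field^'n^'n) monoid)"
  unfolding levi_def
  by (rule group.generate_is_subgroup[OF group_SL]) (use levi_generators in auto)

lemma levi_mult: "g \<in> levi J \<Longrightarrow> h \<in> levi J \<Longrightarrow> (g ** h :: 'k::field^'n^'n) \<in> levi J"
  using subgroup.m_closed[OF subgroup_levi] by auto

lemma levi_one: "(mat 1 :: 'k::field^'n^'n) \<in> levi J"
  using subgroup.one_closed[OF subgroup_levi] by auto

lemma levi_inv: "(g :: 'k::field^'n^'n) \<in> levi J \<Longrightarrow> matrix_inv g \<in> levi J"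
  using subgroup.m_inv_closed[OF subgroup_levi] levi_subset by (metis m_inv_SL)

text \<open>Commutators of adjacent transvections: \<open>[e_ab(t), e_bc(1)] = e_ac(t)\<close>.\<close>

lemma transv_in_levi:
  assumes "(a, b) \<in> conn J" "a \<noteq> b"
  shows "(transv a b t :: 'k::field^'n^'n) \<in> levi J"
proof -
  have base: "transv a b t \<in> levi J" if "(a, b) \<in> root_edges J \<union> (root_edges J)\<inverse>"
    for a b and t :: 'k
  proof -
    have ab: "a \<noteq> b" using that by (auto simp: root_edges_def)
    have "\<exists>\<alpha>\<in>J. transv a b t \<in> root_subgroup \<alpha> \<union> root_subgroup (- \<alpha>)"
    proof (cases "axis a 1 - axis b 1 \<in> J")
      case True
      then show ?thesis using transv_in_root_subgroup[OF ab] by blast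
    next
      case False
      then have "axis b 1 - axis a 1 \<in> J" using that by (auto simp: root_edges_def)
      moreover have "transv a b t \<in> root_subgroup (- (axis b 1 - axis a 1))"
        using transv_in_root_subgroup[OF ab] by (simp only: minus_diff_eq)
      ultimately show ?thesis by blast
    qed
    then show ?thesis unfolding levi_def by (intro generate.incl) blast
  qed
  \<comment> \<open>A walk along edges may return to \<open>a\<close>, hence the guard
    \<open>a \<noteq> b\<close>. The commutator needs the induction hypothesis at both
    \<open>t\<close> and \<open>- t\<close>.\<close>
  from assms(1) have "\<forall>t. a \<noteq> b \<longrightarrow> (transv a b t :: 'k^'n^'n) \<in> levi J"
    unfolding conn_def
  proof (induction rule: rtrancl_induct)
    case (step b c)
    show ?case
    proof (intro allI impI)
      fix t :: 'k assume ac: "a \<noteq> c"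
      show "transv a c t \<in> levi J"
      proof (cases "a = b")
        case True
        then show ?thesis using base[OF step.hyps(2)] by simp
      next
        case False
        have bc: "b \<noteq> c" using step.hyps by (auto simp: root_edges_def)
        have 1: "transv a b s \<in> levi J" for s :: 'k using step.IH False by blast
        have 2: "transv b c s \<in> levi J" for s :: 'k using base[OF step.hyps(2)] .
        have "transv a c t = transv a b t ** (transv b c 1 ** (transv a b (- t) ** transv b c (-1)))"
          using ac False bc by (simp add: vec_eq_iff transv_mult_nth transv_nth)
        then show ?thesis by (simp only:) (intro levi_mult 1 2)
      qed
    qed
  qed simp
  then show ?thesis using assms by blast
qed

end

context
  fixes J :: "(real^'n) set"
begin

text \<open>Multiplying by this matrix adds multiples of row \<open>b\<close> to all rows in
  \<open>S\<close> at once. As \<open>b\<close> is not in \<open>S\<close>, it is a plain product of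
  transvections.\<close>

lemma column_op_in_levi:
  assumes "\<And>i. i \<in> S \<Longrightarrow> (i, b) \<in> conn J" "b \<notin> S"
  shows "((\<chi> i j. (if i = j then 1 else 0) + (if i \<in> S \<and> j = b then t i else 0)) :: 'k::field^'n^'n) \<in> levi J"
  using finite[of S] assms
proof (induction S rule: finite_induct)
  case empty
  then show ?case using levi_one by (simp add: mat_def)
next
  case (insert s S)
  let ?M = "\<lambda>S. ((\<chi> i j. (if i = j then 1 else 0) + (if i \<in> S \<and> j = b then t i else 0)) :: 'k^'n^'n)"
  have sb: "s \<noteq> b" "s \<notin> S" "b \<notin> S" using insert.hyps insert.prems(2) by auto
  have *: "?M (insert s S) = transv s b (t s) ** ?M S"
    using sb by (simp add: vec_eq_iff transv_mult_nth)
  have "?M S \<in> levi J" by (rule insert.IH) (use insert.prems in auto)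
  moreover have "transv s b (t s) \<in> levi J"
    by (rule transv_in_levi) (use insert.prems in auto)
  ultimately show ?case unfolding * by (intro levi_mult)
qed

text \<open>Gaussian elimination, one column at a time, inside the blocks. A vanishing pivot is
  repaired by adding a row instead of exchanging rows, so that every operation is a product of
  transvections in \<open>levi J\<close>.\<close>

lemma levi_elimination:
  fixes g :: "'k::field^'n^'n"
  assumes "g \<in> SL" "\<And>a b. g $ a $ b \<noteq> 0 \<Longrightarrow> (a, b) \<in> conn J"
  shows "\<exists>h\<in>levi J. \<forall>c\<in>C. \<forall>i. i \<noteq> c \<longrightarrow> (h ** g) $ i $ c = 0"
  using finite[of C]
proof (induction C rule: finite_induct)
  case empty
  then show ?case using levi_one by auto
next
  case (insert b C)
  have block: "h ** g \<in> SL \<and> (\<forall>i j. (h ** g) $ i $ j \<noteq> 0 \<longrightarrow> (i, j) \<in> conn J)" if "h \<in> levi J" for h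
  proof -
    have h: "h \<in> SL" "\<And>i j. h $ i $ j \<noteq> 0 \<Longrightarrow> (i, j) \<in> conn J"
      using levi_subset[OF that] by auto
    have "(i, j) \<in> conn J" if nz: "(h ** g) $ i $ j \<noteq> 0" for i j
    proof -
      obtain k where "h $ i $ k \<noteq> 0" "g $ k $ j \<noteq> 0"
        using matrix_mult_nonzero[OF nz] by blast
      then show ?thesis using h(2)[of i k] assms(2)[of k j] conn_trans[of i k J j] by auto
    qed
    then show ?thesis using h(1) assms(1) by (auto simp: SL_mult)
  qed
  obtain h where h: "h \<in> levi J" "\<forall>c\<in>C. \<forall>i. i \<noteq> c \<longrightarrow> (h ** g) $ i $ c = 0"
    using insert.IH by blast
  define x where "x = h ** g"
  have x: "x \<in> SL" "\<And>i j. x $ i $ j \<noteq> 0 \<Longrightarrow> (i, j) \<in> conn J"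
    using block[OF h(1)] by (auto simp: x_def)
  have xC: "x $ i $ c = 0" if "c \<in> C" "i \<noteq> c" for i c
    using h(2) that by (auto simp: x_def)
  define G where "G = matrix_inv x"
  have Gx: "(\<Sum>r\<in>UNIV. G $ i $ r * x $ r $ j) = (if i = j then 1 else 0)" for i j
    using SL_inv(3)[OF x(1)] by (simp add: G_def matrix_matrix_mult_def mat_def vec_eq_iff)
  have Gc: "G $ i $ c * x $ c $ c = (if i = c then 1 else 0)" if "c \<in> C" for i c
  proof -
    have "(\<Sum>r\<in>UNIV. G $ i $ r * x $ r $ c) = (\<Sum>r\<in>{c}. G $ i $ r * x $ r $ c)"
      using that by (intro sum.mono_neutral_right) (auto simp: xC)
    then show ?thesis by (simp add: Gx)
  qed
  \<comment> \<open>A cleared column is nonzero only on the diagonal, so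
    \<open>G ** x = mat 1\<close> makes row \<open>b\<close> of \<open>G\<close> vanish on
    \<open>C\<close>. A nonzero term in the (b, b) entry of \<open>G ** x\<close> therefore comes
    from a row outside \<open>C\<close>.\<close>
  have Gb: "G $ b $ c = 0" if "c \<in> C" for c
  proof -
    have "b \<noteq> c" using that insert.hyps(2) by auto
    then have "G $ b $ c * x $ c $ c = 0" "x $ c $ c \<noteq> 0"
      using Gc[OF that, of b] Gc[OF that, of c] by auto
    then show ?thesis by simp
  qed
  obtain a where "G $ b $ a * x $ a $ b \<noteq> 0"
    using Gx[of b b] sum.not_neutral_contains_not_neutral[of "\<lambda>r. G $ b $ r * x $ r $ b" UNIV] by auto
  then have a: "a \<notin> C" "x $ a $ b \<noteq> 0" using Gb by auto
  have "\<exists>h1\<in>levi J. (h1 ** x) $ b $ b \<noteq> 0 \<and> (\<forall>c\<in>C. \<forall>i. i \<noteq> c \<longrightarrow> (h1 ** x) $ i $ c = 0)"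
  proof (cases "x $ b $ b = 0")
    case False
    then show ?thesis by (intro bexI[OF _ levi_one]) (simp add: xC)
  next
    case True
    then have ab: "b \<noteq> a" using a by auto
    have "transv b a 1 \<in> levi J" by (rule transv_in_levi[OF conn_sym[OF x(2)[OF a(2)]] ab])
    moreover have "(transv b a 1 ** x) $ b $ b \<noteq> 0" using True a by (simp add: transv_mult_nth)
    \<comment> \<open>As \<open>a\<close> lies outside \<open>C\<close>, row \<open>a\<close> is
      zero in the columns of \<open>C\<close>, so adding it keeps them cleared.\<close>
    moreover have "(transv b a 1 ** x) $ i $ c = 0" if "c \<in> C" "i \<noteq> c" for i c
      using that a(1) xC[of c a] xC[of c i] by (auto simp: transv_mult_nth)
    ultimately show ?thesis by blast
  qed
  then obtain h1 where h1: "h1 \<in> levi J" "(h1 ** x) $ b $ b \<noteq> 0"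
    "\<And>c i. c \<in> C \<Longrightarrow> i \<noteq> c \<Longrightarrow> (h1 ** x) $ i $ c = 0" by blast
  define y where "y = h1 ** x"
  \<comment> \<open>Rows of other blocks already have a zero in column \<open>b\<close>, by the
    support condition.\<close>
  define S where "S = {i. i \<noteq> b \<and> (i, b) \<in> conn J}"
  define t where "t i = - (y $ i $ b / y $ b $ b)" for i
  define M where "M = ((\<chi> i j. (if i = j then 1 else 0) + (if i \<in> S \<and> j = b then t i else 0)) :: 'k^'n^'n)"
  have M: "M \<in> levi J" unfolding M_def by (rule column_op_in_levi) (auto simp: S_def)
  have My: "(M ** y) $ i $ j = y $ i $ j + (if i \<in> S then t i * y $ b $ j else 0)" for i j
  proof -
    have "(M ** y) $ i $ j = (\<Sum>k\<in>UNIV. (if i = k then y $ k $ j else 0)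
        + (if k = b then if i \<in> S then t i * y $ k $ j else 0 else 0))"
      unfolding matrix_matrix_mult_def by (auto simp: M_def algebra_simps intro!: sum.cong)
    then show ?thesis by (simp add: sum.distrib)
  qed
  have yg: "y = (h1 ** h) ** g" by (simp add: y_def x_def matrix_mul_assoc)
  have ycol: "y $ i $ b = 0" if "i \<notin> S" "i \<noteq> b" for i
    using block[OF levi_mult[OF h1(1) h(1)]] that by (auto simp: S_def simp flip: yg)
  have "(M ** y) $ i $ c = 0" if "c \<in> insert b C" "i \<noteq> c" for i c
  proof (cases "c = b")
    case True
    then show ?thesis using that ycol[of i] h1(2) by (auto simp: My t_def simp flip: y_def)
  next
    case False
    then show ?thesis using that h1(3)[of c i] h1(3)[of c b] by (auto simp: My simp flip: y_def)
  qed
  moreover have "M ** y = (M ** (h1 ** h)) ** g" by (simp add: yg matrix_mul_assoc)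
  moreover have "M ** (h1 ** h) \<in> levi J" using M h h1 by (intro levi_mult)
  ultimately show ?case by (intro bexI[of _ "M ** (h1 ** h)"]) auto
qed

text \<open>After elimination only a diagonal matrix of determinant 1 is left, an element of the
  torus. Hence \<open>levi J\<close> depends on \<open>J\<close> only through its
  components.\<close>

theorem levi_eq_block:
  "levi J = {g \<in> SL. \<forall>a b. (g :: 'k::field^'n^'n) $ a $ b \<noteq> 0 \<longrightarrow> (a, b) \<in> conn J}"
proof (intro equalityI subsetI)
  fix g :: "'k^'n^'n" assume g: "g \<in> {g \<in> SL. \<forall>a b. g $ a $ b \<noteq> 0 \<longrightarrow> (a, b) \<in> conn J}"
  then obtain h where h: "h \<in> levi J" "\<forall>c\<in>UNIV. \<forall>i. i \<noteq> c \<longrightarrow> (h ** g) $ i $ c = 0"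
    using levi_elimination[of g UNIV] by blast
  have hSL: "h \<in> SL" using levi_subset h(1) by blast
  have "h ** g \<in> torus"
    using h(2) g hSL by (auto simp: torus_def diagonal_mat_def SL_mult)
  then have "h ** g \<in> levi J" unfolding levi_def by (intro generate.incl) blast
  then have "matrix_inv h ** (h ** g) \<in> levi J" by (rule levi_mult[OF levi_inv[OF h(1)]])
  then show "g \<in> levi J" using SL_inv[OF hSL] by (simp add: matrix_mul_assoc)
qed (use levi_subset in blast)

end

section \<open>Multisets with prescribed multiplicities\<close>

text \<open>The partition as a multiset of parts: the count of i is r_i, the number of distinct
  elements that occur exactly i times.\<close>

definition mult_type :: "'a multiset \<Rightarrow> nat multiset" where
  "mult_type X = image_mset (count X) (mset_set (set_mset X))"

definition block_type :: "('a \<times> 'a) set \<Rightarrow> nat multiset" where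
  "block_type R = image_mset card (mset_set (UNIV // R))"

text \<open>The spectrum of \<open>diag d\<close>, with multiplicities.\<close>

abbreviation entries :: "('n::finite \<Rightarrow> 'k) \<Rightarrow> 'k multiset" where
  "entries d \<equiv> image_mset d (mset_set UNIV)"

text \<open>Serves to count orbits through their spectra and cosets through residues mod n.\<close>

lemma card_image_eq_of_same_kernel:
  assumes "\<And>x y. x \<in> D \<Longrightarrow> y \<in> D \<Longrightarrow> f x = f y \<longleftrightarrow> g x = g y"
  shows "card (f ` D) = card (g ` D)"
proof (rule bij_betw_same_card)
  have r: "inv_into D f (f x) \<in> D \<and> f (inv_into D f (f x)) = f x" if "x \<in> D" for x
    using that by (simp add: inv_into_into f_inv_into_f)
  have eq: "g (inv_into D f (f x)) = g x" if "x \<in> D" for x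
    using r[OF that] assms that by blast
  show "bij_betw (\<lambda>y. g (inv_into D f y)) (f ` D) (g ` D)"
  proof (rule bij_betwI')
    fix y z assume "y \<in> f ` D" "z \<in> f ` D"
    then obtain a b where ab: "a \<in> D" "b \<in> D" "y = f a" "z = f b" by blast
    show "g (inv_into D f y) = g (inv_into D f z) \<longleftrightarrow> y = z"
      using assms[OF ab(1,2)] by (simp add: ab(3,4) eq[OF ab(1)] eq[OF ab(2)])
  next
    fix y assume "y \<in> f ` D"
    then show "g (inv_into D f y) \<in> g ` D" by (auto simp: eq)
  next
    fix z assume "z \<in> g ` D"
    then obtain a where "a \<in> D" "z = g a" by blast
    then show "\<exists>y\<in>f ` D. z = g (inv_into D f y)" by (intro bexI[of _ "f a"]) (auto simp: eq)
  qed
qed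

text \<open>Matches objects with equal labels: classes with eigenvalues of the same multiplicity,
  and later paths with paths of the same length.\<close>

lemma image_mset_eq_imp_bij_betw:
  assumes "finite A" "finite B" "image_mset f (mset_set A) = image_mset g (mset_set B)"
  shows "\<exists>h. bij_betw h A B \<and> (\<forall>a\<in>A. g (h a) = f a)"
  using assms
proof (induction A arbitrary: B rule: finite_induct)
  case empty
  then have "B = {}" by (simp add: mset_set_empty_iff)
  then show ?case by (simp add: bij_betw_def)
next
  case (insert x A)
  have "f x \<in># image_mset f (mset_set (insert x A))" using insert.hyps by simp
  then have "f x \<in># image_mset g (mset_set B)" by (simp add: insert.prems)
  then obtain y where y: "y \<in> B" "g y = f x" using insert.prems(1) by auto
  have "mset_set B = add_mset y (mset_set (B - {y}))"
    using y(1) insert.prems(1) by (simp add: mset_set.remove)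
  then have "image_mset f (mset_set A) = image_mset g (mset_set (B - {y}))"
    using insert.prems(2) insert.hyps y(2) by simp
  then obtain h where h: "bij_betw h A (B - {y})" "\<forall>a\<in>A. g (h a) = f a"
    using insert.IH[of "B - {y}"] insert.prems(1) by blast
  have "bij_betw (h(x := y)) (insert x A) (insert y (B - {y}))"
    using h(1) insert.hyps(2) by (auto simp: bij_betw_def inj_on_def)
  moreover have "insert y (B - {y}) = B" using y(1) by auto
  moreover have "\<forall>a\<in>insert x A. g ((h(x := y)) a) = f a"
    using h(2) y(2) insert.hyps(2) by auto
  ultimately show ?case by metis
qed

lemma count_entries: "count (entries d) x = card {a. d a = x}"
  by (simp add: count_image_mset vimage_def)

text \<open>The classes of \<open>R\<close> are the nonempty fibres of \<open>d\<close>, and the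
  size of a fibre is the multiplicity of its value.\<close>

lemma mult_type_entries:
  fixes d :: "'n::finite \<Rightarrow> 'k"
  assumes "\<forall>a b. d a = d b \<longleftrightarrow> (a, b) \<in> R"
  shows "mult_type (entries d) = block_type R"
proof -
  have "R `` {a} = {b. d b = d a}" for a
  proof (rule Set.set_eqI)
    fix b show "b \<in> R `` {a} \<longleftrightarrow> b \<in> {b. d b = d a}"
      using assms[rule_format, of a b] by auto
  qed
  then have "UNIV // R = (\<lambda>x. {a. d a = x}) ` range d"
    by (auto simp: quotient_def image_image)
  moreover have "inj_on (\<lambda>x. {a. d a = x}) (range d)"
    by (auto simp: inj_on_def)
  ultimately have "mset_set (UNIV // R) = image_mset (\<lambda>x. {a. d a = x}) (mset_set (range d))"
    by (simp add: image_mset_mset_set)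
  moreover have "count (entries d) = (\<lambda>x. card {a. d a = x})"
    by (rule ext) (rule count_entries)
  ultimately show ?thesis
    by (simp add: block_type_def mult_type_def image_mset.compositionality comp_def)
qed

text \<open>Equal types allow a matching of the classes of \<open>R\<close> with the elements of
  \<open>X\<close> such that class size equals multiplicity; \<open>d\<close> sends each index to
  the partner of its class.\<close>

lemma exists_entries_of_block_type:
  fixes R :: "('n::finite \<times> 'n) set"
  assumes "equiv UNIV R" "mult_type X = block_type R"
  shows "\<exists>d. entries d = X \<and> (\<forall>a b. d a = d b \<longleftrightarrow> (a, b) \<in> R)"
proof -
  have "image_mset card (mset_set (UNIV // R)) = image_mset (count X) (mset_set (set_mset X))"
    using assms(2) by (simp add: block_type_def mult_type_def)
  then obtain h where h: "bij_betw h (UNIV // R) (set_mset X)" "\<forall>C\<in>UNIV // R. count X (h C) = card C"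
    using image_mset_eq_imp_bij_betw[of "UNIV // R" "set_mset X" card "count X"] by auto
  define d where "d a = h (R `` {a})" for a
  have cls: "R `` {a} \<in> UNIV // R" for a by (simp add: quotientI)
  have ker: "d a = d b \<longleftrightarrow> (a, b) \<in> R" for a b
  proof -
    have "d a = d b \<longleftrightarrow> R `` {a} = R `` {b}"
      unfolding d_def by (rule inj_on_eq_iff[OF bij_betw_imp_inj_on[OF h(1)] cls cls])
    then show ?thesis using assms(1) by (simp add: eq_equiv_class_iff)
  qed
  have "count (entries d) x = count X x" for x
  proof (cases "x \<in># X")
    case True
    then obtain a where a: "x = d a"
      using h(1) unfolding d_def bij_betw_def by (metis imageE quotientE)
    have "{b. d b = x} = R `` {a}" 
      unfolding a by (rule Set.set_eqI) (simp add: eq_commute[of "d _" "d a"] flip: ker)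
    then show ?thesis using h(2) cls[of a] by (simp add: count_entries) (simp add: a d_def)
  next
    case False
    have "d a \<noteq> x" for a using False h(1) cls[of a] unfolding d_def bij_betw_def by blast
    then show ?thesis using False by (simp add: count_entries not_in_iff)
  qed
  then have "entries d = X" by (intro multiset_eqI)
  then show ?thesis using ker by blast
qed

lemma zero_notin_mult_type: "0 \<notin># mult_type X"
  by (auto simp: mult_type_def count_eq_zero_iff)

lemma size_mult_type: "size (mult_type X) = card (set_mset X)"
  by (simp add: mult_type_def)

lemma sum_mset_mult_type: "sum_mset (mult_type X) = size X"
  by (simp add: mult_type_def size_multiset_overloaded_eq sum_unfold_sum_mset)

lemma mult_type_image_inj:
  assumes "inj f"
  shows "mult_type (image_mset f X) = mult_type X"
proof -
  have c: "count (image_mset f X) (f x) = count X x" for x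
    using assms by (cases "x \<in># X") (simp_all add: count_image_mset vimage_def inj_eq not_in_iff)
  have "mset_set (f ` set_mset X) = image_mset f (mset_set (set_mset X))"
    using assms by (metis image_mset_mset_set inj_on_subset subset_UNIV)
  then show ?thesis by (simp add: mult_type_def image_mset.compositionality comp_def c)
qed

lemma image_count_superset:
  assumes "finite A" "set_mset X \<subseteq> A"
  shows "image_mset (count X) (mset_set A) = mult_type X + replicate_mset (card A - card (set_mset X)) 0"
proof -
  have "mset_set A = mset_set (set_mset X) + mset_set (A - set_mset X)"
    using assms by (subst mset_set_Union[symmetric]) (auto simp: Un_absorb1)
  moreover have "image_mset (count X) (mset_set (A - set_mset X)) = image_mset (\<lambda>_. 0) (mset_set (A - set_mset X))"
    by (rule image_mset_cong) (use assms in \<open>auto simp: not_in_iff\<close>)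
  ultimately show ?thesis
    using assms by (simp add: mult_type_def image_mset_const_eq card_Diff_subset)
qed

lemma finite_mult_type: "finite A \<Longrightarrow> finite {X. set_mset X \<subseteq> A \<and> mult_type X = M}"
  by (rule finite_subset[OF _ finite_multisets_of_size[of A "sum_mset M"]])
    (auto simp: sum_mset_mult_type multisets_of_size_def)

lemma filter_nonzero_add_replicate:
  assumes "0 \<notin># K"
  shows "filter_mset (\<lambda>k. k \<noteq> 0) (K + replicate_mset j (0 :: nat)) = K"
proof (rule multiset_eqI)
  fix k
  show "count (filter_mset (\<lambda>k. k \<noteq> 0) (K + replicate_mset j 0)) k = count K k"
    using assms by (cases "k = 0") (simp_all add: not_in_iff)
qed

text \<open>Along a fixed listing of \<open>A\<close>, a multiset becomes the word of its
  multiplicities. That word is an arrangement of \<open>M\<close> padded with zeros for the elements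
  of \<open>A\<close> that do not occur.\<close>

lemma card_mult_type:
  assumes "finite A" "0 \<notin># M" "size M \<le> card A"
  shows "card {X. set_mset X \<subseteq> A \<and> mult_type X = M} =
     card (permutations_of_multiset (M + replicate_mset (card A - size M) 0))"
proof -
  obtain as where as: "set as = A" "distinct as" using finite_distinct_list[OF assms(1)] by blast
  have mas: "mset as = mset_set A" using as by (metis mset_set_set)
  have len: "length as = card A" using as by (metis distinct_card)
  show ?thesis
  proof (rule bij_betw_same_card[of "\<lambda>X. map (count X) as"], rule bij_betw_imageI)
    show "inj_on (\<lambda>X. map (count X) as) {X. set_mset X \<subseteq> A \<and> mult_type X = M}"
    proof (rule inj_onI, clarify)
      fix X Y assume XY: "set_mset X \<subseteq> A" "set_mset Y \<subseteq> A" "map (count X) as = map (count Y) as"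
      have "count X a = count Y a" for a
      proof (cases "a \<in> A")
        case True
        then show ?thesis using XY(3) as(1) by (simp add: map_eq_conv)
      next
        case False
        then have "a \<notin># X" "a \<notin># Y" using XY by auto
        then show ?thesis by (simp add: not_in_iff)
      qed
      then show "X = Y" by (rule multiset_eqI)
    qed
    show "(\<lambda>X. map (count X) as) ` {X. set_mset X \<subseteq> A \<and> mult_type X = M} =
        permutations_of_multiset (M + replicate_mset (card A - size M) 0)"
    proof (intro equalityI subsetI)
      fix xs assume "xs \<in> (\<lambda>X. map (count X) as) ` {X. set_mset X \<subseteq> A \<and> mult_type X = M}"
      then obtain X where X: "xs = map (count X) as" "set_mset X \<subseteq> A" "mult_type X = M" by blast
      have "mset xs = M + replicate_mset (card A - size M) 0"
        using image_count_superset[OF assms(1) X(2)] size_mult_type[of X] by (simp add: X(1,3) mas)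
      then show "xs \<in> permutations_of_multiset (M + replicate_mset (card A - size M) 0)"
        by (simp add: permutations_of_multiset_def)
    next
      fix xs assume "xs \<in> permutations_of_multiset (M + replicate_mset (card A - size M) 0)"
      then have xs: "mset xs = M + replicate_mset (card A - size M) 0"
        by (simp add: permutations_of_multiset_def)
      then have lx: "length xs = length as"
        using assms(3) by (metis size_mset size_union size_replicate_mset le_add_diff_inverse len)
      define f where "f a = the (map_of (zip as xs) a)" for a
      define X where "X = (\<Sum>a\<in>A. replicate_mset (f a) a)"
      have cX: "count X a = (if a \<in> A then f a else 0)" for a
      proof -
        have "count X a = (\<Sum>b\<in>A. if b = a then f b else 0)"
          unfolding X_def count_sum by (intro sum.cong) auto
        then show ?thesis using assms(1) by simp
      qed
      have "f (as ! i) = xs ! i" if "i < length as" for i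
        using that as(2) lx by (simp add: f_def map_of_zip_nth)
      then have map: "map (count X) as = xs"
        using lx as(1) by (intro nth_equalityI) (auto simp: cX)
      have sX: "set_mset X \<subseteq> A"
        using cX by (metis count_eq_zero_iff subsetI)
      have "mult_type X + replicate_mset (card A - card (set_mset X)) 0 = M + replicate_mset (card A - size M) 0"
        using image_count_superset[OF assms(1) sX] map xs mas by (metis mset_map)
      \<comment> \<open>Discarding the zeros recovers both types, since neither has 0 as a
        part.\<close>
      then have "mult_type X = M"
        using filter_nonzero_add_replicate[OF assms(2)] filter_nonzero_add_replicate[OF zero_notin_mult_type]
        by metis
      then show "xs \<in> (\<lambda>X. map (count X) as) ` {X. set_mset X \<subseteq> A \<and> mult_type X = M}"
        using sX map by blast
    qed
  qed
qed

lemma real_card_permutations_of_multiset: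
  "real (card (permutations_of_multiset A)) = fact (size A) / (\<Prod>x\<in>set_mset A. fact (count A x))"
proof -
  have "real (card (permutations_of_multiset A)) = real (fact (size A)) / real (\<Prod>x\<in>set_mset A. fact (count A x))"
    unfolding card_permutations_of_multiset(1)
    by (rule real_of_nat_div[OF card_permutations_of_multiset(2)])
  then show ?thesis by simp
qed

lemma fact_eq_prod_diff:
  "m \<le> q \<Longrightarrow> fact q = fact (q - m) * (\<Prod>k<m. real q - real k)"
proof (induction m)
  case (Suc m)
  have "q - m = Suc (q - Suc m)" using Suc.prems by simp
  then have "fact (q - m) = (real q - real m) * fact (q - Suc m)"
    using Suc.prems by (simp add: of_nat_diff)
  then show ?case using Suc by (simp add: mult_ac)
qed simp

text \<open>A multinomial coefficient with the factorial of the number of absent elements cancelled.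
  The factor \<open>card A\<close> is kept apart because it will be divided out by the number of
  possible sums.\<close>

lemma real_card_mult_type:
  assumes "finite A" "0 \<notin># M" "M \<noteq> {#}"
  shows "real (card {X. set_mset X \<subseteq> A \<and> mult_type X = M}) =
    real (card A) * (\<Prod>k=1..size M - 1. real (card A) - real k) / (\<Prod>x\<in>set_mset M. fact (count M x))"
proof -
  let ?q = "card A" and ?m = "size M"
  have m: "?m > 0" using assms(3) by (simp add: nonempty_has_size)
  have split: "(\<Prod>k<?m. real ?q - real k) = real ?q * (\<Prod>k=1..?m - 1. real ?q - real k)"
  proof -
    have "{..<?m} = insert 0 {1..?m - 1}" using m by auto
    then show ?thesis by simp
  qed
  show ?thesis
  proof (cases "?m \<le> ?q")
    case True
    let ?Z = "M + replicate_mset (?q - ?m) 0"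
    have "(\<Prod>x\<in>set_mset ?Z. fact (count ?Z x)) = (\<Prod>x\<in>insert 0 (set_mset M). fact (count ?Z x) :: real)"
      by (rule prod.mono_neutral_left) (auto simp: not_in_iff split: if_splits)
    also have "\<dots> = fact (?q - ?m) * (\<Prod>x\<in>set_mset M. fact (count ?Z x))"
      using assms(2) by (simp add: not_in_iff)
    also have "(\<Prod>x\<in>set_mset M. fact (count ?Z x)) = (\<Prod>x\<in>set_mset M. fact (count M x) :: real)"
      by (rule prod.cong) (use assms(2) in auto)
    finally have "real (card {X. set_mset X \<subseteq> A \<and> mult_type X = M}) =
        fact ?q / (fact (?q - ?m) * (\<Prod>x\<in>set_mset M. fact (count M x)))"
      unfolding card_mult_type[OF assms(1,2) True] real_card_permutations_of_multiset
      using True by simp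
    then show ?thesis by (simp add: fact_eq_prod_diff[OF True] split)
  next
    case False
    have "{X. set_mset X \<subseteq> A \<and> mult_type X = M} = {}"
    proof -
      have "mult_type X \<noteq> M" if "set_mset X \<subseteq> A" for X
        using card_mono[OF assms(1) that] False size_mult_type[of X] by auto
      then show ?thesis by auto
    qed
    \<comment> \<open>With more parts than elements, the factor k = \<open>card A\<close> occurs in
      the product; for empty \<open>A\<close> the leading factor is already 0.\<close>
    moreover have "real ?q * (\<Prod>k=1..?m - 1. real ?q - real k) = 0"
      using False by (auto simp: prod_zero_iff intro!: bexI[of _ ?q])
    ultimately show ?thesis by (simp only: card.empty of_nat_0 div_0)
  qed
qed

context finite_subfield
begin

lemma real_card_mult_type_sum_0:
  assumes "0 \<notin># M" "M \<noteq> {#}" "of_nat (sum_mset M) \<noteq> (0 :: 'k)"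
  shows "real (card {X. set_mset X \<subseteq> F \<and> sum_mset X = 0 \<and> mult_type X = M}) =
    (\<Prod>k=1..size M - 1. real q - real k) / (\<Prod>x\<in>set_mset M. fact (count M x))"
proof -
  define T where "T s = {X. set_mset X \<subseteq> F \<and> mult_type X = M \<and> sum_mset X = s}" for s
  define N :: 'k where "N = of_nat (sum_mset M)"
  have N: "N \<noteq> 0" "N \<in> F" unfolding N_def by (rule assms(3), rule F_of_nat)
  have shift: "image_mset (\<lambda>x. x + c) X \<in> T (s + N * c)" if "X \<in> T s" "c \<in> F" for X s c
  proof -
    have "sum_mset (image_mset (\<lambda>x. x + c) X) = sum_mset X + of_nat (size X) * c"
      by (induction X) (auto simp: algebra_simps)
    moreover have "size X = sum_mset M" using that(1) sum_mset_mult_type[of X] by (simp add: T_def)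
    moreover have "inj (\<lambda>x. x + c)" by (simp add: inj_def)
    ultimately show ?thesis
      using that by (auto simp: T_def N_def mult_type_image_inj F_add)
  qed
  have finT: "finite (T s)" for s
    unfolding T_def by (rule finite_subset[OF _ finite_mult_type[OF finite_F, of M]]) auto
  have cardT: "card (T s) = card (T 0)" if s: "s \<in> F" for s
  proof (rule sym, rule bij_betw_same_card)
    \<comment> \<open>Adding c to each of the N members changes the sum by N * c.\<close>
    define c where "c = s * inverse N"
    have c: "c \<in> F" "N * c = s" using s N by (auto simp: c_def F_mult F_inverse)
    show "bij_betw (image_mset (\<lambda>x. x + c)) (T 0) (T s)"
    proof (rule bij_betw_byWitness[where f' = "image_mset (\<lambda>x. x + - c)"])
      show "image_mset (\<lambda>x. x + c) ` T 0 \<subseteq> T s"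
        using shift[of _ 0 c] c by auto
      show "image_mset (\<lambda>x. x + - c) ` T s \<subseteq> T 0"
        using shift[of _ s "- c"] c F_uminus by auto
    qed (simp_all add: image_mset.compositionality comp_def)
  qed
  have "{X. set_mset X \<subseteq> F \<and> mult_type X = M} = (\<Union>s\<in>F. T s)"
  proof -
    have "sum_mset X \<in> F" if "set_mset X \<subseteq> F" for X
      using that by (induction X) (auto intro: F_0 F_add)
    then show ?thesis by (auto simp: T_def)
  qed
  then have "card {X. set_mset X \<subseteq> F \<and> mult_type X = M} = (\<Sum>s\<in>F. card (T s))"
    using finT finite_F by (simp only:) (rule card_UN_disjoint, auto simp: T_def)
  also have "\<dots> = q * card (T 0)" by (simp add: cardT card_F)
  finally have "real q * real (card (T 0)) =
      real q * ((\<Prod>k=1..size M - 1. real q - real k) / (\<Prod>x\<in>set_mset M. fact (count M x)))"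
    using real_card_mult_type[OF finite_F assms(1,2)] by (simp add: card_F)
  then have "real (card (T 0)) =
      (\<Prod>k=1..size M - 1. real q - real k) / (\<Prod>x\<in>set_mset M. fact (count M x))"
    using q_gt_1 by (subst (asm) mult_left_cancel) auto
  moreover have "T 0 = {X. set_mset X \<subseteq> F \<and> sum_mset X = 0 \<and> mult_type X = M}"
    by (auto simp: T_def)
  ultimately show ?thesis by simp
qed

end

section \<open>Split orbits\<close>

lemma trace_Ad:
  fixes x :: "'k::field^'n^'n"
  assumes "g \<in> SL"
  shows "trace (Ad g x) = trace x"
proof -
  have "trace (Ad g x) = trace (matrix_inv g ** (g ** x))"
    unfolding Ad_def by (rule trace_mul_sym)
  then show ?thesis by (simp add: matrix_mul_assoc SL_inv[OF assms])
qed

text \<open>Both groups are given by supports, and the single transvection with entry at (a, b)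
  tests whether that position is allowed.\<close>

lemma SL_centralizer_diag_eq_levi_iff:
  "SL_centralizer (diag d :: 'k::field^'n^'n) = levi J \<longleftrightarrow> (\<forall>a b. d a = d b \<longleftrightarrow> (a, b) \<in> conn J)"
proof
  assume eq: "SL_centralizer (diag d :: 'k^'n^'n) = levi J"
  show "\<forall>a b. d a = d b \<longleftrightarrow> (a, b) \<in> conn J"
  proof (intro allI)
    fix a b
    show "d a = d b \<longleftrightarrow> (a, b) \<in> conn J"
    proof (cases "a = b")
      case False
      let ?g = "transv a b 1 :: 'k^'n^'n"
      have SL: "?g \<in> SL" by (simp add: SL_def det_transv[OF False])
      have nz: "?g $ i $ j \<noteq> 0 \<longleftrightarrow> i = j \<or> (i = a \<and> j = b)" for i j
        using False by (simp add: transv_nth)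
      have "?g \<in> SL_centralizer (diag d) \<longleftrightarrow> d a = d b"
        unfolding SL_centralizer_diag using SL nz by auto
      moreover have "?g \<in> levi J \<longleftrightarrow> (a, b) \<in> conn J"
        unfolding levi_eq_block using SL nz by (auto simp: conn_refl)
      ultimately show ?thesis by (simp add: eq)
    qed (simp add: conn_refl)
  qed
next
  assume "\<forall>a b. d a = d b \<longleftrightarrow> (a, b) \<in> conn J"
  then show "SL_centralizer (diag d :: 'k^'n^'n) = levi J"
    by (simp add: SL_centralizer_diag levi_eq_block)
qed

lemma torus_subset_levi: "torus \<subseteq> levi J"
  unfolding levi_def by (auto intro: generate.incl)

context finite_subfield
begin

lemma frob_mult: "frob q (x ** y) = frob q x ** (frob q y :: 'k^'n^'n)"
  by (simp add: frob_def matrix_matrix_mult_def vec_eq_iff frobenius_sum power_mult_distrib)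

lemma frob_one: "frob q (mat 1 :: 'k^'n^'n) = mat 1"
  using q_gt_1 by (simp add: frob_def mat_def vec_eq_iff)

lemma frob_diag: "frob q (diag d :: 'k^'n^'n) = diag (\<lambda>i. d i ^ q)"
  using q_gt_1 by (simp add: frob_def diag_def vec_eq_iff)

lemma SL_F_SL: "g \<in> SL_F q \<Longrightarrow> g \<in> SL"
  by (simp add: SL_F_def)

lemma SL_F_mult: "g \<in> SL_F q \<Longrightarrow> h \<in> SL_F q \<Longrightarrow> g ** (h :: 'k^'n^'n) \<in> SL_F q"
  by (simp add: SL_F_def SL_mult frob_mult)

lemma SL_F_one: "(mat 1 :: 'k^'n^'n) \<in> SL_F q"
  by (simp add: SL_F_def SL_one frob_one)

lemma SL_F_inv:
  assumes "(g :: 'k^'n^'n) \<in> SL_F q"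
  shows "matrix_inv g \<in> SL_F q"
proof -
  have g: "g \<in> SL" "frob q g = g" using assms by (auto simp: SL_F_def)
  have "g ** frob q (matrix_inv g) = frob q (g ** matrix_inv g)"
    by (simp add: frob_mult g)
  then have "matrix_inv g = frob q (matrix_inv g)"
    by (intro matrix_inv_unique_field) (simp add: SL_inv[OF g(1)] frob_one)
  then show ?thesis using SL_inv[OF g(1)] by (simp add: SL_F_def)
qed

lemma sl_F_Ad:
  assumes "g \<in> SL_F q" "(x :: 'k^'n^'n) \<in> sl_F q"
  shows "Ad g x \<in> sl_F q"
  using assms SL_F_inv[OF assms(1)]
  by (auto simp: sl_F_def sl_def trace_Ad SL_F_SL) (simp add: Ad_def frob_mult SL_F_def)

lemma orbit_Ad:
  assumes "g \<in> SL_F q"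
  shows "orbit q (Ad g (x :: 'k^'n^'n)) = orbit q x"
proof (intro equalityI subsetI)
  fix y assume "y \<in> orbit q (Ad g x)"
  then obtain h where "h \<in> SL_F q" "y = Ad h (Ad g x)" by (auto simp: orbit_def)
  then show "y \<in> orbit q x"
    using assms by (auto simp: orbit_def SL_F_SL SL_F_mult simp flip: Ad_mult)
next
  fix y assume "y \<in> orbit q x"
  then obtain h where h: "h \<in> SL_F q" "y = Ad h x" by (auto simp: orbit_def)
  have "y = Ad (h ** matrix_inv g) (Ad g x)"
    using h assms by (simp add: Ad_mult Ad_inv_Ad SL_F_SL SL_inv)
  then show "y \<in> orbit q (Ad g x)"
    unfolding orbit_def by (rule image_eqI[OF _ SL_F_mult[OF h(1) SL_F_inv[OF assms]]])
qed

lemma orbit_self: "(x :: 'k^'n^'n) \<in> orbit q x"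
  unfolding orbit_def using SL_F_one by (auto simp: image_iff intro!: bexI[of _ "mat 1"] simp: Ad_one)

lemma diag_in_sl_F_iff: "(diag d :: 'k^'n^'n) \<in> sl_F q \<longleftrightarrow> range d \<subseteq> F \<and> (\<Sum>a\<in>UNIV. d a) = 0"
  by (auto simp: sl_F_def sl_def frob_diag trace_def diag_nth image_subset_iff vec_eq_iff simp flip: F_iff)

lemma has_genus_id_diag:
  assumes "\<And>a b. d a = d b \<longleftrightarrow> (a, b) \<in> conn J"
  shows "has_genus_id q J (diag d :: 'k^'n^'n)"
proof -
  have "SL_centralizer (diag d :: 'k^'n^'n) = levi J"
    using assms by (simp add: SL_centralizer_diag_eq_levi_iff)
  then have "Ad (mat 1) ` SL_centralizer (diag d :: 'k^'n^'n) = levi J"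
    by (simp add: Ad_one cong: image_cong)
  then show ?thesis unfolding has_genus_id_def using SL_F_one by blast
qed

text \<open>Conjugation turns \<open>levi J\<close> into the centralizer of \<open>Ad g x\<close>,
  which thus contains the torus and forces \<open>Ad g x\<close> to be diagonal. Since
  \<open>g\<close> is Frobenius-fixed, \<open>Ad g x\<close> stays in \<open>sl_F q\<close> and its
  diagonal entries lie in \<open>F\<close>.\<close>

lemma has_genus_id_imp_diag:
  assumes "has_genus_id q J (x :: 'k^'n^'n)" "x \<in> sl_F q"
  obtains g d where "g \<in> SL_F q" "Ad g x = diag d" "range d \<subseteq> F" "(\<Sum>a\<in>UNIV. d a) = 0"
    "\<forall>a b. d a = d b \<longleftrightarrow> (a, b) \<in> conn J"
proof -
  obtain g where g: "g \<in> SL_F q" "Ad g ` SL_centralizer x = levi J"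
    using assms(1) by (auto simp: has_genus_id_def)
  then have C: "SL_centralizer (Ad g x) = levi J"
    by (simp add: Ad_image_SL_centralizer SL_F_SL)
  then have "diagonal_mat (Ad g x)"
    using torus_subset_levi[of J] by (intro diagonal_of_torus_subset_centralizer) simp
  then obtain d where d: "Ad g x = diag d" by (auto simp: diagonal_mat_iff_diag)
  have "diag d \<in> sl_F q" using sl_F_Ad[OF g(1) assms(2)] by (simp add: d)
  then have "range d \<subseteq> F" "(\<Sum>a\<in>UNIV. d a) = 0" by (simp_all add: diag_in_sl_F_iff)
  moreover have "d a = d b \<longleftrightarrow> (a, b) \<in> conn J" for a b
    using C SL_centralizer_diag_eq_levi_iff[of d J] by (simp add: d)
  ultimately show ?thesis using that g(1) d by blast
qed

lemma semisimple_diag: "semisimple_mat (diag d :: 'k^'n^'n)"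
  unfolding semisimple_mat_def
  by (intro exI[of _ "mat 1"]) (auto simp: invertible_def Ad_one diagonal_mat_def diag_nth intro!: exI[of _ "mat 1"])

text \<open>The parameter is a function on indices rather than a multiset because the condition
  given by \<open>conn J\<close> refers to positions.\<close>

lemma orbits_of_genus_id_eq:
  "(orbits_of_genus_id q J :: ('k^'n^'n) set set) =
     (\<lambda>d. orbit q (diag d)) ` {d. range d \<subseteq> F \<and> (\<Sum>a\<in>UNIV. d a) = 0 \<and> (\<forall>a b. d a = d b \<longleftrightarrow> (a, b) \<in> conn J)}"
proof (intro equalityI subsetI)
  fix X :: "('k^'n^'n) set" assume "X \<in> orbits_of_genus_id q J"
  then obtain x :: "'k^'n^'n" where x: "X = orbit q x" "x \<in> sl_F q" "has_genus_id q J x"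
    by (auto simp: orbits_of_genus_id_def)
  obtain g d where dg: "g \<in> SL_F q" "Ad g x = diag d" "range d \<subseteq> F" "(\<Sum>a\<in>UNIV. d a) = 0"
    "\<forall>a b. d a = d b \<longleftrightarrow> (a, b) \<in> conn J"
    using has_genus_id_imp_diag[OF x(3,2)] by blast
  have "X = orbit q (diag d)" using orbit_Ad[OF dg(1), of x] by (simp add: x(1) dg(2))
  then show "X \<in> (\<lambda>d. orbit q (diag d)) ` {d. range d \<subseteq> F \<and> (\<Sum>a\<in>UNIV. d a) = 0 \<and> (\<forall>a b. d a = d b \<longleftrightarrow> (a, b) \<in> conn J)}"
    using dg(3-5) by blast
next
  fix X :: "('k^'n^'n) set"
  assume "X \<in> (\<lambda>d. orbit q (diag d)) ` {d. range d \<subseteq> F \<and> (\<Sum>a\<in>UNIV. d a) = 0 \<and> (\<forall>a b. d a = d b \<longleftrightarrow> (a, b) \<in> conn J)}"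
  then obtain d where d: "X = orbit q (diag d)" "range d \<subseteq> F" "(\<Sum>a\<in>UNIV. d a) = 0"
    "\<forall>a b. d a = d b \<longleftrightarrow> (a, b) \<in> conn J" by blast
  have "diag d \<in> {x \<in> sl_F q. semisimple_mat x \<and> has_genus_id q J (x :: 'k^'n^'n)}"
    using d(2,3) d(4)[rule_format, THEN has_genus_id_diag] by (simp add: diag_in_sl_F_iff semisimple_diag)
  then show "X \<in> orbits_of_genus_id q J" unfolding orbits_of_genus_id_def d(1) by (rule imageI)
qed

end

section \<open>The spectrum as a complete invariant of diagonal matrices\<close>

lemma charpoly_diag: "charpoly (diag d :: 'k::field^'n^'n) = (\<Prod>x\<in>#entries d. [:- x, 1:])"
proof -
  have "charpoly (diag d :: 'k^'n^'n) = (\<Prod>i\<in>UNIV. [:0, 1:] - [:d i:])"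
    unfolding charpoly_def by (subst det_diagonal) (auto simp: diag_nth)
  also have "\<dots> = (\<Prod>i\<in>UNIV. [:- d i, 1:])" by simp
  finally show ?thesis by (simp add: prod_unfold_prod_mset image_mset.compositionality comp_def)
qed

lemma order_prod_linear:
  "Polynomial.order a (\<Prod>x\<in>#X. [:- x, 1 :: 'k::field:]) = count X a"
proof (induction X)
  case (add x X)
  have nz: "(\<Prod>x\<in>#X. [:- x, 1 :: 'k:]) \<noteq> 0" for X :: "'k multiset"
    by (auto simp: prod_mset_zero_iff)
  have "Polynomial.order a [:- x, 1:] = (if a = x then 1 else 0)"
    using order_power_n_n[of a 1] by (auto intro: order_0I)
  then show ?case
    using add nz[of "add_mset x X"] by (subst image_mset_add_mset, subst prod_mset.add_mset, subst order_mult) auto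
qed simp

lemma order_charpoly_diag: "Polynomial.order a (charpoly (diag d :: 'k::field^'n^'n)) = count (entries d) a"
  by (simp add: charpoly_diag order_prod_linear)

definition const_mat :: "'k::field^'n^'n \<Rightarrow> 'k poly^'n^'n" where
  "const_mat x = (\<chi> i j. [:x $ i $ j:])"

lemma const_mat_mult: "const_mat (x ** y) = const_mat x ** const_mat y"
  by (simp add: const_mat_def matrix_matrix_mult_def vec_eq_iff sum_to_poly mult.commute)

lemma const_mat_one: "const_mat (mat 1) = mat 1"
  by (simp add: const_mat_def mat_def vec_eq_iff one_pCons)

lemma matrix_mult_diff_mult:
  "g ** (x - y) ** h = g ** x ** h - g ** y ** (h :: 'a::comm_ring_1^'n^'n)"
  by (simp add: matrix_matrix_mult_def vec_eq_iff algebra_simps sum_subtractf)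

text \<open>Over the polynomial ring the scalar matrix of the indeterminate commutes with constant
  matrices, so the matrix whose determinant is \<open>charpoly\<close> is itself conjugated.\<close>

lemma charpoly_Ad:
  fixes x :: "'k::field^'n^'n"
  assumes "g \<in> SL"
  shows "charpoly (Ad g x) = charpoly x"
proof -
  define X :: "'k poly^'n^'n" where "X = diag (\<lambda>_. [:0, 1:])"
  have cp: "charpoly y = det (X - const_mat y)" for y :: "'k^'n^'n"
    unfolding charpoly_def by (intro arg_cong[where f = det]) (simp add: X_def vec_eq_iff diag_nth const_mat_def)
  let ?G = "const_mat g" and ?H = "const_mat (matrix_inv g)"
  have GH: "?G ** ?H = mat 1" by (simp add: SL_inv[OF assms] const_mat_one flip: const_mat_mult)
  have "?G ** X = X ** ?G"
    by (simp add: X_def vec_eq_iff diag_mult_nth mult_diag_nth mult.commute)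
  then have "?G ** X ** ?H = X"
    using GH by (simp flip: matrix_mul_assoc)
  then have "X - const_mat (Ad g x) = ?G ** (X - const_mat x) ** ?H"
    by (simp add: Ad_def const_mat_mult matrix_mult_diff_mult)
  then have "charpoly (Ad g x) = det ?G * det (X - const_mat x) * det ?H"
    by (simp add: cp det_mul)
  also have "\<dots> = det (?G ** ?H) * det (X - const_mat x)" by (simp add: det_mul mult_ac)
  finally show ?thesis by (simp add: GH cp)
qed

context finite_subfield
begin

text \<open>A permutation matrix has determinant \<open>sign \<pi>\<close>. Scaling one row by this
  sign brings it into SL(n,q) without changing its effect on diagonal matrices.\<close>

lemma monomial_in_SL_F:
  assumes "\<pi> permutes (UNIV :: 'n::finite set)"
  obtains g :: "'k^'n^'n" where "g \<in> SL_F q" "\<And>d. Ad g (diag d) = diag (d \<circ> \<pi>)"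
proof -
  define i0 :: 'n where "i0 = undefined"
  define s :: "'n \<Rightarrow> 'k" where "s i = (if i = i0 then of_int (sign \<pi>) else 1)" for i
  define g :: "'k^'n^'n" where "g = (\<chi> i. s i *s (mat 1 :: 'k^'n^'n) $ \<pi> i)"
  have gn: "g $ i $ j = (if j = \<pi> i then s i else 0)" for i j
    by (simp add: g_def mat_def)
  have "det g = (\<Prod>i\<in>UNIV. s i) * (of_int (sign \<pi>) * 1)"
    unfolding g_def by (subst det_rows_mul, subst det_permute_rows[OF assms]) simp
  also have "(\<Prod>i\<in>UNIV. s i) = of_int (sign \<pi>)"
    unfolding s_def by (subst prod.delta) auto
  finally have "det g = of_int (sign \<pi> * sign \<pi>)" by (simp only: of_int_mult mult_1_right)
  then have SL: "g \<in> SL" by (simp add: SL_def del: of_int_mult)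
  have "s i ^ q = s i" for i
    using frobenius_uminus[of 1] by (cases "\<pi>" rule: sign_cases) (auto simp: s_def)
  then have "frob q g = g"
    using q_gt_1 by (simp add: frob_def vec_eq_iff gn)
  then have "g \<in> SL_F q" using SL by (simp add: SL_F_def)
  moreover have "Ad g (diag d) = diag (d \<circ> \<pi>)" for d
    unfolding Ad_eq_iff[OF SL] by (simp add: vec_eq_iff diag_mult_nth mult_diag_nth gn)
  ultimately show ?thesis using that by blast
qed

text \<open>Orders of the roots of \<open>charpoly\<close> recover the multiset from the orbit;
  conversely, equal multisets differ by a permutation, which a monomial matrix realizes.\<close>

lemma orbit_diag_eq_iff:
  "orbit q (diag d :: 'k^'n^'n) = orbit q (diag d') \<longleftrightarrow> entries d = entries d'"
proof
  assume "orbit q (diag d :: 'k^'n^'n) = orbit q (diag d')"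
  then have "diag d \<in> orbit q (diag d' :: 'k^'n^'n)" using orbit_self by metis
  then obtain g where "g \<in> SL_F q" "diag d = Ad g (diag d' :: 'k^'n^'n)" by (auto simp: orbit_def)
  then have "charpoly (diag d :: 'k^'n^'n) = charpoly (diag d' :: 'k^'n^'n)"
    by (simp add: charpoly_Ad SL_F_SL)
  then show "entries d = entries d'"
    by (intro multiset_eqI) (metis order_charpoly_diag)
next
  assume "entries d = entries d'"
  then obtain \<pi> where \<pi>: "\<pi> permutes UNIV" "\<forall>x\<in>UNIV. d x = d' (\<pi> x)"
    by (rule image_mset_eq_implies_permutes[OF finite])
  obtain g :: "'k^'n^'n" where g: "g \<in> SL_F q" "\<And>d. Ad g (diag d) = diag (d \<circ> \<pi>)"
    using monomial_in_SL_F[OF \<pi>(1)] by blast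
  have "d' \<circ> \<pi> = d" using \<pi>(2) by auto
  then have "Ad g (diag d') = diag d" by (simp add: g(2))
  then show "orbit q (diag d :: 'k^'n^'n) = orbit q (diag d')" using orbit_Ad[OF g(1), of "diag d'"] by simp
qed

end

section \<open>The Weyl group\<close>

text \<open>The inverse makes \<open>axis a 1\<close> go to \<open>axis (\<pi> a) 1\<close> and
  composition covariant.\<close>

definition perm_map :: "('n \<Rightarrow> 'n) \<Rightarrow> real^'n \<Rightarrow> real^'n" where
  "perm_map \<pi> v = (\<chi> i. v $ inv_into UNIV \<pi> i)"

lemma perm_map_axis:
  assumes "bij \<pi>"
  shows "perm_map \<pi> (axis a 1) = axis (\<pi> a) 1"
proof -
  have "inv_into UNIV \<pi> i = a \<longleftrightarrow> i = \<pi> a" for i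
    using bij_inv_eq_iff[OF assms, of a i] by auto
  then show ?thesis by (simp add: perm_map_def vec_eq_iff axis_def)
qed

lemma perm_map_diff: "perm_map \<pi> (v - w) = perm_map \<pi> v - perm_map \<pi> w"
  by (simp add: perm_map_def vec_eq_iff)

lemma perm_map_axis_diff:
  assumes "bij \<pi>"
  shows "perm_map \<pi> (axis a 1 - axis b 1) = axis (\<pi> a) 1 - axis (\<pi> b) 1"
  by (simp add: perm_map_diff perm_map_axis[OF assms])

lemma perm_map_comp:
  assumes "bij \<pi>" "bij \<rho>"
  shows "perm_map \<pi> \<circ> perm_map \<rho> = perm_map (\<pi> \<circ> \<rho>)"
  by (rule ext) (simp add: perm_map_def o_inv_distrib[OF assms])

lemma perm_map_id: "perm_map id = id"
  by (rule ext) (simp add: perm_map_def)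

lemma perm_map_inv:
  assumes "bij \<pi>"
  shows "perm_map (inv_into UNIV \<pi>) \<circ> perm_map \<pi> = id" "perm_map \<pi> \<circ> perm_map (inv_into UNIV \<pi>) = id"
  using assms by (simp_all add: perm_map_comp bij_imp_bij_inv perm_map_id bij_is_inj bij_is_surj
      inj_iff[THEN iffD1] surj_iff[THEN iffD1])

lemma linear_perm_map: "linear (perm_map \<pi>)"
  by (rule linearI) (simp_all add: perm_map_def vec_eq_iff)

lemma bij_perm_map: "bij \<pi> \<Longrightarrow> bij (perm_map \<pi>)"
  using perm_map_inv by (metis o_bij)

lemma root_reflection_axis_diff:
  fixes a b :: "'n::finite"
  assumes "a \<noteq> b"
  shows "root_reflection (axis a 1 - axis b 1) = perm_map (Transposition.transpose a b)"
proof (rule ext)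
  fix v :: "real^'n"
  have "root_reflection (axis a 1 - axis b 1) v = v - (v $ a - v $ b) *\<^sub>R (axis a 1 - axis b 1)"
    unfolding root_reflection_def axis_diff_norm[OF assms] by (simp add: inner_axis_diff)
  also have "\<dots> = perm_map (Transposition.transpose a b) v"
    using assms by (auto simp: vec_eq_iff perm_map_def axis_def Transposition.transpose_def)
  finally show "root_reflection (axis a 1 - axis b 1) v = perm_map (Transposition.transpose a b) v" .
qed

text \<open>Root reflections are the transpositions of coordinates, and these generate all
  permutations.\<close>

lemma weyl_group_A: "weyl_group (roots_A :: (real^'n) set) = perm_map ` {\<pi>. bij \<pi>}"
proof -
  let ?G = "\<lparr>carrier = {w :: real^'n \<Rightarrow> real^'n. linear w \<and> bij w}, mult = (\<circ>), one = id\<rparr>"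
  have gen: "\<exists>\<pi>. bij \<pi> \<and> w = perm_map \<pi> \<and> w \<circ> w = id" if w: "w \<in> root_reflection ` (roots_A :: (real^'n) set)" for w
  proof -
    obtain a b :: 'n where ab: "a \<noteq> b" "w = root_reflection (axis a 1 - axis b 1)"
      using w by (auto simp: roots_A_def)
    let ?\<tau> = "Transposition.transpose a b"
    have "w = perm_map ?\<tau>" by (simp only: ab(2) root_reflection_axis_diff[OF ab(1)])
    moreover have "perm_map ?\<tau> \<circ> perm_map ?\<tau> = id"
      by (simp add: perm_map_comp perm_map_id)
    ultimately show ?thesis by (intro exI[of _ ?\<tau>]) auto
  qed
  show ?thesis
  proof (intro equalityI subsetI)
    fix w assume "w \<in> weyl_group (roots_A :: (real^'n) set)"
    then show "w \<in> perm_map ` {\<pi>. bij \<pi>}" unfolding weyl_group_def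
    proof (induction rule: generate.induct)
      case one
      show ?case
        by (simp only: monoid.select_convs) (rule image_eqI[of _ perm_map id], simp_all only: perm_map_id mem_Collect_eq bij_id)
    next
      case (incl h)
      then show ?case using gen by blast
    next
      case (inv h)
      obtain \<pi> where \<pi>: "bij \<pi>" "h = perm_map \<pi>" "h \<circ> h = id" using gen[OF inv] by blast
      \<comment> \<open>A reflection is an involution, so the inverse rule of
        \<open>generate\<close> yields nothing new.\<close>
      have "inv\<^bsub>?G\<^esub> h = h" unfolding m_inv_def
      proof (rule the_equality)
        show "h \<in> carrier ?G \<and> h \<otimes>\<^bsub>?G\<^esub> h = \<one>\<^bsub>?G\<^esub> \<and> h \<otimes>\<^bsub>?G\<^esub> h = \<one>\<^bsub>?G\<^esub>"
          using \<pi> by (simp add: linear_perm_map bij_perm_map)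
      next
        fix y assume "y \<in> carrier ?G \<and> h \<otimes>\<^bsub>?G\<^esub> y = \<one>\<^bsub>?G\<^esub> \<and> y \<otimes>\<^bsub>?G\<^esub> h = \<one>\<^bsub>?G\<^esub>"
        then have "h \<circ> y = id" by simp
        then have "h \<circ> (h \<circ> y) = h" by simp
        then show "y = h" using \<pi>(3) by (simp flip: comp_assoc)
      qed
      then show ?case using \<pi> by auto
    next
      case (eng h1 h2)
      then obtain \<pi> \<rho> where "bij \<pi>" "bij \<rho>" "h1 = perm_map \<pi>" "h2 = perm_map \<rho>"
        by blast
      then have "h1 \<circ> h2 = perm_map (\<pi> \<circ> \<rho>)" "bij (\<pi> \<circ> \<rho>)"
        by (simp_all add: perm_map_comp bij_comp)
      then show ?case
        by (simp only: monoid.select_convs) (rule image_eqI[of _ perm_map "\<pi> \<circ> \<rho>"], simp_all only: mem_Collect_eq)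
    qed
  next
    fix w :: "real^'n \<Rightarrow> real^'n" assume "w \<in> perm_map ` {\<pi>. bij \<pi>}"
    then obtain \<pi> where \<pi>: "bij \<pi>" "w = perm_map \<pi>" by blast
    from \<pi>(1) have "\<pi> permutes UNIV" by (intro bij_imp_permutes) auto
    from this finite have "perm_map \<pi> \<in> weyl_group (roots_A :: (real^'n) set)"
    proof (induction rule: permutes_induct)
      case id
      show ?case
        using generate.one[of ?G "root_reflection ` roots_A"]
        unfolding perm_map_id weyl_group_def by (simp only: monoid.select_convs)
    next
      case (swap a b p)
      have "perm_map (Transposition.transpose a b) \<in> weyl_group (roots_A :: (real^'n) set)"
        unfolding weyl_group_def root_reflection_axis_diff[OF swap(3), symmetric]
        by (rule generate.incl) (use swap(3) in \<open>auto simp: roots_A_def\<close>)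
      then have "perm_map (Transposition.transpose a b) \<circ> perm_map p \<in> weyl_group (roots_A :: (real^'n) set)"
        using swap generate.eng[of _ ?G] unfolding weyl_group_def by force
      moreover have "perm_map (Transposition.transpose a b) \<circ> perm_map p =
          perm_map (Transposition.transpose a b \<circ> p)"
        by (rule perm_map_comp) (simp, use swap permutes_bij in blast)
      ultimately show ?case by (simp only:)
    qed
    then show "w \<in> weyl_group roots_A" by (simp add: \<pi>(2))
  qed
qed

lemma weyl_equiv_A_iff:
  "weyl_equiv (roots_A :: (real^'n) set) S S' \<longleftrightarrow> (\<exists>\<pi>. bij \<pi> \<and> perm_map \<pi> ` S = S')"
  by (auto simp: weyl_equiv_def weyl_group_A)

lemma conn_perm_map:
  assumes "bij \<pi>" "(a, b) \<in> conn S"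
  shows "(\<pi> a, \<pi> b) \<in> conn (perm_map \<pi> ` S)"
proof -
  have inj: "\<pi> x = \<pi> y \<longleftrightarrow> x = y" for x y using assms(1) by (simp add: bij_is_inj inj_eq)
  have edge: "(\<pi> x, \<pi> y) \<in> root_edges (perm_map \<pi> ` S)" if "(x, y) \<in> root_edges S" for x y
    using that imageI[of "axis x 1 - axis y 1" S "perm_map \<pi>"]
    by (simp add: root_edges_def inj perm_map_axis_diff[OF assms(1)])
  show ?thesis using assms(2) unfolding conn_def
  proof (induction rule: rtrancl_induct)
    case (step y z)
    have "(\<pi> y, \<pi> z) \<in> root_edges (perm_map \<pi> ` S) \<union> (root_edges (perm_map \<pi> ` S))\<inverse>"
      using step.hyps(2) edge by blast
    then show ?case by (rule rtrancl_into_rtrancl[OF step.IH])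
  qed simp
qed

text \<open>A Weyl element renames indices. Labelling each index by its class in
  \<open>conn S\<close> turns both types into spectra of one labelling, before and after
  renaming.\<close>

lemma block_type_conn_weyl_equiv:
  fixes S :: "(real^'n) set"
  assumes "weyl_equiv (roots_A :: (real^'n) set) S S'"
  shows "block_type (conn S) = block_type (conn S')"
proof -
  obtain \<pi> where \<pi>: "bij \<pi>" "perm_map \<pi> ` S = S'" using assms by (auto simp: weyl_equiv_A_iff)
  have inv: "perm_map (inv_into UNIV \<pi>) ` S' = S"
    using perm_map_inv(1)[OF \<pi>(1)] by (simp add: image_image flip: \<pi>(2)) (simp add: comp_def fun_eq_iff)
  have c: "(inv_into UNIV \<pi> a, inv_into UNIV \<pi> b) \<in> conn S \<longleftrightarrow> (a, b) \<in> conn S'" for a b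
  proof
    assume "(inv_into UNIV \<pi> a, inv_into UNIV \<pi> b) \<in> conn S"
    from conn_perm_map[OF \<pi>(1) this] show "(a, b) \<in> conn S'"
      using \<pi> by (simp add: bij_is_surj surj_f_inv_f)
  next
    assume "(a, b) \<in> conn S'"
    from conn_perm_map[OF bij_imp_bij_inv[OF \<pi>(1)] this] show "(inv_into UNIV \<pi> a, inv_into UNIV \<pi> b) \<in> conn S"
      by (simp add: inv)
  qed
  define d where "d a = conn S `` {a}" for a
  have d: "d a = d b \<longleftrightarrow> (a, b) \<in> conn S" for a b
    unfolding d_def using equiv_conn[of S] by (rule eq_equiv_class_iff) auto
  have "block_type (conn S) = mult_type (entries d)"
    by (rule mult_type_entries[symmetric]) (simp add: d)
  also have "entries d = entries (d \<circ> inv_into UNIV \<pi>)"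
  proof -
    have "image_mset (inv_into UNIV \<pi>) (mset_set UNIV) = mset_set (inv_into UNIV \<pi> ` UNIV)"
      using \<pi>(1) by (intro image_mset_mset_set) (simp add: bij_imp_bij_inv bij_is_inj)
    also have "inv_into UNIV \<pi> ` UNIV = UNIV" using \<pi>(1) by (simp add: bij_imp_bij_inv bij_is_surj)
    finally have "image_mset d (image_mset (inv_into UNIV \<pi>) (mset_set UNIV)) = image_mset d (mset_set UNIV)"
      by (rule arg_cong)
    then show ?thesis by (simp add: image_mset.compositionality)
  qed
  also have "mult_type (entries (d \<circ> inv_into UNIV \<pi>)) = block_type (conn S')"
    by (rule mult_type_entries) (simp add: d c)
  finally show ?thesis .
qed

text \<open>The diagram of the composition \<open>xs\<close>: row j has \<open>xs ! j\<close>
  cells.\<close>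

definition cells :: "nat list \<Rightarrow> (nat \<times> nat) set" where
  "cells xs = (SIGMA j:{..<length xs}. {..<xs ! j})"

text \<open>\<open>presents \<phi> xs S\<close>: the roots in \<open>S\<close> are the edges of disjoint directed paths of
  \<open>xs ! 0, xs ! 1, \<dots>\<close> vertices, and \<open>\<phi> (j, k)\<close> is the \<open>k\<close>-th vertex of path \<open>j\<close>.\<close>

definition presents :: "(nat \<times> nat \<Rightarrow> 'n) \<Rightarrow> nat list \<Rightarrow> (real^'n) set \<Rightarrow> bool" where
  "presents \<phi> xs S \<longleftrightarrow> bij_betw \<phi> (cells xs) UNIV \<and> 0 \<notin> set xs \<and>
     S = (\<lambda>(j, k). axis (\<phi> (j, k)) 1 - axis (\<phi> (j, Suc k)) 1) ` {(j, k). (j, Suc k) \<in> cells xs}"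

lemma image_nth_mset: "image_mset ((!) xs) (mset_set {..<length xs}) = mset xs"
proof -
  have "mset xs = mset (map ((!) xs) [0..<length xs])" by (simp add: map_nth)
  also have "\<dots> = image_mset ((!) xs) (mset_set {..<length xs})"
    by (simp add: atLeast0LessThan)
  finally show ?thesis ..
qed

text \<open>The row number is constant along edges, and every vertex is joined to the first vertex
  of its row, so the components are exactly the rows.\<close>

lemma presents_block_type:
  fixes \<phi> :: "nat \<times> nat \<Rightarrow> 'n::finite" and S :: "(real^'n) set"
  assumes "presents \<phi> xs S"
  shows "block_type (conn S) = mset xs"
proof -
  have bij: "bij_betw \<phi> (cells xs) UNIV" and pos: "0 \<notin> set xs"
    and S: "S = (\<lambda>(j, k). axis (\<phi> (j, k)) 1 - axis (\<phi> (j, Suc k)) 1) ` {(j, k). (j, Suc k) \<in> cells xs}"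
    using assms by (auto simp: presents_def)
  define \<psi> where "\<psi> = inv_into (cells xs) \<phi>"
  have \<psi>\<phi>: "\<psi> (\<phi> x) = x" if "x \<in> cells xs" for x
    using that bij by (simp add: \<psi>_def bij_betw_inv_into_left)
  have \<phi>\<psi>: "\<phi> (\<psi> a) = a" "\<psi> a \<in> cells xs" for a
    using bij by (auto simp: \<psi>_def bij_betw_def inv_into_into f_inv_into_f)
  define d where "d a = fst (\<psi> a)" for a
  have cell: "(j, k) \<in> cells xs" if "(j, Suc k) \<in> cells xs" for j k
    using that by (auto simp: cells_def)
  have edge: "d a = d b" if ab_edge: "(a, b) \<in> root_edges S" for a b
  proof -
    obtain j k where jk: "(j, Suc k) \<in> cells xs" and ab: "a \<noteq> b"
      "(axis a 1 - axis b 1 :: real^'n) = axis (\<phi> (j, k)) 1 - axis (\<phi> (j, Suc k)) 1"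
      using ab_edge unfolding root_edges_def S by auto
    have "a = \<phi> (j, k)" "b = \<phi> (j, Suc k)"
      using axis_diff_eq_iff[OF ab(1), THEN iffD1, OF ab(2)] by auto
    then show ?thesis using \<psi>\<phi>[OF jk] \<psi>\<phi>[OF cell[OF jk]] by (simp add: d_def)
  qed
  have path: "(\<phi> (j, 0), \<phi> (j, k)) \<in> conn S" if "(j, k) \<in> cells xs" for j k
    using that
  proof (induction k)
    case 0
    then show ?case by (simp add: conn_refl)
  next
    case (Suc k)
    have "\<phi> (j, k) \<noteq> \<phi> (j, Suc k)"
      using \<psi>\<phi>[OF Suc.prems] \<psi>\<phi>[OF cell[OF Suc.prems]] by (metis n_not_Suc_n prod.inject)
    moreover have "axis (\<phi> (j, k)) 1 - axis (\<phi> (j, Suc k)) 1 \<in> S"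
      unfolding S using Suc.prems by (intro image_eqI[of _ _ "(j, k)"]) auto
    ultimately have "(\<phi> (j, k), \<phi> (j, Suc k)) \<in> conn S"
      unfolding conn_def root_edges_def by (intro r_into_rtrancl UnI1) simp
    then show ?case using Suc.IH[OF cell[OF Suc.prems]] conn_trans by blast
  qed
  have "d a = d b \<longleftrightarrow> (a, b) \<in> conn S" for a b
  proof
    assume "(a, b) \<in> conn S"
    then show "d a = d b" unfolding conn_def
    proof (induction rule: rtrancl_induct)
      case (step y z)
      have "d y = d z" using step.hyps(2) edge[of y z] edge[of z y] by auto
      then show ?case using step.IH by simp
    qed simp
  next
    assume eq: "d a = d b"
    obtain j k where jk: "\<psi> a = (j, k)" by fastforce
    obtain l where l: "\<psi> b = (j, l)" using eq jk by (metis d_def fst_conv prod.exhaust_sel)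
    have "(\<phi> (j, 0), a) \<in> conn S" "(\<phi> (j, 0), b) \<in> conn S"
      using path[of j k] path[of j l] \<phi>\<psi>[of a] \<phi>\<psi>[of b] by (simp_all add: jk l)
    then show "(a, b) \<in> conn S" using conn_sym conn_trans by blast
  qed
  then have "block_type (conn S) = mult_type (entries d)"
    by (intro mult_type_entries[symmetric]) simp
  also have "\<dots> = mset xs"
  proof -
    have cnt: "count (entries d) j = xs ! j" if "j < length xs" for j
    proof -
      have "{a. d a = j} = \<phi> ` ({j} \<times> {..<xs ! j})"
      proof (intro equalityI subsetI)
        fix a assume "a \<in> {a. d a = j}"
        then have "\<psi> a \<in> {j} \<times> {..<xs ! j}" using \<phi>\<psi>(2)[of a] by (auto simp: d_def cells_def)
        then show "a \<in> \<phi> ` ({j} \<times> {..<xs ! j})" using \<phi>\<psi>(1)[of a] by (metis imageI)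
      next
        fix a assume "a \<in> \<phi> ` ({j} \<times> {..<xs ! j})"
        then obtain k where "k < xs ! j" "a = \<phi> (j, k)" by auto
        then show "a \<in> {a. d a = j}" using \<psi>\<phi>[of "(j, k)"] that by (simp add: d_def cells_def)
      qed
      moreover have "inj_on \<phi> ({j} \<times> {..<xs ! j})"
        by (rule inj_on_subset[of _ "cells xs"]) (use bij that in \<open>auto simp: bij_betw_def cells_def\<close>)
      ultimately show ?thesis by (simp add: count_entries card_image card_cartesian_product)
    qed
    have "range d = {..<length xs}"
    proof (intro equalityI subsetI)
      fix j assume "j \<in> {..<length xs}"
      then have "count (entries d) j \<noteq> 0" using cnt[of j] pos by (metis lessThan_iff nth_mem)
      then show "j \<in> range d" by (auto simp: count_entries)
    qed (use \<phi>\<psi>(2) in \<open>auto simp: d_def cells_def split: prod.splits\<close>, metis SigmaD1 lessThan_iff prod.collapse)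
    then have "mult_type (entries d) = image_mset (count (entries d)) (mset_set {..<length xs})"
      by (simp add: mult_type_def)
    also have "\<dots> = image_mset ((!) xs) (mset_set {..<length xs})"
      by (rule image_mset_cong) (simp add: cnt)
    finally show ?thesis by (simp add: image_nth_mset)
  qed
  finally show ?thesis .
qed

text \<open>Rows of equal length are matched and positions within them are kept. The resulting
  permutation of indices carries directed edges to directed edges, hence \<open>S\<close> onto
  \<open>S'\<close> itself and not merely its components.\<close>

lemma presents_weyl_equiv:
  fixes S S' :: "(real^'n) set"
  assumes "presents \<phi> xs S" "presents \<psi> ys S'" "mset xs = mset ys"
  shows "weyl_equiv (roots_A :: (real^'n) set) S S'"
proof -
  have \<phi>: "bij_betw \<phi> (cells xs) UNIV" and \<psi>: "bij_betw \<psi> (cells ys) UNIV"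
    using assms(1,2) by (auto simp: presents_def)
  obtain h where h: "bij_betw h {..<length xs} {..<length ys}" "\<forall>j\<in>{..<length xs}. ys ! h j = xs ! j"
    using image_mset_eq_imp_bij_betw[of "{..<length xs}" "{..<length ys}" "(!) xs" "(!) ys"] assms(3)
    by (auto simp: image_nth_mset)
  have H: "bij_betw (map_prod h id) (cells xs) (cells ys)"
  proof (rule bij_betw_imageI)
    show "inj_on (map_prod h id) (cells xs)"
      using h(1) by (auto simp: inj_on_def cells_def bij_betw_def)
    show "map_prod h id ` cells xs = cells ys"
    proof (intro equalityI subsetI)
      fix x assume "x \<in> map_prod h id ` cells xs"
      then show "x \<in> cells ys" using h by (auto simp: cells_def bij_betw_def)
    next
      fix x assume "x \<in> cells ys"
      then obtain i k where x: "x = (i, k)" "i < length ys" "k < ys ! i" by (auto simp: cells_def)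
      then obtain j where "j < length xs" "i = h j"
        using h(1) unfolding bij_betw_def by (metis imageE lessThan_iff)
      then show "x \<in> map_prod h id ` cells xs"
        using x h(2) by (intro image_eqI[of _ _ "(j, k)"]) (auto simp: cells_def)
    qed
  qed
  define \<pi> where "\<pi> = (\<psi> \<circ> map_prod h id) \<circ> inv_into (cells xs) \<phi>"
  have \<pi>: "bij \<pi>"
    unfolding \<pi>_def by (intro bij_betw_trans[OF bij_betw_inv_into[OF \<phi>]] bij_betw_trans[OF H] \<psi>)
  have \<pi>\<phi>: "\<pi> (\<phi> (j, k)) = \<psi> (h j, k)" if "(j, k) \<in> cells xs" for j k
    using that \<phi> by (simp add: \<pi>_def bij_betw_inv_into_left)
  have mem: "(h j, k) \<in> cells ys \<longleftrightarrow> (j, k) \<in> cells xs" if "j < length xs" for j k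
    using that h unfolding cells_def bij_betw_def by auto
  have "perm_map \<pi> ` S = S'"
  proof (intro equalityI subsetI)
    fix v assume "v \<in> perm_map \<pi> ` S"
    then obtain j k where jk: "(j, Suc k) \<in> cells xs"
      "v = perm_map \<pi> (axis (\<phi> (j, k)) 1 - axis (\<phi> (j, Suc k)) 1)"
      using assms(1) unfolding presents_def by auto
    then have "(j, k) \<in> cells xs" "j < length xs" by (auto simp: cells_def)
    then have "v = axis (\<psi> (h j, k)) 1 - axis (\<psi> (h j, Suc k)) 1" "(h j, Suc k) \<in> cells ys"
      using jk by (simp_all add: perm_map_axis_diff[OF \<pi>] \<pi>\<phi> mem)
    then show "v \<in> S'" using assms(2) unfolding presents_def by auto
  next
    fix v assume "v \<in> S'"
    then obtain i k where ik: "(i, Suc k) \<in> cells ys" "v = axis (\<psi> (i, k)) 1 - axis (\<psi> (i, Suc k)) 1"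
      using assms(2) unfolding presents_def by auto
    then obtain j where j: "j < length xs" "i = h j"
      using h(1) unfolding bij_betw_def cells_def by (metis SigmaD1 imageE lessThan_iff)
    then have jk: "(j, Suc k) \<in> cells xs" using ik(1) mem by simp
    then have "(j, k) \<in> cells xs" by (auto simp: cells_def)
    then have "v = perm_map \<pi> (axis (\<phi> (j, k)) 1 - axis (\<phi> (j, Suc k)) 1)"
      using jk ik(2) j by (simp add: perm_map_axis_diff[OF \<pi>] \<pi>\<phi>)
    moreover have "axis (\<phi> (j, k)) 1 - axis (\<phi> (j, Suc k)) 1 \<in> S"
      using assms(1) jk unfolding presents_def by auto
    ultimately show "v \<in> perm_map \<pi> ` S" by blast
  qed
  then show ?thesis using \<pi> by (auto simp: weyl_equiv_A_iff)
qed

section \<open>Simple systems\<close>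

lemma representation_eq_0_imp:
  fixes \<Delta> :: "(real^'n) set"
  assumes "independent \<Delta>" "v \<in> span \<Delta>" "\<forall>\<beta>\<in>\<Delta>. representation \<Delta> v \<beta> = 0"
  shows "v = 0"
proof -
  have "(\<Sum>\<beta>\<in>\<Delta>. representation \<Delta> v \<beta> *\<^sub>R \<beta>) = v"
    using assms by (intro sum_representation_eq) (auto intro: independent_imp_finite)
  then show ?thesis using assms(3) by simp
qed

text \<open>Prefix sums along the enumeration are dual to the simple roots, so they read off coefficients.\<close>

definition prefix_sum :: "(nat \<Rightarrow> 'n) \<Rightarrow> nat \<Rightarrow> real^'n \<Rightarrow> real" where
  "prefix_sum \<sigma> i v = (\<Sum>k\<le>i. v $ \<sigma> k)"

lemma linear_prefix_sum: "linear (prefix_sum \<sigma> i)"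
  by (rule linearI) (simp_all add: prefix_sum_def sum.distrib sum_distrib_left)

lemma prefix_sum_axis_diff:
  fixes \<sigma> :: "nat \<Rightarrow> 'n::finite"
  assumes "inj_on \<sigma> {..<N}" "i < N" "a < N" "b < N"
  shows "prefix_sum \<sigma> i (axis (\<sigma> a) 1 - axis (\<sigma> b) 1) = (if a \<le> i then 1 else 0) - (if b \<le> i then 1 else 0)"
proof -
  have "(axis (\<sigma> c) 1 :: real^'n) $ \<sigma> k = (if k = c then 1 else 0)" if "k \<le> i" "c < N" for k c
    using that assms inj_onD[OF assms(1), of k c] by (auto simp: axis_def)
  then have "prefix_sum \<sigma> i (axis (\<sigma> a) 1 - axis (\<sigma> b) 1) =
      (\<Sum>k\<le>i. (if k = a then 1 else 0) - (if k = b then 1 else 0))"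
    unfolding prefix_sum_def using assms by (intro sum.cong) auto
  then show ?thesis by (simp add: sum_subtractf)
qed

text \<open>A simple system orders the indices: a precedes b when e_a - e_b is positive. The simple
  roots are the differences of neighbours in this order.\<close>

lemma simple_system_A_enumeration:
  fixes \<Delta> :: "(real^'n) set"
  assumes "simple_system (roots_A :: (real^'n) set) \<Delta>"
  obtains \<sigma> :: "nat \<Rightarrow> 'n" where "bij_betw \<sigma> {..<CARD('n)} UNIV"
    "\<Delta> = (\<lambda>i. axis (\<sigma> i) 1 - axis (\<sigma> (Suc i)) 1) ` {i. Suc i < CARD('n)}"
proof -
  let ?N = "CARD('n)"
  let ?r = "\<lambda>a b. axis a 1 - axis b 1 :: real^'n"
  have sub: "\<Delta> \<subseteq> roots_A" and ind: "independent \<Delta>" and sp: "roots_A \<subseteq> span \<Delta>"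
    and sgn: "\<And>\<alpha>. \<alpha> \<in> roots_A \<Longrightarrow> (\<forall>\<beta>\<in>\<Delta>. representation \<Delta> \<alpha> \<beta> \<ge> 0) \<or> (\<forall>\<beta>\<in>\<Delta>. representation \<Delta> \<alpha> \<beta> \<le> 0)"
    using assms unfolding simple_system_def by auto
  have root: "?r a b \<in> roots_A" if "a \<noteq> b" for a b
    using that by (auto simp: roots_A_def)
  have rsp: "?r a b \<in> span \<Delta>" for a b
    using root[of a b] sp by (cases "a = b") (auto simp: span_zero)
  define pos where "pos a b \<longleftrightarrow> a \<noteq> b \<and> (\<forall>\<beta>\<in>\<Delta>. representation \<Delta> (?r a b) \<beta> \<ge> 0)" for a b
  have neg: "representation \<Delta> (?r b a) \<beta> = - representation \<Delta> (?r a b) \<beta>" for a b \<beta>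
    using representation_neg[OF ind rsp[of a b]] by simp
  have add: "representation \<Delta> (?r a c) \<beta> = representation \<Delta> (?r a b) \<beta> + representation \<Delta> (?r b c) \<beta>" for a b c \<beta>
  proof -
    have "representation \<Delta> (?r a c) \<beta> = representation \<Delta> (?r a b + ?r b c) \<beta>" by simp
    also have "\<dots> = representation \<Delta> (?r a b) \<beta> + representation \<Delta> (?r b c) \<beta>"
      by (simp only: representation_add[OF ind rsp[of b c] rsp[of a b]])
    finally show ?thesis .
  qed
  have total: "pos a b \<or> pos b a" if "a \<noteq> b" for a b
  proof -
    have "representation \<Delta> (?r b a) \<beta> \<ge> 0 \<longleftrightarrow> representation \<Delta> (?r a b) \<beta> \<le> 0" for \<beta>
      using neg[of b a \<beta>] by linarith
    then show ?thesis using sgn[OF root[OF that]] that by (simp add: pos_def)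
  qed
  have antisym: "\<not> (pos a b \<and> pos b a)" for a b
  proof
    assume *: "pos a b \<and> pos b a"
    have "\<forall>\<beta>\<in>\<Delta>. representation \<Delta> (?r a b) \<beta> = 0"
    proof
      fix \<beta> assume "\<beta> \<in> \<Delta>"
      then have "representation \<Delta> (?r a b) \<beta> \<ge> 0" "representation \<Delta> (?r b a) \<beta> \<ge> 0"
        using * by (simp_all add: pos_def)
      then show "representation \<Delta> (?r a b) \<beta> = 0" using neg[of b a \<beta>] by linarith
    qed
    then have "?r a b = 0" by (rule representation_eq_0_imp[OF ind rsp])
    then show False using * by (auto simp: pos_def axis_eq_axis)
  qed
  have trans: "pos a c" if "pos a b" "pos b c" for a b c
  proof -
    have "a \<noteq> c" using that antisym by blast
    moreover have "representation \<Delta> (?r a c) \<beta> \<ge> 0" if "\<beta> \<in> \<Delta>" for \<beta>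
    proof -
      have "representation \<Delta> (?r a b) \<beta> \<ge> 0" "representation \<Delta> (?r b c) \<beta> \<ge> 0"
        using \<open>pos a b\<close> \<open>pos b c\<close> that by (simp_all add: pos_def)
      then show ?thesis using add[of a c \<beta> b] by linarith
    qed
    ultimately show ?thesis by (simp add: pos_def)
  qed
  \<comment> \<open>The number of predecessors; its inverse enumerates the indices in increasing
    order.\<close>
  define rank where "rank a = card {b. pos b a}" for a
  have rank_less: "rank a < rank b" if "pos a b" for a b
    unfolding rank_def
  proof (rule psubset_card_mono)
    show "{c. pos c a} \<subset> {c. pos c b}"
      using that trans antisym by blast
  qed simp
  have rank_iff: "rank a < rank b \<longleftrightarrow> pos a b" for a b
    using rank_less total by (metis less_asym less_irrefl)
  have inj: "inj rank"
    by (rule injI) (metis rank_less total less_irrefl)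
  have "rank a < ?N" for a
  proof -
    have "{b. pos b a} \<subset> UNIV" using antisym[of a a] by blast
    then show ?thesis unfolding rank_def by (intro psubset_card_mono) auto
  qed
  then have "rank ` UNIV = {..<?N}"
    by (intro card_subset_eq) (auto simp: card_image[OF inj])
  then have bij: "bij_betw rank UNIV {..<?N}" using inj by (simp add: bij_betw_def)
  define \<sigma> where "\<sigma> = inv_into UNIV rank"
  have \<sigma>: "bij_betw \<sigma> {..<?N} UNIV" unfolding \<sigma>_def by (rule bij_betw_inv_into[OF bij])
  have rs: "rank (\<sigma> i) = i" if "i < ?N" for i
    using that bij by (simp add: \<sigma>_def bij_betw_inv_into_right)
  have sr: "\<sigma> (rank a) = a" for a
    using bij by (simp add: \<sigma>_def bij_betw_inv_into_left)
  have rN: "rank a < ?N" for a using bij by (auto simp: bij_betw_def)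
  have inj\<sigma>: "inj_on \<sigma> {..<?N}" using \<sigma> by (simp add: bij_betw_def)
  have D_sub: "\<beta> \<in> (\<lambda>i. ?r (\<sigma> i) (\<sigma> (Suc i))) ` {i. Suc i < ?N}" if \<beta>: "\<beta> \<in> \<Delta>" for \<beta>
  proof -
    obtain a b where ab: "a \<noteq> b" "\<beta> = ?r a b" using sub \<beta> by (auto simp: roots_A_def)
    have basis: "representation \<Delta> (?r a b) \<gamma> = (if \<gamma> = \<beta> then 1 else 0)" for \<gamma>
      using representation_basis[OF ind \<beta>] by (simp add: ab(2))
    have "pos a b" unfolding pos_def using ab(1) by (simp add: basis)
    then have less: "rank a < rank b" by (simp add: rank_iff)
    have "rank b = Suc (rank a)"
    \<comment> \<open>An index strictly between a and b would write the simple root as a sum of two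
      positive roots. Nonnegative coefficients force each summand to be a multiple of \<beta>, which
      coordinate \<open>c\<close> refutes.\<close>
    proof (rule ccontr)
      assume ne: "rank b \<noteq> Suc (rank a)"
      define c where "c = \<sigma> (Suc (rank a))"
      have rc: "rank c = Suc (rank a)" unfolding c_def using less rN[of b] by (intro rs) simp
      then have ac: "pos a c" and cb: "pos c b" using ne less by (auto simp flip: rank_iff)
      have zero: "representation \<Delta> (?r a c) \<gamma> = 0" if "\<gamma> \<in> \<Delta>" "\<gamma> \<noteq> \<beta>" for \<gamma>
      proof -
        have "representation \<Delta> (?r a c) \<gamma> + representation \<Delta> (?r c b) \<gamma> = 0"
          using add[of a b \<gamma> c] basis[of \<gamma>] that by simp
        moreover have "representation \<Delta> (?r a c) \<gamma> \<ge> 0" "representation \<Delta> (?r c b) \<gamma> \<ge> 0"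
          using ac cb that by (auto simp: pos_def)
        ultimately show ?thesis by linarith
      qed
      have fin: "finite \<Delta>" using ind by (rule independent_imp_finite)
      have "?r a c = (\<Sum>\<gamma>\<in>\<Delta>. representation \<Delta> (?r a c) \<gamma> *\<^sub>R \<gamma>)"
        using ind rsp fin by (intro sum_representation_eq[symmetric]) auto
      also have "\<dots> = (\<Sum>\<gamma>\<in>{\<beta>}. representation \<Delta> (?r a c) \<gamma> *\<^sub>R \<gamma>)"
        by (rule sum.mono_neutral_right) (use fin \<beta> zero in auto)
      finally have "?r a c = representation \<Delta> (?r a c) \<beta> *\<^sub>R ?r a b" by (simp add: ab(2))
      then have "?r a c $ c = (representation \<Delta> (?r a c) \<beta> *\<^sub>R ?r a b) $ c" by metis
      moreover have "c \<noteq> a" "c \<noteq> b" using ac cb by (auto simp: pos_def)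
      ultimately show False by (simp add: axis_def)
    qed
    then have "\<beta> = ?r (\<sigma> (rank a)) (\<sigma> (Suc (rank a)))" "Suc (rank a) < ?N"
      using rN[of b] sr[of a] sr[of b] by (simp_all add: ab(2))
    then show ?thesis by blast
  qed
  have "?r (\<sigma> i) (\<sigma> (Suc i)) \<in> \<Delta>" if i: "Suc i < ?N" for i
  proof (rule ccontr)
    assume ni: "?r (\<sigma> i) (\<sigma> (Suc i)) \<notin> \<Delta>"
    have ps: "prefix_sum \<sigma> i (?r (\<sigma> j) (\<sigma> (Suc j))) = (if j = i then 1 else 0)" if "Suc j < ?N" for j
      using prefix_sum_axis_diff[OF inj\<sigma>, of i j "Suc j"] i that by auto
    \<comment> \<open>If the i-th neighbour difference were missing, this functional would vanish on
      the whole span of the simple roots, but it is 1 on that difference.\<close>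
    have "prefix_sum \<sigma> i \<beta> = 0" if "\<beta> \<in> \<Delta>" for \<beta>
      using D_sub[OF that] ps ni that by auto
    then have "prefix_sum \<sigma> i v = 0" if "v \<in> span \<Delta>" for v
      using linear_eq_0_on_span[OF linear_prefix_sum _ that] by blast
    then have "prefix_sum \<sigma> i (?r (\<sigma> i) (\<sigma> (Suc i))) = 0" using rsp by blast
    then show False using ps[OF i] by simp
  qed
  then have "\<Delta> = (\<lambda>i. ?r (\<sigma> i) (\<sigma> (Suc i))) ` {i. Suc i < ?N}"
    using D_sub by blast
  then show ?thesis using that \<sigma> by blast
qed

section \<open>The extended simple system as a directed cycle\<close>

locale ordered_simple_system =
  fixes \<Delta> :: "(real^'n) set" and \<sigma> :: "nat \<Rightarrow> 'n" and N :: nat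
  assumes simple: "simple_system (roots_A :: (real^'n) set) \<Delta>"
    and bij_\<sigma>: "bij_betw \<sigma> {..<N} UNIV"
    and \<Delta>_eq: "\<Delta> = (\<lambda>i. axis (\<sigma> i) 1 - axis (\<sigma> (Suc i)) 1) ` {i. Suc i < N}"
    and card_ge_2: "N \<ge> 2" and N_eq: "N = CARD('n)"
begin

text \<open>The residue closes the path of simple roots into a cycle: \<open>edge (N - 1)\<close> is
  the negative of the highest root.\<close>

definition edge :: "nat \<Rightarrow> real^'n" where
  "edge i = axis (\<sigma> i) 1 - axis (\<sigma> (Suc i mod N)) 1"

lemma inj_\<sigma>: "inj_on \<sigma> {..<N}"
  using bij_\<sigma> by (simp add: bij_betw_def)

lemma \<sigma>_eq_iff: "i < N \<Longrightarrow> j < N \<Longrightarrow> \<sigma> i = \<sigma> j \<longleftrightarrow> i = j"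
  using inj_\<sigma> by (auto simp: inj_on_def)

lemma \<sigma>_surj: "\<exists>i<N. a = \<sigma> i"
  using bij_\<sigma> by (auto simp: bij_betw_def)

lemma Suc_mod_neq: "i < N \<Longrightarrow> Suc i mod N \<noteq> i"
  using card_ge_2 by (cases "Suc i = N") auto

lemma edge_Suc: "Suc i < N \<Longrightarrow> edge i = axis (\<sigma> i) 1 - axis (\<sigma> (Suc i)) 1"
  by (simp add: edge_def)

lemma edge_last: "edge (N - 1) = axis (\<sigma> (N - 1)) 1 - axis (\<sigma> 0) 1"
  using card_ge_2 by (simp add: edge_def)

lemma inj_edge: "inj_on edge {..<N}"
proof (rule inj_onI)
  fix i j assume ij: "i \<in> {..<N}" "j \<in> {..<N}" "edge i = edge j"
  have "\<sigma> i \<noteq> \<sigma> (Suc i mod N)"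
    using ij(1) Suc_mod_neq[of i] card_ge_2 by (subst \<sigma>_eq_iff) auto
  then have "\<sigma> i = \<sigma> j" using ij(3) by (simp add: edge_def axis_diff_eq_iff)
  then show "i = j" using ij by (simp add: \<sigma>_eq_iff)
qed

lemma \<Delta>_eq_edge: "\<Delta> = edge ` {i. Suc i < N}"
  unfolding \<Delta>_eq by (rule image_cong) (simp_all add: edge_Suc)

lemma prefix_sum_root:
  assumes "i < N" "a < N" "b < N"
  shows "prefix_sum \<sigma> i (axis (\<sigma> a) 1 - axis (\<sigma> b) 1) = (if a \<le> i then 1 else 0) - (if b \<le> i then 1 else 0)"
  by (rule prefix_sum_axis_diff[OF inj_\<sigma> assms])

lemma prefix_sum_edge:
  assumes "Suc i < N" "Suc j < N"
  shows "prefix_sum \<sigma> i (edge j) = (if j = i then 1 else 0)"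
  using assms by (auto simp: edge_Suc prefix_sum_root)

lemma prefix_sum_edge_last:
  assumes "Suc i < N"
  shows "prefix_sum \<sigma> i (edge (N - 1)) = - 1"
  using assms by (simp add: edge_last prefix_sum_root del: One_nat_def)

lemma representation_edge:
  assumes "v \<in> span \<Delta>" "Suc i < N"
  shows "representation \<Delta> v (edge i) = prefix_sum \<sigma> i v"
proof -
  have ind: "independent \<Delta>" using simple by (simp add: simple_system_def)
  have inj: "inj_on edge {i. Suc i < N}" by (rule inj_on_subset[OF inj_edge]) auto
  have fin: "finite {i. Suc i < N}" by (rule finite_subset[of _ "{..<N}"]) auto
  have "v = (\<Sum>\<beta>\<in>\<Delta>. representation \<Delta> v \<beta> *\<^sub>R \<beta>)"
    using ind assms(1) by (intro sum_representation_eq[symmetric]) (auto intro: independent_imp_finite)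
  also have "\<dots> = (\<Sum>j | Suc j < N. representation \<Delta> v (edge j) *\<^sub>R edge j)"
    unfolding \<Delta>_eq_edge sum.reindex[OF inj] by (simp add: comp_def)
  finally have "prefix_sum \<sigma> i v = prefix_sum \<sigma> i (\<Sum>j | Suc j < N. representation \<Delta> v (edge j) *\<^sub>R edge j)"
    by (rule arg_cong)
  also have "\<dots> = (\<Sum>j | Suc j < N. representation \<Delta> v (edge j) * prefix_sum \<sigma> i (edge j))"
    by (simp add: linear_sum[OF linear_prefix_sum] linear_scale[OF linear_prefix_sum])
  also have "\<dots> = (\<Sum>j | Suc j < N. if j = i then representation \<Delta> v (edge j) else 0)"
    by (rule sum.cong) (simp_all add: prefix_sum_edge assms(2))
  also have "\<dots> = representation \<Delta> v (edge i)"
    using fin assms(2) by (simp add: sum.delta')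
  finally show ?thesis ..
qed

text \<open>Coefficients of a root are differences of two indicators, hence at most 1, and all are 1
  when the root runs from the first index to the last.\<close>

lemma highest_root_A: "highest_root (roots_A :: (real^'n) set) \<Delta> = axis (\<sigma> 0) 1 - axis (\<sigma> (N - 1)) 1"
proof -
  have sp: "v \<in> span \<Delta>" if "v \<in> roots_A" for v
    using that simple by (auto simp: simple_system_def)
  have rep: "representation \<Delta> (axis (\<sigma> a) 1 - axis (\<sigma> b) 1) (edge i) = (if a \<le> i then 1 else 0) - (if b \<le> i then 1 else 0)"
    if "Suc i < N" "a < N" "b < N" "a \<noteq> b" for a b i
  proof -
    have "axis (\<sigma> a) 1 - axis (\<sigma> b) 1 \<in> (roots_A :: (real^'n) set)"
      using that \<sigma>_eq_iff[of a b] by (auto simp: roots_A_def)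
    then show ?thesis using that by (simp add: representation_edge sp prefix_sum_root)
  qed
  have elim: "\<exists>a b. a < N \<and> b < N \<and> a \<noteq> b \<and> \<alpha> = axis (\<sigma> a) 1 - axis (\<sigma> b) 1"
    if \<alpha>: "\<alpha> \<in> (roots_A :: (real^'n) set)" for \<alpha>
  proof -
    obtain x y where xy: "x \<noteq> y" "\<alpha> = axis x 1 - axis y 1" using \<alpha> by (auto simp: roots_A_def)
    obtain a b where "a < N" "x = \<sigma> a" "b < N" "y = \<sigma> b" using \<sigma>_surj by metis
    then show ?thesis using xy by (intro exI[of _ a] exI[of _ b]) auto
  qed
  have N0: "(0::nat) \<noteq> N - 1" using card_ge_2 by simp
  show ?thesis unfolding highest_root_def
  proof (rule the_equality)
    show "axis (\<sigma> 0) 1 - axis (\<sigma> (N - 1)) 1 \<in> roots_A \<and>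
      (\<forall>\<alpha>\<in>roots_A. \<forall>\<beta>\<in>\<Delta>. representation \<Delta> \<alpha> \<beta> \<le> representation \<Delta> (axis (\<sigma> 0) 1 - axis (\<sigma> (N - 1)) 1) \<beta>)"
    proof (intro conjI ballI)
      show "axis (\<sigma> 0) 1 - axis (\<sigma> (N - 1)) 1 \<in> (roots_A :: (real^'n) set)"
        using \<sigma>_eq_iff[of 0 "N - 1"] N0 card_ge_2 by (auto simp: roots_A_def)
    next
      fix \<alpha> \<beta> assume \<alpha>: "\<alpha> \<in> (roots_A :: (real^'n) set)" and \<beta>: "\<beta> \<in> \<Delta>"
      obtain a b where "a < N" "b < N" "a \<noteq> b" "\<alpha> = axis (\<sigma> a) 1 - axis (\<sigma> b) 1" using elim[OF \<alpha>] by blast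
      moreover obtain i where "Suc i < N" "\<beta> = edge i" using \<beta> by (auto simp: \<Delta>_eq_edge)
      ultimately show "representation \<Delta> \<alpha> \<beta> \<le> representation \<Delta> (axis (\<sigma> 0) 1 - axis (\<sigma> (N - 1)) 1) \<beta>"
        using rep[of i 0 "N - 1"] N0 by (auto simp: rep simp del: One_nat_def)
    qed
  next
    fix \<theta> assume \<theta>: "\<theta> \<in> roots_A \<and> (\<forall>\<alpha>\<in>roots_A. \<forall>\<beta>\<in>\<Delta>. representation \<Delta> \<alpha> \<beta> \<le> representation \<Delta> \<theta> \<beta>)"
    then obtain a b where ab: "a < N" "b < N" "a \<noteq> b" "\<theta> = axis (\<sigma> a) 1 - axis (\<sigma> b) 1" using elim by blast
    have "axis (\<sigma> 0) 1 - axis (\<sigma> (N - 1)) 1 \<in> (roots_A :: (real^'n) set)"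
      using \<sigma>_eq_iff[of 0 "N - 1"] N0 card_ge_2 by (auto simp: roots_A_def)
    then have ge: "representation \<Delta> (axis (\<sigma> 0) 1 - axis (\<sigma> (N - 1)) 1) (edge i) \<le> representation \<Delta> \<theta> (edge i)"
      if "Suc i < N" for i
      using \<theta> that by (auto simp: \<Delta>_eq_edge)
    have one: "1 \<le> (if a \<le> i then 1 else 0) - (if b \<le> i then 1 else 0 :: real)" if "Suc i < N" for i
    proof -
      have "\<not> N - 1 \<le> i" using that by simp
      then show ?thesis
        using ge[OF that] rep[OF that ab(1-3)] rep[OF that, of 0 "N - 1"] N0 card_ge_2
        by (simp add: ab(4) del: One_nat_def)
    qed
    \<comment> \<open>Coefficient 0 forces the root to start at the first index; coefficient N - 2,
      the last one, forces it to end at the last index.\<close>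
    have "a = 0" using one[of 0] card_ge_2 by (auto split: if_splits)
    moreover have "b = N - 1"
    proof -
      have "Suc (N - 2) < N" using card_ge_2 by simp
      from one[OF this] have "\<not> b \<le> N - 2" by (auto split: if_splits)
      then show ?thesis using ab(2) by simp
    qed
    ultimately show "\<theta> = axis (\<sigma> 0) 1 - axis (\<sigma> (N - 1)) 1" by (simp add: ab(4))
  qed
qed

lemma extended_simple_A: "extended_simple roots_A \<Delta> = edge ` {..<N}"
proof -
  have "- highest_root roots_A \<Delta> = edge (N - 1)" by (simp add: highest_root_A edge_last del: One_nat_def)
  moreover have "{..<N} = insert (N - 1) {i. Suc i < N}" using card_ge_2 by auto
  ultimately show ?thesis by (simp add: extended_simple_def \<Delta>_eq_edge)
qed

text \<open>Around the cycle every coordinate vector occurs once with each sign, so the edges sum to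
  0. Uniqueness holds because prefix sum i of a relation is the coefficient of \<open>edge i\<close>
  minus that of the last edge.\<close>

lemma marks_A: "marks roots_A \<Delta> = (\<lambda>\<alpha>. if \<alpha> \<in> edge ` {..<N} then 1 else 0)"
proof -
  have last: "- highest_root roots_A \<Delta> = edge (N - 1)" by (simp add: highest_root_A edge_last del: One_nat_def)
  have sum: "(\<Sum>\<alpha>\<in>edge ` {..<N}. real (c \<alpha>) *\<^sub>R \<alpha>) = (\<Sum>i<N. real (c (edge i)) *\<^sub>R edge i)" for c :: "real^'n \<Rightarrow> nat"
    by (simp add: sum.reindex[OF inj_edge])
  show ?thesis unfolding marks_def extended_simple_A last sum
  proof (rule the_equality)
    have "(\<Sum>i<N. edge i) = (\<Sum>i<N. axis (\<sigma> i) 1) - (\<Sum>i<N. axis (\<sigma> (Suc i mod N)) 1)"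
      by (simp add: edge_def sum_subtractf)
    also have "(\<Sum>i<N. axis (\<sigma> (Suc i mod N)) 1) = (\<Sum>i<N. axis (\<sigma> i) 1 :: real^'n)"
    proof -
      obtain M where M: "N = Suc M" using card_ge_2 by (cases N) auto
      have "(\<Sum>i<N. axis (\<sigma> (Suc i mod N)) 1) = (\<Sum>i<M. axis (\<sigma> (Suc i)) 1) + (axis (\<sigma> 0) 1 :: real^'n)"
        unfolding M by simp
      also have "\<dots> = (\<Sum>i<N. axis (\<sigma> i) 1)"
        unfolding M by (subst sum.lessThan_Suc_shift) simp
      finally show ?thesis .
    qed
    finally show "(\<Sum>i<N. real (if edge i \<in> edge ` {..<N} then 1 else 0) *\<^sub>R edge i) = 0 \<and>
      (if edge (N - 1) \<in> edge ` {..<N} then 1 else 0) = (1::nat) \<and>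
      (\<forall>\<alpha>. \<alpha> \<notin> edge ` {..<N} \<longrightarrow> (if \<alpha> \<in> edge ` {..<N} then 1 else 0) = (0::nat))"
      using card_ge_2 by auto
  next
    fix c :: "real^'n \<Rightarrow> nat"
    assume c: "(\<Sum>i<N. real (c (edge i)) *\<^sub>R edge i) = 0 \<and> c (edge (N - 1)) = 1 \<and>
      (\<forall>\<alpha>. \<alpha> \<notin> edge ` {..<N} \<longrightarrow> c \<alpha> = 0)"
    have "c (edge i) = 1" if i: "i < N" for i
    proof (cases "Suc i < N")
      case True
      have "0 = prefix_sum \<sigma> i (\<Sum>j<N. real (c (edge j)) *\<^sub>R edge j)"
        using c linear_0[OF linear_prefix_sum] by simp
      also have "\<dots> = (\<Sum>j<N. real (c (edge j)) * prefix_sum \<sigma> i (edge j))"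
        by (simp add: linear_sum[OF linear_prefix_sum] linear_scale[OF linear_prefix_sum])
      also have "\<dots> = (\<Sum>j<N - 1. real (c (edge j)) * prefix_sum \<sigma> i (edge j)) - 1"
      proof -
        have "{..<N} = insert (N - 1) {..<N - 1}" using card_ge_2 by auto
        moreover have "c (edge (N - 1)) = 1" using c by blast
        ultimately show ?thesis by (simp add: prefix_sum_edge_last[OF True] del: One_nat_def)
      qed
      also have "(\<Sum>j<N - 1. real (c (edge j)) * prefix_sum \<sigma> i (edge j)) = (\<Sum>j<N - 1. if j = i then real (c (edge j)) else 0)"
        by (rule sum.cong) (use True in \<open>auto simp: prefix_sum_edge\<close>)
      also have "\<dots> = real (c (edge i))" using True by (simp add: sum.delta')
      finally show ?thesis by simp
    next
      case False
      then have "i = N - 1" using i by simp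
      then show ?thesis using c by simp
    qed
    then show "c = (\<lambda>\<alpha>. if \<alpha> \<in> edge ` {..<N} then 1 else 0)"
      using c by (auto simp: fun_eq_iff)
  qed
qed

end

section \<open>Solutions, cosets and compositions\<close>

text \<open>Lowering every unknown by 1 leaves nonnegative solutions, counted by stars and
  bars.\<close>

lemma card_positive_solutions:
  assumes "finite A" "A \<noteq> {}" "t \<ge> 1"
  shows "card {y \<in> A \<rightarrow>\<^sub>E {0<..}. (\<Sum>a\<in>A. y a) = (t :: nat)} = (t - 1) choose (card A - 1)"
proof -
  let ?Y = "{y \<in> A \<rightarrow>\<^sub>E {0<..}. (\<Sum>a\<in>A. y a) = t}" and ?m = "card A"
  have m: "?m \<ge> 1" using assms(1,2) by (simp add: Suc_le_eq card_gt_0_iff)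
  have ge: "(\<Sum>a\<in>A. y a) \<ge> ?m" if "y \<in> A \<rightarrow>\<^sub>E {0<..}" for y :: "'a \<Rightarrow> nat"
  proof -
    have "(\<Sum>a\<in>A. 1) \<le> (\<Sum>a\<in>A. y a)"
      using that by (intro sum_mono) (auto simp: PiE_def Pi_def Suc_le_eq)
    then show ?thesis by simp
  qed
  show ?thesis
  proof (cases "?m \<le> t")
    case False
    then have "?Y = {}" using ge by fastforce
    \<comment> \<open>Here t must be positive: with t = 0 and one unknown, truncated subtraction
      would give 0 choose 0 = 1.\<close>
    moreover have "t - 1 < ?m - 1" using False assms(3) by simp
    ultimately show ?thesis by (simp only: card.empty binomial_eq_0)
  next
    case True
    obtain as where as: "set as = A" "distinct as" using finite_distinct_list[OF assms(1)] by blast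
    have len: "length as = ?m" using as by (metis distinct_card)
    let ?L = "{l :: nat list. size l = ?m \<and> sum_list l = t - ?m}"
    have sumA: "(\<Sum>a\<in>A. f a) = sum_list (map f as)" for f :: "'a \<Rightarrow> nat"
      using as by (metis sum_list_distinct_conv_sum_set)
    have "bij_betw (\<lambda>y. map (\<lambda>a. y a - 1) as) ?Y ?L"
    proof (rule bij_betw_imageI)
      show "inj_on (\<lambda>y. map (\<lambda>a. y a - 1) as) ?Y"
      proof (rule inj_onI)
        fix y z assume yz: "y \<in> ?Y" "z \<in> ?Y" "map (\<lambda>a. y a - 1) as = map (\<lambda>a. z a - 1) as"
        have "y a = z a" for a
        proof (cases "a \<in> A")
          case True
          then have "y a - 1 = z a - 1" "y a > 0" "z a > 0"
            using yz as(1) by (auto simp: PiE_def Pi_def)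
          then show ?thesis by simp
        next
          case False
          then show ?thesis using yz by (auto simp: PiE_def extensional_def)
        qed
        then show "y = z" by (rule ext)
      qed
      show "(\<lambda>y. map (\<lambda>a. y a - 1) as) ` ?Y = ?L"
      proof (intro equalityI subsetI)
        fix l assume "l \<in> (\<lambda>y. map (\<lambda>a. y a - 1) as) ` ?Y"
        then obtain y where y: "l = map (\<lambda>a. y a - 1) as" "y \<in> A \<rightarrow>\<^sub>E {0<..}" "(\<Sum>a\<in>A. y a) = t" by blast
        have "(\<Sum>a\<in>A. y a) = (\<Sum>a\<in>A. (y a - 1) + 1)"
          using y(2) by (intro sum.cong) (auto simp: PiE_def Pi_def)
        then have "(\<Sum>a\<in>A. y a - 1) = t - ?m" using y(3) by (simp only: sum.distrib) simp
        then show "l \<in> ?L" using len by (simp add: y(1) sumA)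
      next
        fix l assume l: "l \<in> ?L"
        define y where "y a = (if a \<in> A then the (map_of (zip as l) a) + 1 else undefined)" for a
        have nth: "y (as ! i) = l ! i + 1" if "i < ?m" for i
          using that as l len by (auto simp: y_def map_of_zip_nth)
        have map: "map (\<lambda>a. y a - 1) as = l"
          using l len nth by (intro nth_equalityI) auto
        have yE: "y \<in> A \<rightarrow>\<^sub>E {0<..}" by (auto simp: y_def)
        have "(\<Sum>a\<in>A. y a) = (\<Sum>a\<in>A. (y a - 1) + 1)"
          using yE by (intro sum.cong) (auto simp: PiE_def Pi_def)
        also have "\<dots> = (\<Sum>a\<in>A. y a - 1) + ?m" by (simp only: sum.distrib) simp
        also have "(\<Sum>a\<in>A. y a - 1) = sum_list l" by (simp only: sumA map)
        finally have "(\<Sum>a\<in>A. y a) = t" using l True by simp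
        then show "l \<in> (\<lambda>y. map (\<lambda>a. y a - 1) as) ` ?Y" using yE map by (intro image_eqI[of _ _ y]) auto
      qed
    qed
    then have "card ?Y = card ?L" by (rule bij_betw_same_card)
    also have "\<dots> = (t - ?m + ?m - 1) choose (t - ?m)" by (rule card_length_sum_list)
    also have "\<dots> = (t - 1) choose (?m - 1)"
      using True m by (subst binomial_symmetric) auto
    finally show ?thesis .
  qed
qed

lemma coset_eq_iff_diff:
  fixes H :: "'a::ab_group_add set"
  assumes "0 \<in> H" "\<And>x y. x \<in> H \<Longrightarrow> y \<in> H \<Longrightarrow> x + y \<in> H" "\<And>x. x \<in> H \<Longrightarrow> - x \<in> H"
  shows "(\<lambda>h. h + a) ` H = (\<lambda>h. h + b) ` H \<longleftrightarrow> a - b \<in> H"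
proof
  assume eq: "(\<lambda>h. h + a) ` H = (\<lambda>h. h + b) ` H"
  have "a \<in> (\<lambda>h. h + a) ` H" using assms(1) by (intro image_eqI[of _ _ 0]) auto
  then show "a - b \<in> H" using eq by auto
next
  have sub: "(\<lambda>h. h + x) ` H \<subseteq> (\<lambda>h. h + y) ` H" if "x - y \<in> H" for x y
  proof
    fix z assume "z \<in> (\<lambda>h. h + x) ` H"
    then obtain h where "h \<in> H" "z = h + x" by blast
    then show "z \<in> (\<lambda>h. h + y) ` H"
      using assms(2)[OF _ that, of h] by (intro image_eqI[of _ _ "h + (x - y)"]) auto
  qed
  assume "a - b \<in> H"
  moreover have "b - a \<in> H" using assms(3)[OF \<open>a - b \<in> H\<close>] by simp
  ultimately show "(\<lambda>h. h + a) ` H = (\<lambda>h. h + b) ` H" using sub by blast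
qed

text \<open>Coordinates of a coweight differ by integers, so its class modulo the coroot lattice is
  fixed by one coordinate modulo 1. Because the coordinates sum to 0, n times that coordinate is an
  integer, and its residue mod n takes every value.\<close>

lemma lattice_index_A: "lattice_index (roots_A :: (real^'n) set) = CARD('n)"
proof -
  let ?N = "CARD('n)"
  define i0 :: 'n where "i0 = undefined"
  define P where "P = coweight_lattice (roots_A :: (real^'n) set)"
  define H where "H = coroot_lattice (roots_A :: (real^'n) set)"
  have P_iff: "v \<in> P \<longleftrightarrow> (\<Sum>i\<in>UNIV. v $ i) = 0 \<and> (\<forall>i j. v $ i - v $ j \<in> \<int>)" for v :: "real^'n"
  proof -
    have "(\<forall>\<alpha>\<in>(roots_A :: (real^'n) set). v \<bullet> \<alpha> \<in> \<int>) \<longleftrightarrow> (\<forall>i j. i \<noteq> j \<longrightarrow> v $ i - v $ j \<in> \<int>)"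
      unfolding roots_A_def by (auto simp: inner_axis_diff) (metis inner_axis_diff)
    also have "\<dots> \<longleftrightarrow> (\<forall>i j. v $ i - v $ j \<in> \<int>)" by (metis Ints_0 diff_self)
    finally show ?thesis by (simp add: P_def coweight_lattice_def span_roots_A)
  qed
  have H_iff: "v \<in> H \<longleftrightarrow> (\<forall>i. v $ i \<in> \<int>) \<and> (\<Sum>i\<in>UNIV. v $ i) = 0" for v :: "real^'n"
    by (simp add: H_def coroot_lattice_A)
  define g where "g v = \<lfloor>real ?N * v $ i0\<rfloor> mod int ?N" for v :: "real^'n"
  have int: "real ?N * v $ i0 \<in> \<int>" if "v \<in> P" for v
  proof -
    have "real ?N * v $ i0 = (\<Sum>j\<in>UNIV. v $ i0 - v $ j)"
      using that by (simp add: sum_subtractf P_iff)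
    also have "\<dots> \<in> \<int>" using that P_iff by (intro Ints_sum) blast
    finally show ?thesis .
  qed
  have ker: "(\<lambda>h. h + v) ` H = (\<lambda>h. h + w) ` H \<longleftrightarrow> g v = g w" if vw: "v \<in> P" "w \<in> P" for v w
  proof -
    obtain k l where kl: "real ?N * v $ i0 = of_int k" "real ?N * w $ i0 = of_int l"
      using int vw by (metis Ints_cases)
    have all: "(\<forall>i. (v - w) $ i \<in> \<int>) \<longleftrightarrow> (v - w) $ i0 \<in> \<int>"
    proof
      assume i0: "(v - w) $ i0 \<in> \<int>"
      show "\<forall>i. (v - w) $ i \<in> \<int>"
      proof
        fix i
        have a: "v $ i - v $ i0 \<in> \<int>" "w $ i - w $ i0 \<in> \<int>" using vw P_iff by blast+
        have "(v - w) $ i = (v - w) $ i0 + ((v $ i - v $ i0) - (w $ i - w $ i0))" by simp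
        also have "\<dots> \<in> \<int>" by (rule Ints_add[OF i0 Ints_diff[OF a]])
        finally show "(v - w) $ i \<in> \<int>" .
      qed
    qed blast
    have "(\<lambda>h. h + v) ` H = (\<lambda>h. h + w) ` H \<longleftrightarrow> v - w \<in> H"
      by (rule coset_eq_iff_diff) (auto simp: H_iff sum.distrib sum_negf)
    also have "\<dots> \<longleftrightarrow> (v - w) $ i0 \<in> \<int>"
      unfolding H_iff all using vw by (auto simp: P_iff sum_subtractf)
    also have "\<dots> \<longleftrightarrow> int ?N dvd k - l"
    proof
      assume "(v - w) $ i0 \<in> \<int>"
      then obtain z where "(v - w) $ i0 = of_int z" by (auto elim: Ints_cases)
      then have "real ?N * ((v - w) $ i0) = of_int (int ?N * z)" by simp
      then have "of_int (k - l) = (of_int (int ?N * z) :: real)"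
        using kl by (simp add: right_diff_distrib)
      then have "k - l = int ?N * z" by (simp only: of_int_eq_iff)
      then show "int ?N dvd k - l" by simp
    next
      assume "int ?N dvd k - l"
      then obtain z where z: "k - l = int ?N * z" by blast
      have "real ?N * ((v - w) $ i0) = of_int (k - l)"
        using kl by (simp add: right_diff_distrib)
      also have "\<dots> = real ?N * of_int z" by (simp add: z)
      finally have "(v - w) $ i0 = of_int z" by simp
      then show "(v - w) $ i0 \<in> \<int>" by simp
    qed
    also have "\<dots> \<longleftrightarrow> g v = g w" by (simp add: g_def kl mod_eq_dvd_iff)
    finally show ?thesis .
  qed
  have "rcosets\<^bsub>\<lparr>carrier = P, mult = (+), one = 0\<rparr>\<^esub> H = (\<lambda>v. (\<lambda>h. h + v) ` H) ` P"
    unfolding RCOSETS_def r_coset_def by auto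
  then have "lattice_index (roots_A :: (real^'n) set) = card ((\<lambda>v. (\<lambda>h. h + v) ` H) ` P)"
    by (simp add: lattice_index_def P_def H_def)
  also have "\<dots> = card (g ` P)"
    by (rule card_image_eq_of_same_kernel) (rule ker)
  also have "g ` P = {0..<int ?N}"
  proof (intro equalityI subsetI)
    fix x assume x: "x \<in> {0..<int ?N}"
    \<comment> \<open>All coordinates are x / n except at \<open>i0\<close>, where x is subtracted
      to make the sum 0; n times that coordinate is still x mod n.\<close>
    define v :: "real^'n" where "v = (\<chi> i. of_int x / real ?N - (if i = i0 then of_int x else 0))"
    have "v \<in> P" unfolding P_iff by (auto simp: v_def sum_subtractf)
    moreover have "real ?N * v $ i0 = of_int (x - int ?N * x)"
      by (simp add: v_def right_diff_distrib)
    then have "g v = (x - int ?N * x) mod int ?N" unfolding g_def by (simp only: floor_of_int)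
    then have "g v = x" using x by (simp add: mod_diff_right_eq[symmetric] mod_diff_eq[symmetric])
    ultimately show "x \<in> g ` P" by blast
  qed (auto simp: g_def)
  also have "card {0..<int ?N} = ?N" by simp
  finally show ?thesis .
qed

section \<open>Compositions of N as the subsets of {1..N} that contain N, via partial sums\<close>

fun cuts :: "nat list \<Rightarrow> nat set" where
  "cuts [] = {}"
| "cuts (x # xs) = insert x ((+) x ` cuts xs)"

lemma cuts_pos: "0 \<notin> set xs \<Longrightarrow> p \<in> cuts xs \<Longrightarrow> p > 0"
  by (induction xs arbitrary: p) auto

lemma finite_cuts [simp]: "finite (cuts xs)"
  by (induction xs) auto

lemma cuts_le: "p \<in> cuts xs \<Longrightarrow> p \<le> sum_list xs"
  by (induction xs arbitrary: p) auto

lemma sum_list_in_cuts: "xs \<noteq> [] \<Longrightarrow> sum_list xs \<in> cuts xs"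
proof (induction xs)
  case (Cons x xs)
  then show ?case by (cases "xs = []") auto
qed simp

lemma card_cuts: "0 \<notin> set xs \<Longrightarrow> card (cuts xs) = length xs"
proof (induction xs)
  case (Cons x xs)
  have "x \<notin> (+) x ` cuts xs" using cuts_pos[of xs 0] Cons.prems by auto
  then show ?case using Cons by (simp add: card_image)
qed simp

lemma cuts_inj: "0 \<notin> set xs \<Longrightarrow> 0 \<notin> set ys \<Longrightarrow> cuts xs = cuts ys \<Longrightarrow> xs = ys"
proof (induction xs arbitrary: ys)
  case Nil
  then show ?case by (cases ys) auto
next
  case (Cons x xs)
  then obtain y ys' where ys: "ys = y # ys'" by (cases ys) auto
  have min: "Min (cuts (z # zs)) = z" for z zs
    by (rule Min_eqI) auto
  have xy: "x = y" using min[of x xs] min[of y ys'] Cons.prems(3) by (simp add: ys del: cuts.simps)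
  have rest: "(+) z ` cuts zs = cuts (z # zs) - {z}" if "0 \<notin> set zs" for z zs
    using cuts_pos[OF that, of 0] by auto
  have "(+) x ` cuts xs = (+) x ` cuts ys'"
    using rest[of xs x] rest[of ys' x] Cons.prems by (simp add: ys xy del: cuts.simps)
  then have "cuts xs = cuts ys'" by (simp add: inj_image_eq_iff)
  then show ?case using Cons by (simp add: ys xy)
qed

text \<open>The least element is the first part; the others, shifted down by it, encode the
  remaining parts.\<close>

lemma cuts_surj:
  assumes "P \<subseteq> {1..N}" "N \<in> P"
  shows "\<exists>xs. 0 \<notin> set xs \<and> sum_list xs = N \<and> cuts xs = P"
  using assms
proof (induction N arbitrary: P rule: less_induct)
  case (less N)
  have fin: "finite P" using less.prems(1) finite_subset by blast
  define x where "x = Min P"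
  have x: "x \<in> P" "\<And>p. p \<in> P \<Longrightarrow> x \<le> p" 
    using Min_in[OF fin] Min_le[OF fin] less.prems(2) by (auto simp: x_def)
  have x1: "x \<ge> 1" "x \<le> N" using x(1) less.prems(1) by auto
  show ?case
  proof (cases "x = N")
    case True
    have "p = N" if "p \<in> P" for p
      using x(2)[OF that] subsetD[OF less.prems(1) that] True by simp
    then have "P = {N}" using less.prems(2) by blast
    then show ?thesis using x1 True by (intro exI[of _ "[N]"]) auto
  next
    case False
    let ?P = "(\<lambda>p. p - x) ` (P - {x})"
    have "?P \<subseteq> {1..N - x}"
    proof
      fix r assume "r \<in> ?P"
      then obtain p where "p \<in> P" "p \<noteq> x" "r = p - x" by auto
      then show "r \<in> {1..N - x}" using x(2)[of p] less.prems(1) by auto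
    qed
    moreover have "N - x \<in> ?P" using less.prems(2) False by auto
    moreover have "N - x < N" using x1 by simp
    ultimately obtain xs where xs: "0 \<notin> set xs" "sum_list xs = N - x" "cuts xs = ?P"
      using less.IH by blast
    have "(+) x ` ?P = (\<lambda>p. p) ` (P - {x})"
      unfolding image_image by (rule image_cong) (use x(2) in auto)
    then have "(+) x ` ?P = P - {x}" by simp
    then have "cuts (x # xs) = P" using xs(3) x(1) by auto
    then show ?thesis using xs x1 by (intro exI[of _ "x # xs"]) auto
  qed
qed

text \<open>Reads the diagram row by row, numbering its cells from 0.\<close>

definition cell_pos :: "nat list \<Rightarrow> nat \<times> nat \<Rightarrow> nat" where
  "cell_pos xs = (\<lambda>(j, k). sum_list (take j xs) + k)"

lemma cells_Cons: "cells (x # xs) = {0} \<times> {..<x} \<union> map_prod Suc id ` cells xs"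
proof (intro equalityI subsetI)
  fix c assume "c \<in> cells (x # xs)"
  then show "c \<in> {0} \<times> {..<x} \<union> map_prod Suc id ` cells xs"
    by (cases "fst c") (auto simp: cells_def image_iff)
qed (auto simp: cells_def)

lemma cell_pos_Cons: "cell_pos (x # xs) (0, k) = k" "cell_pos (x # xs) (Suc j, k) = x + cell_pos xs (j, k)"
  by (simp_all add: cell_pos_def)

lemma bij_betw_cell_pos: "bij_betw (cell_pos xs) (cells xs) {..<sum_list xs}"
proof (induction xs)
  case Nil
  then show ?case by (simp add: cells_def bij_betw_def)
next
  case (Cons x xs)
  have img: "cell_pos xs ` cells xs = {..<sum_list xs}" and inj: "inj_on (cell_pos xs) (cells xs)"
    using Cons by (auto simp: bij_betw_def)
  show ?case
  proof (rule bij_betw_imageI)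
    show "inj_on (cell_pos (x # xs)) (cells (x # xs))"
    proof (rule inj_onI)
      fix a b assume ab: "a \<in> cells (x # xs)" "b \<in> cells (x # xs)" and eq: "cell_pos (x # xs) a = cell_pos (x # xs) b"
      have split: "(\<exists>k<x. c = (0, k)) \<or> (\<exists>j k. c = (Suc j, k) \<and> (j, k) \<in> cells xs)"
        if "c \<in> cells (x # xs)" for c
        using that unfolding cells_Cons by auto
      show "a = b"
        using split[OF ab(1)] split[OF ab(2)] eq inj_onD[OF inj] by (elim disjE exE conjE) (auto simp: cell_pos_Cons)
    qed
    have "cell_pos (x # xs) ` ({0} \<times> {..<x}) = {..<x}"
      by (auto simp: cell_pos_Cons image_iff)
    moreover have "cell_pos (x # xs) ` map_prod Suc id ` cells xs = (+) x ` cell_pos xs ` cells xs"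
      unfolding image_image by (rule image_cong) (auto simp: cell_pos_Cons)
    moreover have "(+) x ` {..<sum_list xs} = {x..<x + sum_list xs}"
      by (simp add: lessThan_atLeast0 add.commute)
    ultimately have "cell_pos (x # xs) ` cells (x # xs) = {..<x} \<union> {x..<x + sum_list xs}"
      by (simp add: cells_Cons image_Un img)
    then show "cell_pos (x # xs) ` cells (x # xs) = {..<sum_list (x # xs)}" by auto
  qed
qed

text \<open>Positions count from 0 and cuts are partial sums, so a cut at \<open>Suc i\<close> lies
  just after position i: that cell ends its row and no path edge leaves it.\<close>

lemma Suc_cell_pos_in_cuts_iff:
  assumes "0 \<notin> set xs" "(j, k) \<in> cells xs"
  shows "Suc (cell_pos xs (j, k)) \<in> cuts xs \<longleftrightarrow> (j, Suc k) \<notin> cells xs"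
  using assms
proof (induction xs arbitrary: j)
  case Nil
  then show ?case by (simp add: cells_def)
next
  case (Cons x xs)
  show ?case
  proof (cases j)
    case 0
    have k: "k < x" using Cons.prems(2) 0 by (simp add: cells_def)
    have "Suc k \<notin> (+) x ` cuts xs"
    proof
      assume "Suc k \<in> (+) x ` cuts xs"
      then obtain r where "r \<in> cuts xs" "Suc k = x + r" by blast
      then show False using k cuts_pos[of xs r] Cons.prems(1) by simp
    qed
    then have "Suc k \<in> cuts (x # xs) \<longleftrightarrow> Suc k = x" by simp
    moreover have "(0, Suc k) \<in> cells (x # xs) \<longleftrightarrow> Suc k < x" by (simp add: cells_def)
    ultimately show ?thesis using k by (simp add: 0 cell_pos_Cons del: cuts.simps) linarith
  next
    case (Suc i)
    have "(i, k) \<in> cells xs" using Cons.prems(2) Suc by (auto simp: cells_def)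
    then have "Suc (cell_pos xs (i, k)) \<in> cuts xs \<longleftrightarrow> (i, Suc k) \<notin> cells xs"
      using Cons.IH[of i] Cons.prems(1) by simp
    moreover have "(i, Suc k) \<in> cells xs \<longleftrightarrow> (j, Suc k) \<in> cells (x # xs)"
      using Suc by (auto simp: cells_def)
    moreover have "Suc (cell_pos (x # xs) (j, k)) \<in> cuts (x # xs) \<longleftrightarrow> Suc (cell_pos xs (i, k)) \<in> cuts xs"
    proof -
      have "Suc (x + r) \<in> cuts (x # xs) \<longleftrightarrow> Suc r \<in> cuts xs" for r
        by (auto simp flip: add_Suc_right)
      then show ?thesis by (simp only: Suc cell_pos_Cons)
    qed
    ultimately show ?thesis by simp
  qed
qed

section \<open>Subsets of the extended simple system\<close>

context ordered_simple_system
begin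

lemma N_pos: "N > 0"
  using card_ge_2 by simp

text \<open>Numbers the cycle starting just after edge c, so that edge c leaves the last position N
  - 1.\<close>

definition rot :: "nat \<Rightarrow> nat \<Rightarrow> nat" where
  "rot c i = (Suc c + i) mod N"

lemma rot_last: "c < N \<Longrightarrow> rot c (N - 1) = c"
  using N_pos by (simp add: rot_def)

lemma Suc_rot_mod: "Suc (rot c i) mod N = rot c (Suc i)"
  by (simp add: rot_def mod_Suc_eq)

lemma bij_betw_rot:
  assumes "c < N"
  shows "bij_betw (rot c) {..<N} {..<N}"
proof -
  have r: "rot c i = (if Suc c + i < N then Suc c + i else Suc c + i - N)" if "i < N" for i
    using that assms by (auto simp: rot_def mod_if)
  have "inj_on (rot c) {..<N}"
    by (rule inj_onI) (use assms in \<open>auto simp: r split: if_splits\<close>)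
  moreover have "rot c ` {..<N} \<subseteq> {..<N}" using N_pos by (auto simp: rot_def)
  ultimately show ?thesis by (simp add: bij_betw_def endo_inj_surj)
qed

lemma inj_edge_rot: "c < N \<Longrightarrow> inj_on (edge \<circ> rot c) {..<N}"
  using bij_betw_rot[of c] inj_edge by (auto simp: bij_betw_def intro!: comp_inj_on)

lemma edge_rot_image: "c < N \<Longrightarrow> (edge \<circ> rot c) ` {..<N} = edge ` {..<N}"
  by (simp only: image_comp[symmetric] bij_betw_imp_surj_on[OF bij_betw_rot])

text \<open>Opens the cycle at edge c and deletes the edges at the cuts. The total N is always a
  cut, so edge c is deleted too and the subset is proper.\<close>

definition arc :: "nat \<Rightarrow> nat list \<Rightarrow> (real^'n) set" where
  "arc c xs = (edge \<circ> rot c) ` {i. i < N \<and> Suc i \<notin> cuts xs}"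

text \<open>Rotation turns successor mod N into successor, so the edge at position i runs from the
  i-th to the next vertex. Between cuts these edges form the directed paths of the rows.\<close>

lemma presents_arc:
  assumes "c < N" "0 \<notin> set xs" "sum_list xs = N"
  shows "presents (\<sigma> \<circ> rot c \<circ> cell_pos xs) xs (arc c xs)"
proof -
  let ?E = "{(j, k). (j, Suc k) \<in> cells xs}"
  have bp: "bij_betw (cell_pos xs) (cells xs) {..<N}" using bij_betw_cell_pos[of xs] assms(3) by simp
  have "bij_betw (\<sigma> \<circ> rot c \<circ> cell_pos xs) (cells xs) UNIV"
    using bij_betw_trans[OF bp bij_betw_trans[OF bij_betw_rot[OF assms(1)] bij_\<sigma>]] by simp
  moreover have "{i. i < N \<and> Suc i \<notin> cuts xs} = cell_pos xs ` ?E"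
  proof (intro equalityI subsetI)
    fix i assume i: "i \<in> {i. i < N \<and> Suc i \<notin> cuts xs}"
    then have "i \<in> cell_pos xs ` cells xs" using bp by (simp add: bij_betw_def)
    then obtain j k where jk: "(j, k) \<in> cells xs" "i = cell_pos xs (j, k)" by auto
    then have "(j, Suc k) \<in> cells xs" using Suc_cell_pos_in_cuts_iff[OF assms(2) jk(1)] i by simp
    then show "i \<in> cell_pos xs ` ?E" using jk(2) by blast
  next
    fix i assume "i \<in> cell_pos xs ` ?E"
    then obtain j k where jk: "(j, Suc k) \<in> cells xs" "i = cell_pos xs (j, k)" by auto
    then have "(j, k) \<in> cells xs" by (auto simp: cells_def)
    then show "i \<in> {i. i < N \<and> Suc i \<notin> cuts xs}"
      using bp jk Suc_cell_pos_in_cuts_iff[OF assms(2), of j k] by (auto simp: bij_betw_def)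
  qed
  then have "arc c xs = (edge \<circ> rot c \<circ> cell_pos xs) ` ?E" by (simp add: arc_def image_comp)
  moreover have "(edge \<circ> rot c \<circ> cell_pos xs) ` ?E =
    (\<lambda>(j, k). axis ((\<sigma> \<circ> rot c \<circ> cell_pos xs) (j, k)) 1 - axis ((\<sigma> \<circ> rot c \<circ> cell_pos xs) (j, Suc k)) 1) ` ?E"
    by (rule image_cong) (auto simp: edge_def Suc_rot_mod cell_pos_def)
  ultimately show ?thesis using assms(2) by (simp only: presents_def) simp
qed

lemma block_type_arc:
  assumes "c < N" "0 \<notin> set xs" "sum_list xs = N"
  shows "block_type (conn (arc c xs)) = mset xs"
  by (rule presents_block_type[OF presents_arc[OF assms]])

lemma edge_notin_arc:
  assumes "c < N" "sum_list xs = N"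
  shows "edge c \<notin> arc c xs"
proof
  assume "edge c \<in> arc c xs"
  then obtain i where i: "i < N" "Suc i \<notin> cuts xs" "edge c = (edge \<circ> rot c) i" by (auto simp: arc_def)
  have "(edge \<circ> rot c) (N - 1) = (edge \<circ> rot c) i" using i(3) rot_last[OF assms(1)] by simp
  then have "N - 1 = i"
    by (rule inj_onD[OF inj_edge_rot[OF assms(1)]]) (use i(1) N_pos in auto)
  moreover have "xs \<noteq> []" using assms(2) N_pos by auto
  then have "N \<in> cuts xs" using sum_list_in_cuts[of xs] assms(2) by simp
  ultimately show False using i(2) N_pos by auto
qed

lemma arc_psubset:
  assumes "c < N" "sum_list xs = N"
  shows "arc c xs \<subset> extended_simple roots_A \<Delta>"
proof -
  have "arc c xs \<subseteq> edge ` {..<N}"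
    unfolding edge_rot_image[OF assms(1), symmetric] arc_def by (rule image_mono) auto
  moreover have "edge c \<in> edge ` {..<N}" using assms(1) by simp
  ultimately show ?thesis unfolding extended_simple_A using edge_notin_arc[OF assms] by blast
qed

lemma arc_surj:
  assumes "S \<subset> extended_simple roots_A \<Delta>" "c < N" "edge c \<notin> S"
  obtains xs where "0 \<notin> set xs" "sum_list xs = N" "arc c xs = S"
proof -
  let ?f = "edge \<circ> rot c"
  \<comment> \<open>One cut after each omitted edge. The omitted edge c sits at position N - 1,
    which supplies the required cut N.\<close>
  define P where "P = Suc ` {i. i < N \<and> ?f i \<notin> S}"
  have "P \<subseteq> {1..N}" by (auto simp: P_def)
  moreover have "N \<in> P"
    unfolding P_def using assms(2,3) N_pos rot_last[OF assms(2)] by (intro image_eqI[of _ _ "N - 1"]) auto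
  ultimately obtain xs where xs: "0 \<notin> set xs" "sum_list xs = N" "cuts xs = P"
    using cuts_surj by blast
  have "{i. i < N \<and> Suc i \<notin> cuts xs} = {i. i < N \<and> ?f i \<in> S}"
    unfolding xs(3) P_def by auto
  then have "arc c xs = ?f ` {i. i < N \<and> ?f i \<in> S}" by (simp add: arc_def)
  also have "\<dots> = S"
    using assms(1) unfolding extended_simple_A edge_rot_image[OF assms(2), symmetric] by auto
  finally show ?thesis using that xs by blast
qed

lemma cuts_eq_Suc_image:
  assumes "0 \<notin> set xs" "sum_list xs = N"
  shows "cuts xs = Suc ` {i. i < N \<and> Suc i \<in> cuts xs}"
proof (intro equalityI subsetI)
  fix p assume p: "p \<in> cuts xs"
  then have "p > 0" "p \<le> N" using cuts_pos[OF assms(1) p] cuts_le[OF p] assms(2) by auto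
  then obtain i where "p = Suc i" "i < N" by (cases p) auto
  then show "p \<in> Suc ` {i. i < N \<and> Suc i \<in> cuts xs}" using p by blast
qed auto

lemma arc_inj:
  assumes "c < N" "0 \<notin> set xs" "sum_list xs = N" "0 \<notin> set ys" "sum_list ys = N" "arc c xs = arc c ys"
  shows "xs = ys"
proof -
  have "{i. i < N \<and> Suc i \<notin> cuts xs} = {i. i < N \<and> Suc i \<notin> cuts ys}"
    using assms(6) unfolding arc_def
    by (subst (asm) inj_on_image_eq_iff[OF inj_edge_rot[OF assms(1)]]) auto
  then have "Suc i \<in> cuts xs \<longleftrightarrow> Suc i \<in> cuts ys" if "i < N" for i
    using that by blast
  then have "{i. i < N \<and> Suc i \<in> cuts xs} = {i. i < N \<and> Suc i \<in> cuts ys}" by blast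
  then have "cuts xs = cuts ys"
    using cuts_eq_Suc_image[OF assms(2,3)] cuts_eq_Suc_image[OF assms(4,5)] by metis
  then show ?thesis by (rule cuts_inj[OF assms(2,4)])
qed

lemma card_complement_arc:
  assumes "c < N" "0 \<notin> set xs" "sum_list xs = N"
  shows "card (edge ` {..<N} - arc c xs) = length xs"
proof -
  let ?f = "edge \<circ> rot c" and ?K = "{i. i < N \<and> Suc i \<in> cuts xs}"
  have "edge ` {..<N} - arc c xs = ?f ` ({..<N} - {i. i < N \<and> Suc i \<notin> cuts xs})"
    unfolding edge_rot_image[OF assms(1), symmetric] arc_def
    by (rule inj_on_image_set_diff[OF inj_edge_rot[OF assms(1)], symmetric]) auto
  also have "{..<N} - {i. i < N \<and> Suc i \<notin> cuts xs} = ?K" by auto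
  finally have "card (edge ` {..<N} - arc c xs) = card (?f ` ?K)" by simp
  also have "\<dots> = card ?K"
    by (rule card_image, rule inj_on_subset[OF inj_edge_rot[OF assms(1)]]) auto
  also have "\<dots> = card (cuts xs)"
    by (subst cuts_eq_Suc_image[OF assms(2,3)]) (simp add: card_image)
  finally show ?thesis using card_cuts[OF assms(2)] by simp
qed

lemma exists_arc:
  assumes "S \<subset> extended_simple roots_A \<Delta>"
  obtains c xs where "c < N" "0 \<notin> set xs" "sum_list xs = N" "S = arc c xs"
proof -
  obtain c where "c < N" "edge c \<notin> S" using assms unfolding extended_simple_A by blast
  then show ?thesis using arc_surj[OF assms] that by metis
qed

lemma block_type_subset:
  assumes "S \<subset> extended_simple roots_A \<Delta>"
  shows "card (edge ` {..<N} - S) = size (block_type (conn S))"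
    and "0 \<notin># block_type (conn S)" and "sum_mset (block_type (conn S)) = N"
proof -
  obtain c xs where "c < N" "0 \<notin> set xs" "sum_list xs = N" "S = arc c xs"
    using exists_arc[OF assms] by blast
  then show "card (edge ` {..<N} - S) = size (block_type (conn S))"
    "0 \<notin># block_type (conn S)" "sum_mset (block_type (conn S)) = N"
    using card_complement_arc[of c xs] block_type_arc[of c xs] by (simp_all add: sum_mset_sum_list)
qed

text \<open>Neither the place of cutting nor the order of the parts matters: two arcs with the same
  parts present isomorphic families of directed paths.\<close>

lemma weyl_equiv_iff_block_type:
  assumes "S \<subset> extended_simple roots_A \<Delta>" "J \<subset> extended_simple roots_A \<Delta>"
  shows "weyl_equiv (roots_A :: (real^'n) set) S J \<longleftrightarrow> block_type (conn S) = block_type (conn J)"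
proof
  assume eq: "block_type (conn S) = block_type (conn J)"
  obtain c xs where S: "c < N" "0 \<notin> set xs" "sum_list xs = N" "S = arc c xs"
    using exists_arc[OF assms(1)] by blast
  obtain b ys where J: "b < N" "0 \<notin> set ys" "sum_list ys = N" "J = arc b ys"
    using exists_arc[OF assms(2)] by blast
  have "mset xs = mset ys"
    using eq block_type_arc[OF S(1-3)] block_type_arc[OF J(1-3)] by (simp add: S(4) J(4))
  then show "weyl_equiv (roots_A :: (real^'n) set) S J"
    unfolding S(4) J(4) by (rule presents_weyl_equiv[OF presents_arc[OF S(1-3)] presents_arc[OF J(1-3)]])
qed (rule block_type_conn_weyl_equiv)

text \<open>Double counting of the pairs \<open>(S, c)\<close> with \<open>S \<sim> J\<close> and \<open>edge c \<notin> S\<close>: cutting the cycle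
  at \<open>c\<close> turns \<open>S\<close> into a composition of \<open>N\<close>.\<close>

lemma card_weyl_class:
  assumes J: "J \<subset> extended_simple roots_A \<Delta>"
  defines "M \<equiv> block_type (conn J)"
  shows "card {S. S \<subset> extended_simple roots_A \<Delta> \<and> weyl_equiv roots_A S J} * size M =
    N * card (permutations_of_multiset M)"
proof -
  define \<S> where "\<S> = {S. S \<subset> extended_simple roots_A \<Delta> \<and> weyl_equiv roots_A S J}"
  have S_iff: "S \<in> \<S> \<longleftrightarrow> S \<subset> extended_simple roots_A \<Delta> \<and> block_type (conn S) = M" for S
    unfolding \<S>_def M_def using weyl_equiv_iff_block_type[OF _ J] by blast
  have fin: "finite \<S>"
    by (rule finite_subset[of _ "Pow (edge ` {..<N})"]) (auto simp: \<S>_def extended_simple_A)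
  \<comment> \<open>Deleting edges from a cycle leaves as many paths as edges deleted, provided at
    least one is deleted.\<close>
  have row: "card {c. c < N \<and> edge c \<notin> S} = size M" if "S \<in> \<S>" for S
  proof -
    have S: "S \<subset> extended_simple roots_A \<Delta>" "block_type (conn S) = M" using that S_iff by auto
    have "edge ` {..<N} - S = edge ` {c. c < N \<and> edge c \<notin> S}" by auto
    moreover have "inj_on edge {c. c < N \<and> edge c \<notin> S}" by (rule inj_on_subset[OF inj_edge]) auto
    ultimately show ?thesis using block_type_subset(1)[OF S(1)] S(2) by (simp add: card_image)
  qed
  have M: "0 \<notin># M" "sum_mset M = N" using block_type_subset[OF J] by (simp_all add: M_def)
  \<comment> \<open>For a fixed omitted edge c, subsets correspond to compositions, and the type
    condition says that the composition arranges \<open>M\<close>.\<close>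
  have col: "card {S \<in> \<S>. edge c \<notin> S} = card (permutations_of_multiset M)" if c: "c < N" for c
  proof (rule bij_betw_same_card[symmetric], rule bij_betw_imageI)
    have xs: "0 \<notin> set xs \<and> sum_list xs = N" if "xs \<in> permutations_of_multiset M" for xs
    proof -
      have "mset xs = M" using that by (simp add: permutations_of_multiset_def)
      then show ?thesis using M by (metis set_mset_mset sum_mset_sum_list)
    qed
    show "inj_on (arc c) (permutations_of_multiset M)"
      by (rule inj_onI) (metis arc_inj c xs)
    show "arc c ` permutations_of_multiset M = {S \<in> \<S>. edge c \<notin> S}"
    proof (intro equalityI subsetI)
      fix S assume "S \<in> arc c ` permutations_of_multiset M"
      then obtain xs where "xs \<in> permutations_of_multiset M" "S = arc c xs" by blast
      then show "S \<in> {S \<in> \<S>. edge c \<notin> S}"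
        using xs[of xs] arc_psubset[OF c, of xs] edge_notin_arc[OF c, of xs] block_type_arc[OF c, of xs]
        by (simp add: S_iff permutations_of_multiset_def)
    next
      fix S assume "S \<in> {S \<in> \<S>. edge c \<notin> S}"
      then have S: "S \<subset> extended_simple roots_A \<Delta>" "block_type (conn S) = M" "edge c \<notin> S"
        by (auto simp: S_iff)
      obtain xs where x: "0 \<notin> set xs" "sum_list xs = N" "arc c xs = S"
        using arc_surj[OF S(1) c S(3)] by blast
      have "mset xs = M" using block_type_arc[OF c x(1,2)] S(2) x(3) by simp
      then show "S \<in> arc c ` permutations_of_multiset M"
        using x(3) by (auto simp: permutations_of_multiset_def)
    qed
  qed
  have "card \<S> * size M = (\<Sum>S\<in>\<S>. card {c. c < N \<and> edge c \<notin> S})"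
    by (simp add: row)
  also have "\<dots> = (\<Sum>S\<in>\<S>. \<Sum>c<N. if edge c \<notin> S then 1 else 0)"
  proof (rule sum.cong[OF refl])
    fix S
    have "{c. c < N \<and> edge c \<notin> S} = {..<N} \<inter> {c. edge c \<notin> S}" by auto
    then show "card {c. c < N \<and> edge c \<notin> S} = (\<Sum>c<N. if edge c \<notin> S then 1 else 0)"
      by (simp add: sum.If_cases)
  qed
  also have "\<dots> = (\<Sum>c<N. \<Sum>S\<in>\<S>. if edge c \<notin> S then 1 else 0)" by (rule sum.swap)
  also have "\<dots> = (\<Sum>c<N. card {S \<in> \<S>. edge c \<notin> S})"
  proof (rule sum.cong[OF refl])
    fix c
    have "{S \<in> \<S>. edge c \<notin> S} = \<S> \<inter> {S. edge c \<notin> S}" by auto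
    then show "(\<Sum>S\<in>\<S>. if edge c \<notin> S then 1 else 0) = card {S \<in> \<S>. edge c \<notin> S}"
      using fin by (simp add: sum.If_cases)
  qed
  also have "\<dots> = N * card (permutations_of_multiset M)" by (simp add: col)
  finally show ?thesis unfolding \<S>_def .
qed

lemma num_solutions_A:
  assumes "S \<subset> extended_simple roots_A \<Delta>" "t \<ge> 1"
  shows "num_solutions roots_A \<Delta> S t = (t - 1) choose (size (block_type (conn S)) - 1)"
proof -
  let ?A = "edge ` {..<N} - S"
  have "(\<Sum>\<alpha>\<in>?A. (if \<alpha> \<in> edge ` {..<N} then 1 else 0) * y \<alpha>) = (\<Sum>\<alpha>\<in>?A. y \<alpha>)"
    for y :: "real^'n \<Rightarrow> nat"
    by (rule sum.cong) auto
  then have "num_solutions roots_A \<Delta> S t = card {y \<in> ?A \<rightarrow>\<^sub>E {0<..}. (\<Sum>\<alpha>\<in>?A. y \<alpha>) = t}"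
    unfolding num_solutions_def extended_simple_A marks_A by (simp only:)
  also have "\<dots> = (t - 1) choose (card ?A - 1)"
    by (rule card_positive_solutions) (use assms in \<open>auto simp: extended_simple_A\<close>)
  finally show ?thesis by (simp only: block_type_subset(1)[OF assms(1)])
qed

end

section \<open>Comparison of the two counts\<close>

lemma fact_mult_choose_eq_prod:
  assumes "q \<ge> 1"
  shows "fact m * real ((q - 1) choose m) = (\<Prod>k=1..m. real q - real k)"
proof -
  have "real ((q - 1) choose m) = (real q - 1) gchoose m"
    using assms by (simp add: binomial_gbinomial of_nat_diff)
  also have "\<dots> = (\<Prod>i=0..<m. real q - 1 - real i) / fact m"
    by (rule gbinomial_prod_rev)
  also have "(\<Prod>i=0..<m. real q - 1 - real i) = (\<Prod>k=1..m. real q - real k)"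
    by (rule prod.reindex_bij_witness[of _ "\<lambda>k. k - 1" Suc]) (auto simp: of_nat_diff)
  finally show ?thesis by simp
qed

text \<open>All members of the class contribute the same binomial coefficient. With m parts, the
  double count gives N * (m - 1)! / (r_1!...r_n!) members; the index cancels N, and (m - 1)! times
  the binomial is the product.\<close>

lemma (in ordered_simple_system) sum_num_solutions:
  assumes J: "J \<subset> extended_simple roots_A \<Delta>" and "t \<ge> 1"
  defines "M \<equiv> block_type (conn J)"
  shows "(\<Sum>S | S \<subset> extended_simple roots_A \<Delta> \<and> weyl_equiv roots_A S J. real (num_solutions roots_A \<Delta> S t))
      / real (lattice_index (roots_A :: (real^'n) set)) =
    (\<Prod>k=1..size M - 1. real t - real k) / (\<Prod>x\<in>set_mset M. fact (count M x))"
proof -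
  define \<S> where "\<S> = {S. S \<subset> extended_simple roots_A \<Delta> \<and> weyl_equiv roots_A S J}"
  let ?P = "\<Prod>x\<in>set_mset M. fact (count M x) :: real" and ?m = "size M"
  have "(\<Sum>S\<in>\<S>. real (num_solutions roots_A \<Delta> S t)) = (\<Sum>S\<in>\<S>. real ((t - 1) choose (?m - 1)))"
  proof (rule sum.cong[OF refl])
    fix S assume "S \<in> \<S>"
    then have "S \<subset> extended_simple roots_A \<Delta>" "block_type (conn S) = M"
      by (auto simp: \<S>_def M_def dest: block_type_conn_weyl_equiv)
    then show "real (num_solutions roots_A \<Delta> S t) = real ((t - 1) choose (?m - 1))"
      using num_solutions_A[OF _ assms(2)] by simp
  qed
  then have sum: "(\<Sum>S\<in>\<S>. real (num_solutions roots_A \<Delta> S t)) = real (card \<S>) * real ((t - 1) choose (?m - 1))"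
    by simp
  have "M \<noteq> {#}" using block_type_subset(3)[OF J] N_pos by (auto simp: M_def)
  then have m: "?m > 0" by (simp add: nonempty_has_size)
  have "card \<S> * ?m = N * card (permutations_of_multiset M)"
    unfolding \<S>_def M_def by (rule card_weyl_class[OF J])
  then have "real (card \<S>) * real ?m = real N * (fact ?m / ?P)"
    by (simp only: real_card_permutations_of_multiset[symmetric] of_nat_mult[symmetric])
  also have "fact ?m = real ?m * fact (?m - 1)" using m by (simp add: fact_reduce)
  finally have "real (card \<S>) = real N * fact (?m - 1) / ?P" using m \<open>M \<noteq> {#}\<close> by (simp add: field_simps)
  then have "(\<Sum>S\<in>\<S>. real (num_solutions roots_A \<Delta> S t)) / real N =
      fact (?m - 1) * real ((t - 1) choose (?m - 1)) / ?P"
    using N_pos by (simp add: sum)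
  then show ?thesis
    unfolding fact_mult_choose_eq_prod[OF assms(2)] by (simp add: \<S>_def lattice_index_A N_eq)
qed

context finite_subfield
begin

lemma card_orbits_of_genus_id:
  "card (orbits_of_genus_id q J :: ('k^'n^'n) set set) =
    card {X. set_mset X \<subseteq> F \<and> sum_mset X = 0 \<and> mult_type X = block_type (conn J)}"
proof -
  let ?D = "{d :: 'n \<Rightarrow> 'k. range d \<subseteq> F \<and> (\<Sum>a\<in>UNIV. d a) = 0 \<and> (\<forall>a b. d a = d b \<longleftrightarrow> (a, b) \<in> conn J)}"
  have "card (orbits_of_genus_id q J :: ('k^'n^'n) set set) = card (entries ` ?D)"
    unfolding orbits_of_genus_id_eq
    by (rule card_image_eq_of_same_kernel) (rule orbit_diag_eq_iff)
  also have "entries ` ?D = {X. set_mset X \<subseteq> F \<and> sum_mset X = 0 \<and> mult_type X = block_type (conn J)}"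
  proof (intro equalityI subsetI)
    fix X assume "X \<in> entries ` ?D"
    then obtain d where "d \<in> ?D" "X = entries d" by blast
    then show "X \<in> {X. set_mset X \<subseteq> F \<and> sum_mset X = 0 \<and> mult_type X = block_type (conn J)}"
      using mult_type_entries[of d "conn J"] by (simp add: sum_unfold_sum_mset)
  next
    fix X assume X: "X \<in> {X. set_mset X \<subseteq> F \<and> sum_mset X = 0 \<and> mult_type X = block_type (conn J)}"
    then obtain d where d: "entries d = X" "\<forall>a b. d a = d b \<longleftrightarrow> (a, b) \<in> conn J"
      using exists_entries_of_block_type[OF equiv_conn] by blast
    have "range d = set_mset X" "(\<Sum>a\<in>UNIV. d a) = sum_mset X"
      by (simp_all add: sum_unfold_sum_mset flip: d(1))
    then have "d \<in> ?D" using X d(2) by simp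
    then show "X \<in> entries ` ?D" using d(1) by blast
  qed
  finally show ?thesis .
qed

lemma real_card_orbits_of_genus_id:
  assumes "0 \<notin># block_type (conn J)" "of_nat (sum_mset (block_type (conn J))) \<noteq> (0 :: 'k)"
  shows "real (card (orbits_of_genus_id q J :: ('k^'n^'n) set set)) =
    (\<Prod>k=1..size (block_type (conn J)) - 1. real q - real k) /
    (\<Prod>x\<in>set_mset (block_type (conn J)). fact (count (block_type (conn J)) x))"
  unfolding card_orbits_of_genus_id
  by (rule real_card_mult_type_sum_0[OF assms(1) _ assms(2)]) (use assms(2) in auto)

text \<open>The genus condition inspects only multiplicities from 1 to n. Equality of whole
  multisets follows because a spectrum of n entries has no multiplicity 0 and none above n.\<close>

lemma has_genus_partition_iff:
  fixes d :: "'n::finite \<Rightarrow> 'k"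
  assumes "range d \<subseteq> F" "charpoly x = charpoly (diag d :: 'k^'n^'n)"
    and M: "\<And>i. count M i = (if i \<in> {1..CARD('n)} then r i else 0)"
  shows "has_genus_partition q r (x :: 'k^'n^'n) \<longleftrightarrow> mult_type (entries d) = M"
proof -
  let ?X = "entries d"
  have X: "set_mset ?X \<subseteq> F" using assms(1) by simp
  \<comment> \<open>Positive i is essential, since every non-eigenvalue has order 0. Eigenvalues lie
    in \<open>F\<close>, so restricting to \<open>F\<close> loses none.\<close>
  have c: "card {a. a ^ q = a \<and> Polynomial.order a (charpoly x) = i} = count (mult_type ?X) i" if "i > 0" for i
  proof -
    have "{a. a ^ q = a \<and> Polynomial.order a (charpoly x) = i} = {a \<in> set_mset ?X. count ?X a = i}"
    proof (rule Set.set_eqI)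
      fix a
      have "a \<in># ?X" if "count ?X a = i" using that \<open>i > 0\<close> by (metis count_greater_zero_iff)
      then show "a \<in> {a. a ^ q = a \<and> Polynomial.order a (charpoly x) = i} \<longleftrightarrow> a \<in> {a \<in> set_mset ?X. count ?X a = i}"
        using X unfolding assms(2) order_charpoly_diag F_iff[symmetric] by blast
    qed
    moreover have "count (mult_type ?X) i = card {a \<in> set_mset ?X. count ?X a = i}"
      unfolding mult_type_def by (simp add: count_image_mset vimage_def Int_def conj_commute)
    ultimately show ?thesis by simp
  qed
  have zero: "count (mult_type ?X) 0 = 0" using zero_notin_mult_type[of ?X] by (simp add: not_in_iff)
  have big: "count (mult_type ?X) i = 0" if "i > CARD('n)" for i
  proof -
    have "count ?X a \<le> CARD('n)" for a
      using count_le_size[of ?X a] by simp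
    then have "i \<noteq> count ?X a" for a using that by (metis not_le)
    then show ?thesis by (auto simp: mult_type_def count_eq_zero_iff)
  qed
  have "has_genus_partition q r x \<longleftrightarrow> (\<forall>i\<in>{1..CARD('n)}. count (mult_type ?X) i = r i)"
    unfolding has_genus_partition_def using c by simp
  also have "\<dots> \<longleftrightarrow> (\<forall>i. count (mult_type ?X) i = count M i)"
  proof
    assume *: "\<forall>i\<in>{1..CARD('n)}. count (mult_type ?X) i = r i"
    show "\<forall>i. count (mult_type ?X) i = count M i"
    proof
      fix i show "count (mult_type ?X) i = count M i"
      proof (cases "i \<in> {1..CARD('n)}")
        case False
        then have "i = 0 \<or> i > CARD('n)" by auto
        then show ?thesis using False zero big[of i] M by auto
      qed (use * M in simp)
    qed
  qed (simp add: M)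
  finally show ?thesis by (simp add: multiset_eq_iff)
qed

end

theorem theorem3:
  fixes \<Delta> :: "(real^'n) set"
    and p q e :: nat
  assumes "CARD('n) \<ge> 2"
    and "simple_system (roots_A :: (real^'n) set) \<Delta>"
    and "prime p" and "CHAR('k::alg_closed_field) = p" and "e \<ge> 1" and "q = p ^ e"
    and algebraic_over_prime_field: "\<forall>x::'k. \<exists>m\<ge>1. x ^ (p ^ m) = x"
    and "good_prime (roots_A :: (real^'n) set) \<Delta> p"
    and "regular_char TYPE('k) (roots_A :: (real^'n) set)"
  shows "(\<forall>J. J \<subset> extended_simple roots_A \<Delta> \<longrightarrow>
            real (card (orbits_of_genus_id q J :: ('k^'n^'n) set set)) =
              (\<Sum>S | S \<subset> extended_simple roots_A \<Delta> \<and> weyl_equiv roots_A S J.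
                 real (num_solutions roots_A \<Delta> S q)) / real (lattice_index (roots_A :: (real^'n) set))) \<and>
         (\<forall>r :: nat \<Rightarrow> nat. (\<Sum>i=1..CARD('n). i * r i) = CARD('n) \<longrightarrow>
            real (card (split_orbits_of_partition \<Delta> q r :: ('k^'n^'n) set set)) =
              (\<Prod>k=1..(\<Sum>i=1..CARD('n). r i) - 1. real q - real k) /
              (\<Prod>i=1..CARD('n). fact (r i)))"
proof -
  obtain \<sigma> :: "nat \<Rightarrow> 'n" where \<sigma>: "bij_betw \<sigma> {..<CARD('n)} UNIV"
    "\<Delta> = (\<lambda>i. axis (\<sigma> i) 1 - axis (\<sigma> (Suc i)) 1) ` {i. Suc i < CARD('n)}"
    using simple_system_A_enumeration[OF assms(2)] by blast
  interpret A: ordered_simple_system \<Delta> \<sigma> "CARD('n)"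
    by (unfold_locales) (use assms \<sigma> in auto)
  interpret K: finite_subfield p e q "{a :: 'k. a ^ q = a}"
    by (unfold_locales) (use assms in auto)
  have N: "of_nat (CARD('n)) \<noteq> (0 :: 'k)"
    using regular_char_imp_not_dvd[OF assms(9,1)] .
  show ?thesis
  proof (intro conjI allI impI)
    fix J assume J: "J \<subset> extended_simple roots_A \<Delta>"
    have "real (card (orbits_of_genus_id q J :: ('k^'n^'n) set set)) =
      (\<Prod>k=1..size (block_type (conn J)) - 1. real q - real k) /
      (\<Prod>x\<in>set_mset (block_type (conn J)). fact (count (block_type (conn J)) x))"
      by (rule K.real_card_orbits_of_genus_id)
        (use A.block_type_subset(2,3)[OF J] N in \<open>simp_all only: not_False_eq_True\<close>)
    also have "\<dots> = (\<Sum>S | S \<subset> extended_simple roots_A \<Delta> \<and> weyl_equiv roots_A S J.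
                 real (num_solutions roots_A \<Delta> S q)) / real (lattice_index (roots_A :: (real^'n) set))"
      using K.q_gt_1 by (intro A.sum_num_solutions[OF J, symmetric]) simp
    finally show "real (card (orbits_of_genus_id q J :: ('k^'n^'n) set set)) =
      (\<Sum>S | S \<subset> extended_simple roots_A \<Delta> \<and> weyl_equiv roots_A S J.
                 real (num_solutions roots_A \<Delta> S q)) / real (lattice_index (roots_A :: (real^'n) set))" .
  next
    fix r :: "nat \<Rightarrow> nat" assume r: "(\<Sum>i=1..CARD('n). i * r i) = CARD('n)"
    let ?N = "CARD('n)"
    define M where "M = (\<Sum>i=1..?N. replicate_mset (r i) i)"
    have cM: "count M i = (if i \<in> {1..?N} then r i else 0)" for i
    proof -
      have "count M i = (\<Sum>j=1..?N. if j = i then r j else 0)"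
        unfolding M_def count_sum by (intro sum.cong) auto
      then show ?thesis by simp
    qed
    have sizeM: "size M = (\<Sum>i=1..?N. r i)" by (simp add: M_def size_multiset_sum)
    have sumM: "sum_mset M = ?N"
    proof -
      have "sum_mset (\<Sum>i\<in>I. replicate_mset (r i) i) = (\<Sum>i\<in>I. i * r i)" if "finite I" for I
        using that by (induction I rule: finite_induct) (auto simp: sum_mset_replicate_mset mult.commute)
      then show ?thesis using r by (simp add: M_def)
    qed
    obtain xs where xs: "mset xs = M" using ex_mset by blast
    have x0: "0 \<notin> set xs" using cM[of 0] xs by (simp add: count_eq_zero_iff flip: set_mset_mset)
    have xsum: "sum_list xs = ?N" using sumM xs by (metis sum_mset_sum_list)
    \<comment> \<open>Any ordering of the parts, laid on the cycle opened at edge 0, gives a proper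
      subset of the prescribed type.\<close>
    define J where "J = A.arc 0 xs"
    have J: "J \<subset> extended_simple roots_A \<Delta>" "block_type (conn J) = M"
      using A.arc_psubset[of 0 xs] A.block_type_arc[of 0 xs] x0 xsum xs by (simp_all add: J_def)
    have "(split_orbits_of_partition \<Delta> q r :: ('k^'n^'n) set set) = orbits_of_genus_id q J"
    proof (intro equalityI subsetI)
      fix X assume "X \<in> (split_orbits_of_partition \<Delta> q r :: ('k^'n^'n) set set)"
      then obtain x :: "'k^'n^'n" and I where x: "X = orbit q x" "x \<in> sl_F q" "has_genus_id q I x"
        "has_genus_partition q r x"
        unfolding split_orbits_of_partition_def by blast
      obtain g d where gd: "g \<in> SL_F q" "Ad g x = diag d" "range d \<subseteq> {a. a ^ q = a}" "(\<Sum>a\<in>UNIV. d a) = 0"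
        by (rule K.has_genus_id_imp_diag[OF x(3,2)])
      have "charpoly x = charpoly (diag d :: 'k^'n^'n)"
        using charpoly_Ad[OF K.SL_F_SL[OF gd(1)], of x] by (simp add: gd(2))
      then have "mult_type (entries d) = M"
        using K.has_genus_partition_iff[OF gd(3) _ cM] x(4) by blast
      \<comment> \<open>The set \<open>I\<close> witnessing that x is split may differ from
        \<open>J\<close>. Rearranging the spectrum makes equal entries sit exactly on the components
        of \<open>J\<close>, within the same orbit.\<close>
      then obtain d' :: "'n \<Rightarrow> 'k" where d': "entries d' = entries d" "\<forall>a b. d' a = d' b \<longleftrightarrow> (a, b) \<in> conn J"
        using exists_entries_of_block_type[OF equiv_conn, of "entries d" J] J(2) by auto
      have "X = orbit q (diag d')"
        using K.orbit_Ad[OF gd(1), of x] K.orbit_diag_eq_iff[of d d'] d'(1) by (simp add: x(1) gd(2))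
      moreover have "range d' \<subseteq> {a. a ^ q = a}"
        using gd(3) arg_cong[OF d'(1), of set_mset] by simp
      moreover have "(\<Sum>a\<in>UNIV. d' a) = 0"
        using gd(4) arg_cong[OF d'(1), of sum_mset] by (simp add: sum_unfold_sum_mset)
      ultimately show "X \<in> orbits_of_genus_id q J"
        unfolding K.orbits_of_genus_id_eq using d'(2) by blast
    next
      fix X assume "X \<in> (orbits_of_genus_id q J :: ('k^'n^'n) set set)"
      then obtain d :: "'n \<Rightarrow> 'k" where d: "X = orbit q (diag d)" "range d \<subseteq> {a. a ^ q = a}"
        "(\<Sum>a\<in>UNIV. d a) = 0" "\<forall>a b. d a = d b \<longleftrightarrow> (a, b) \<in> conn J"
        unfolding K.orbits_of_genus_id_eq by blast
      have "has_genus_partition q r (diag d :: 'k^'n^'n)"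
        using K.has_genus_partition_iff[OF d(2) refl cM] mult_type_entries[OF d(4)] J(2) by simp
      moreover have "has_genus_id q J (diag d :: 'k^'n^'n)"
        using d(4) by (intro K.has_genus_id_diag) blast
      moreover have "(diag d :: 'k^'n^'n) \<in> sl_F q" using d(2,3) by (simp add: K.diag_in_sl_F_iff)
      ultimately show "X \<in> split_orbits_of_partition \<Delta> q r"
        unfolding split_orbits_of_partition_def d(1) using J(1) K.semisimple_diag by blast
    qed
    then have "real (card (split_orbits_of_partition \<Delta> q r :: ('k^'n^'n) set set)) =
      (\<Prod>k=1..size M - 1. real q - real k) / (\<Prod>x\<in>set_mset M. fact (count M x))"
      using K.real_card_orbits_of_genus_id[of J, unfolded J(2)]
        A.block_type_subset(2,3)[OF J(1), unfolded J(2)] N by (simp only: not_False_eq_True)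
    \<comment> \<open>Absent part sizes contribute 0! = 1.\<close>
    also have "(\<Prod>x\<in>set_mset M. fact (count M x)) = (\<Prod>i=1..?N. fact (count M i) :: real)"
      by (rule prod.mono_neutral_left) (auto simp: cM not_in_iff simp flip: count_greater_zero_iff split: if_splits)
    also have "\<dots> = (\<Prod>i=1..?N. fact (r i))" by (rule prod.cong) (simp_all add: cM)
    finally show "real (card (split_orbits_of_partition \<Delta> q r :: ('k^'n^'n) set set)) =
              (\<Prod>k=1..(\<Sum>i=1..CARD('n). r i) - 1. real q - real k) /
              (\<Prod>i=1..CARD('n). fact (r i))"
      by (simp only: sizeM)
  qed
qed

end
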